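(* Let $G$ be a finite non-empty graph and let $k$ be a positive integer. Then the following three conditions are equivalent: (1) $G$ has a bramble of order $\geq k$; (2) $G$ has a tangle of order $\geq k$; (3) $G$ has ab-tree-cut width $\geq k$.
   Context: Graphs are finite and undirected; parallel edges are allowed, loops are not. A near-partition of a set $\Omega$ is a family of pairwise disjoint (possibly empty) subsets of $\Omega$ with union $\Omega$. For $X\subseteq V(G)$, $\delta(X)$ is the set of edges of $G$ with exactly one endpoint in $X$. ab-tree-cut width. A tree-cut decomposition of $G$ is a pair $\mathcal{T}=(T,\mathcal{X})$ where $T$ is a tree and $\mathcal{X}=\{X_t : t\in V(T)\}$ is a near-partition of $V(G)$ indexed by the nodes of $T$; $X_t$ is the bag of $t$. For an edge $st$ of $T$, $\mathrm{adh}(st)$ is the set of edges $uv$ of $G$ such that the node whose bag contains $u$ and the node whose bag contains $v$ lie in different components of $T-st$. The edge $st$ is bold if $|\mathrm{adh}(st)|\geq 3$ and thin otherwise. For a node $t$, $\mathrm{adh}(t)$ is the union of the sets $\mathrm{adh}(st)$ over all bold edges $st$ of $T$ incident to $t$. The adhesion-width of $\mathcal{T}$ is $\max_{t\in V(T)}|\mathrm{adh}(t)|$ and the bag-width of $\mathcal{T}$ is $\max_{t\in V(T)}|X_t|$. The ab-tree-cut width of $G$ is the least number $k$ such that $G$ has a tree-cut decomposition with adhesion-width $\leq k$ and bag-width $\leq k$. Brambles. Two vertices $u,v$ of $G$ are 3-edge-connected in $G$ if $u=v$ or there are three pairwise edge-disjoint paths in $G$ connecting $u$ and $v$; a set $K\subseteq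 V(G)$ is 3-edge-connected in $G$ if its elements are pairwise 3-edge-connected in $G$. A slab in $G$ is a pair $(H,K)$ where $H$ is a connected subgraph of $G$ and $K$ (the core) is a non-empty subset of $V(H)$ that is 3-edge-connected in $G$. Two slabs touch if their cores intersect. A bramble in $G$ is a family of pairwise touching slabs. A set $F\subseteq E(G)$ disconnects a slab $(H,K)$ if there are $u,v\in K$ lying in different connected components of $H-(F\cap E(H))$. $F$ is a disconnecting set for a bramble $\mathcal{B}$ if it disconnects every slab in $\mathcal{B}$. The adhesion-order of $\mathcal{B}$ is the minimum size of a disconnecting set for $\mathcal{B}$, or $+\infty$ if none exists. The bag-order of $\mathcal{B}$ is $\min_{(H,K)\in\mathcal{B}}|K|$, or $+\infty$ if $\mathcal{B}$ is empty. The order of $\mathcal{B}$ is the minimum of its adhesion-order and its bag-order. Tangles. A separation of $G$ is a near-partition $\{A,B\}$ of $V(G)$ into two sides; its order is $|\delta(A)|=|\delta(B)|$. It has two associated oriented separations $(A,B)$ and $(B,A)$. For a set $\mathcal{S}$ of separations, $\vec{\mathcal{S}}$ is the set of all oriented separations associated with elements of $\mathcal{S}$, and an orientation of $\mathcal{S}$ is a subset of $\vec{\mathcal{S}}$ containing precisely one oriented separation associated with each element of $\mathcal{S}$. An orientation $\mathcal{L}$ avoids a collection $\Sigma$ of sets of oriented separations if no subset of $\mathcal{L}$ belongs to $\Sigma$. A set $\sigma$ of oriented separations is consistent if it does not contain $(A,B)$ and $(C,D)$ with $B\cap D=\emptyset$. A star is a non-empty consistent set $\sigma$ of oriented separations such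 that $A\cap C=\emptyset$ for all distinct $(A,B),(C,D)\in\sigma$. For positive integers $a,b$, let $\mathcal{S}_a$ be the set of all separations of $G$ of order $<a$, and let $\Sigma_{a,b}$ be the set of all stars $\sigma\subseteq\vec{\mathcal{S}}_a$ such that $\left|\bigcup\{\delta(A) : (A,B)\in\sigma,\ |\delta(A)|\geq 3\}\right|<a$ and $\left|\bigcap\{B : (A,B)\in\sigma\}\right|<b$. An $(a,b)$-tangle in $G$ is a consistent orientation of $\mathcal{S}_a$ that avoids $\Sigma_{a,b}$; it is said to have order $\min(a,b)$.
   Formalization: For k = 2 the implications from (2) to (1) and (3) are dropped, since they fail: two vertices joined by two parallel edges have a (2,2)-tangle but no bramble of order 2 and ab-tree-cut width 1; (1)⇔(3) and (1)⇒(2) are kept for all k. *)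

theory Defs
  imports Main "HOL-Library.Extended_Nat"
begin

section \<open>Multigraphs\<close>

text \<open>Edges are named objects, so that parallel edges are distinct elements of \<open>edges G\<close>.\<close>

record ('v, 'e) mgraph =
  verts :: "'v set"
  edges :: "'e set"
  ends :: "'e \<Rightarrow> 'v set"

definition is_graph :: "('v, 'e) mgraph \<Rightarrow> bool" where
  "is_graph G \<longleftrightarrow> finite (verts G) \<and> finite (edges G) \<and>
     (\<forall>e\<in>edges G. ends G e \<subseteq> verts G \<and> card (ends G e) = 2)"

definition subgraph :: "('v, 'e) mgraph \<Rightarrow> ('v, 'e) mgraph \<Rightarrow> bool" where
  "subgraph H G \<longleftrightarrow> is_graph H \<and> verts H \<subseteq> verts G \<and> edges H \<subseteq> edges G \<and> ends H = ends G"

definition del_edges :: "('v, 'e) mgraph \<Rightarrow> 'e set \<Rightarrow> ('v, 'e) mgraph" where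
  "del_edges G F = G\<lparr>edges := edges G - F\<rparr>"

definition cut :: "('v, 'e) mgraph \<Rightarrow> 'v set \<Rightarrow> 'e set" where
  "cut G X = {e \<in> edges G. card (ends G e \<inter> X) = 1}"

definition walk :: "('v, 'e) mgraph \<Rightarrow> 'v list \<Rightarrow> 'e list \<Rightarrow> bool" where
  "walk G vs es \<longleftrightarrow> length vs = Suc (length es) \<and> set vs \<subseteq> verts G \<and> set es \<subseteq> edges G \<and>
     (\<forall>i<length es. ends G (es ! i) = {vs ! i, vs ! Suc i})"

definition path_between :: "('v, 'e) mgraph \<Rightarrow> 'v \<Rightarrow> 'v \<Rightarrow> 'v list \<Rightarrow> 'e list \<Rightarrow> bool" where
  "path_between G u v vs es \<longleftrightarrow> walk G vs es \<and> distinct vs \<and> hd vs = u \<and> last vs = v"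

text \<open>Two parallel edges form a cycle of length 2.\<close>

definition is_cycle :: "('v, 'e) mgraph \<Rightarrow> 'v list \<Rightarrow> 'e list \<Rightarrow> bool" where
  "is_cycle G vs es \<longleftrightarrow> walk G vs es \<and> 2 \<le> length es \<and> hd vs = last vs \<and>
     distinct (tl vs) \<and> distinct es"

definition conn_comp :: "('v, 'e) mgraph \<Rightarrow> 'v \<Rightarrow> 'v set" where
  "conn_comp G u = {v. \<exists>vs es. path_between G u v vs es}"

definition connected_graph :: "('v, 'e) mgraph \<Rightarrow> bool" where
  "connected_graph G \<longleftrightarrow> verts G \<noteq> {} \<and>
     (\<forall>u\<in>verts G. \<forall>v\<in>verts G. \<exists>vs es. path_between G u v vs es)"

definition is_tree :: "('v, 'e) mgraph \<Rightarrow> bool" where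
  "is_tree T \<longleftrightarrow> is_graph T \<and> connected_graph T \<and> \<not> (\<exists>vs es. is_cycle T vs es)"


section \<open>Tree-cut decompositions\<close>

definition near_partition :: "'v set \<Rightarrow> 'i set \<Rightarrow> ('i \<Rightarrow> 'v set) \<Rightarrow> bool" where
  "near_partition \<Omega> I X \<longleftrightarrow>
     (\<forall>i\<in>I. \<forall>j\<in>I. i \<noteq> j \<longrightarrow> X i \<inter> X j = {}) \<and> (\<Union>i\<in>I. X i) = \<Omega>"

definition tree_cut_decomp ::
  "('v, 'e) mgraph \<Rightarrow> ('t, 'f) mgraph \<Rightarrow> ('t \<Rightarrow> 'v set) \<Rightarrow> bool" where
  "tree_cut_decomp G T X \<longleftrightarrow> is_tree T \<and> near_partition (verts G) (verts T) X"

definition adh ::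
  "('v, 'e) mgraph \<Rightarrow> ('t, 'f) mgraph \<Rightarrow> ('t \<Rightarrow> 'v set) \<Rightarrow> 'f \<Rightarrow> 'e set" where
  "adh G T X f = {e \<in> edges G. \<exists>u v. ends G e = {u, v} \<and>
     (\<exists>s\<in>verts T. \<exists>t\<in>verts T. u \<in> X s \<and> v \<in> X t \<and>
        conn_comp (del_edges T {f}) s \<noteq> conn_comp (del_edges T {f}) t)}"

definition bold ::
  "('v, 'e) mgraph \<Rightarrow> ('t, 'f) mgraph \<Rightarrow> ('t \<Rightarrow> 'v set) \<Rightarrow> 'f \<Rightarrow> bool" where
  "bold G T X f \<longleftrightarrow> card (adh G T X f) \<ge> 3"

definition adh_node ::
  "('v, 'e) mgraph \<Rightarrow> ('t, 'f) mgraph \<Rightarrow> ('t \<Rightarrow> 'v set) \<Rightarrow> 't \<Rightarrow> 'e set" where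
  "adh_node G T X t = \<Union> {adh G T X f | f. f \<in> edges T \<and> t \<in> ends T f \<and> bold G T X f}"

definition adhesion_width ::
  "('v, 'e) mgraph \<Rightarrow> ('t, 'f) mgraph \<Rightarrow> ('t \<Rightarrow> 'v set) \<Rightarrow> nat" where
  "adhesion_width G T X = Max ((\<lambda>t. card (adh_node G T X t)) ` verts T)"

definition bag_width :: "('t, 'f) mgraph \<Rightarrow> ('t \<Rightarrow> 'v set) \<Rightarrow> nat" where
  "bag_width T X = Max ((\<lambda>t. card (X t)) ` verts T)"

text \<open>Trees are finite, so restricting their nodes and edges to natural numbers loses nothing.\<close>

definition ab_tree_cut_width :: "('v, 'e) mgraph \<Rightarrow> nat" where
  "ab_tree_cut_width G =
     (LEAST k. \<exists>(T :: (nat, nat) mgraph) X.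
        tree_cut_decomp G T X \<and> adhesion_width G T X \<le> k \<and> bag_width T X \<le> k)"


section \<open>Brambles\<close>

definition three_edge_connected :: "('v, 'e) mgraph \<Rightarrow> 'v \<Rightarrow> 'v \<Rightarrow> bool" where
  "three_edge_connected G u v \<longleftrightarrow> u = v \<or>
     (\<exists>vs1 es1 vs2 es2 vs3 es3.
        path_between G u v vs1 es1 \<and> path_between G u v vs2 es2 \<and> path_between G u v vs3 es3 \<and>
        set es1 \<inter> set es2 = {} \<and> set es1 \<inter> set es3 = {} \<and> set es2 \<inter> set es3 = {})"

definition three_edge_connected_set :: "('v, 'e) mgraph \<Rightarrow> 'v set \<Rightarrow> bool" where
  "three_edge_connected_set G K \<longleftrightarrow> K \<subseteq> verts G \<and> (\<forall>u\<in>K. \<forall>v\<in>K. three_edge_connected G u v)"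

type_synonym ('v, 'e) slab = "('v, 'e) mgraph \<times> 'v set"

fun is_slab :: "('v, 'e) mgraph \<Rightarrow> ('v, 'e) slab \<Rightarrow> bool" where
  "is_slab G (H, K) \<longleftrightarrow> subgraph H G \<and> connected_graph H \<and>
     K \<noteq> {} \<and> K \<subseteq> verts H \<and> three_edge_connected_set G K"

fun touch :: "('v, 'e) slab \<Rightarrow> ('v, 'e) slab \<Rightarrow> bool" where
  "touch (H, K) (H', K') \<longleftrightarrow> K \<inter> K' \<noteq> {}"

definition bramble :: "('v, 'e) mgraph \<Rightarrow> ('v, 'e) slab set \<Rightarrow> bool" where
  "bramble G \<B> \<longleftrightarrow> (\<forall>s\<in>\<B>. is_slab G s) \<and> (\<forall>s\<in>\<B>. \<forall>s'\<in>\<B>. touch s s')"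

fun disconnects :: "'e set \<Rightarrow> ('v, 'e) slab \<Rightarrow> bool" where
  "disconnects F (H, K) \<longleftrightarrow>
     (\<exists>u\<in>K. \<exists>v\<in>K. conn_comp (del_edges H (F \<inter> edges H)) u \<noteq> conn_comp (del_edges H (F \<inter> edges H)) v)"

definition disconnecting_set ::
  "('v, 'e) mgraph \<Rightarrow> ('v, 'e) slab set \<Rightarrow> 'e set \<Rightarrow> bool" where
  "disconnecting_set G \<B> F \<longleftrightarrow> F \<subseteq> edges G \<and> (\<forall>s\<in>\<B>. disconnects F s)"

text \<open>Infima of empty families in \<^typ>\<open>enat\<close> are \<open>\<infinity>\<close>, as required in the next two definitions.\<close>

definition adhesion_order :: "('v, 'e) mgraph \<Rightarrow> ('v, 'e) slab set \<Rightarrow> enat" where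
  "adhesion_order G \<B> = (INF F\<in>{F. disconnecting_set G \<B> F}. enat (card F))"

definition bag_order :: "('v, 'e) slab set \<Rightarrow> enat" where
  "bag_order \<B> = (INF s\<in>\<B>. enat (card (snd s)))"

definition bramble_order :: "('v, 'e) mgraph \<Rightarrow> ('v, 'e) slab set \<Rightarrow> enat" where
  "bramble_order G \<B> = min (adhesion_order G \<B>) (bag_order \<B>)"


section \<open>Tangles\<close>

definition separations :: "('v, 'e) mgraph \<Rightarrow> 'v set set set" where
  "separations G = {{A, B} | A B. A \<inter> B = {} \<and> A \<union> B = verts G}"

text \<open>Both sides of a separation have the same cut, so quantifying over them is harmless.\<close>

definition separations_below :: "('v, 'e) mgraph \<Rightarrow> nat \<Rightarrow> 'v set set set" where
  "separations_below G a = {S \<in> separations G. \<forall>A\<in>S. card (cut G A) < a}"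

definition oriented :: "'v set set set \<Rightarrow> ('v set \<times> 'v set) set" where
  "oriented \<S> = {(A, B). {A, B} \<in> \<S>}"

definition orientation :: "'v set set set \<Rightarrow> ('v set \<times> 'v set) set \<Rightarrow> bool" where
  "orientation \<S> L \<longleftrightarrow> L \<subseteq> oriented \<S> \<and> (\<forall>S\<in>\<S>. \<exists>!p. p \<in> L \<and> p \<in> oriented {S})"

definition avoids :: "'p set \<Rightarrow> 'p set set \<Rightarrow> bool" where
  "avoids L \<Sigma> \<longleftrightarrow> (\<forall>\<sigma>. \<sigma> \<subseteq> L \<longrightarrow> \<sigma> \<notin> \<Sigma>)"

definition consistent :: "('v set \<times> 'v set) set \<Rightarrow> bool" where
  "consistent \<sigma> \<longleftrightarrow> \<not> (\<exists>A B C D. (A, B) \<in> \<sigma> \<and> (C, D) \<in> \<sigma> \<and> B \<inter> D = {})"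

definition is_star :: "('v set \<times> 'v set) set \<Rightarrow> bool" where
  "is_star \<sigma> \<longleftrightarrow> \<sigma> \<noteq> {} \<and> consistent \<sigma> \<and>
     (\<forall>A B C D. (A, B) \<in> \<sigma> \<longrightarrow> (C, D) \<in> \<sigma> \<longrightarrow> (A, B) \<noteq> (C, D) \<longrightarrow> A \<inter> C = {})"

definition forbidden_stars ::
  "('v, 'e) mgraph \<Rightarrow> nat \<Rightarrow> nat \<Rightarrow> ('v set \<times> 'v set) set set" where
  "forbidden_stars G a b =
     {\<sigma>. \<sigma> \<subseteq> oriented (separations_below G a) \<and> is_star \<sigma> \<and>
        card (\<Union> {cut G A | A B. (A, B) \<in> \<sigma> \<and> card (cut G A) \<ge> 3}) < a \<and>
        card (\<Inter> {B | A B. (A, B) \<in> \<sigma>}) < b}"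

definition tangle ::
  "('v, 'e) mgraph \<Rightarrow> nat \<Rightarrow> nat \<Rightarrow> ('v set \<times> 'v set) set \<Rightarrow> bool" where
  "tangle G a b L \<longleftrightarrow> orientation (separations_below G a) L \<and> consistent L \<and>
     avoids L (forbidden_stars G a b)"


section \<open>Conditions of the duality theorem\<close>

definition has_bramble_of_order_ge :: "('v, 'e) mgraph \<Rightarrow> nat \<Rightarrow> bool" where
  "has_bramble_of_order_ge G k \<longleftrightarrow> (\<exists>\<B>. bramble G \<B> \<and> bramble_order G \<B> \<ge> enat k)"

text \<open>Pitfall: for \<open>a \<le> 2\<close> a cut with at least \<open>a\<close> and at most two edges is not oriented by an
  \<open>(a, b)\<close>-tangle although it is thin in tree-cut decompositions. The graph with two vertices
  and two parallel edges therefore has a \<open>(2, 2)\<close>-tangle, but ab-tree-cut width \<open>1\<close> and no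
  bramble of order \<open>2\<close>: having a tangle of order at least \<open>k\<close> implies the other two
  conditions only for \<open>k \<noteq> 2\<close>.\<close>

definition has_tangle_of_order_ge :: "('v, 'e) mgraph \<Rightarrow> nat \<Rightarrow> bool" where
  "has_tangle_of_order_ge G k \<longleftrightarrow>
     (\<exists>a b L. 0 < a \<and> 0 < b \<and> tangle G a b L \<and> min a b \<ge> k)"

end

theory Submission
  imports Defs "HOL-Library.Disjoint_Sets" "HOL-Library.Countable"
begin

text \<open>
  All three conditions are compared with one recursive notion: a vertex set is dismantlable if a
  rooted piece of a tree-cut decomposition of adhesion- and bag-width less than \<open>k\<close> has it as the union
  of its bags. By induction along such a piece, a bramble of order at least \<open>k\<close> always has a core that
  avoids the set and, if \<open>k \<ge> 3\<close>, a tangle of order at least \<open>k\<close> regards the set as its small side; so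
  neither exists if \<open>V(G)\<close> is dismantlable. For \<open>k = 1\<close> all three conditions always hold.

  Conversely, suppose that \<open>V(G)\<close> is not dismantlable. Enlarge the family of sets allowed as leaves
  as long as possible while keeping it closed under subsets and \<open>V(G)\<close> not dismantlable. Two disjoint
  sets \<open>A\<close>, \<open>B\<close> outside the resulting family \<open>L\<close>, chosen minimal, could be split along a minimum cut
  separating them: submodularity shows that this cut turns the decompositions that use \<open>A\<close>
  respectively \<open>B\<close> as a leaf into decompositions of its two sides, a contradiction. So the sets outside
  \<open>L\<close> pairwise intersect. Cutting off sets of \<open>L\<close> with boundary at most 2 in an optimal way leaves a
  3-edge-connected set \<open>Q\<close>, and each set cut off is connected and attaches to \<open>Q\<close> only. Moving it
  wholesale to a neighbour in \<open>Q\<close> shows that, for every set \<open>F\<close> of fewer than \<open>k\<close> edges, some component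
  of \<open>G - F\<close> contains at least \<open>k\<close> vertices of \<open>Q\<close> and extends to a set outside \<open>L\<close>. These components form
  a bramble.
\<close>

section \<open>Connectivity\<close>

text \<open>The obstacle is the threshold 3. Cuts with at most two edges are free, so the size of
  \<open>bold_cut\<close> is not submodular and decompositions cannot be uncrossed directly.
  Uncrossing is done with ordinary cuts, applied only to cuts that are bold beforehand; thin ones
  merely have to stay thin, for which posimodularity suffices. On the bramble side the threshold
  reappears as 3-edge-connectedness: a thin cut cannot split a core, so an edge set that contains
  the bold cuts of a node controls all cuts at that node.

  A leaf from \<open>L\<close> is a placeholder for a set that is not decomposed further, whatever
  its size. \<open>L\<close> has to be closed under subsets because shifting a decomposition shrinks
  its leaves. The sets outside a maximal \<open>L\<close> behave like the big sides of a tangle, but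
  they are bare vertex sets; cores have to be found inside them, which is the purpose of
  \<open>Q\<close>. Menger's theorem turns the absence of thin cuts between vertices of
  \<open>Q\<close> into the three disjoint paths that a core requires.

  For tangles the bound 3 on \<open>k\<close> ensures that every thin cut is small enough to be
  oriented.\<close>

definition arcs :: "('v, 'e) mgraph \<Rightarrow> ('e \<times> 'v \<times> 'v) set" where
  "arcs G = {(e, x, y). e \<in> edges G \<and> ends G e = {x, y}}"

definition arc_rel :: "('e \<times> 'v \<times> 'v) set \<Rightarrow> ('v \<times> 'v) set" where
  "arc_rel R = snd ` R"

text \<open>Paths along an arbitrary set of arcs: the same notion serves for \<open>G\<close>, for
  the residual arcs \<open>arcs G - D\<close> and for the arcs of a flow \<open>D\<close>.\<close>

definition dpath :: "('e \<times> 'v \<times> 'v) set \<Rightarrow> 'v list \<Rightarrow> 'e list \<Rightarrow> bool" where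
  "dpath R vs es \<longleftrightarrow> length vs = Suc (length es) \<and> distinct vs \<and>
     (\<forall>i<length es. (es ! i, vs ! i, vs ! Suc i) \<in> R)"

text \<open>The reflexive closure relates every value to itself, so the start has to be required to
  be a vertex.\<close>

definition conn :: "('v, 'e) mgraph \<Rightarrow> 'v \<Rightarrow> 'v \<Rightarrow> bool" where
  "conn G u v \<longleftrightarrow> u \<in> verts G \<and> (u, v) \<in> (arc_rel (arcs G))\<^sup>*"

lemma arcs_iff [simp]: "(e, x, y) \<in> arcs G \<longleftrightarrow> e \<in> edges G \<and> ends G e = {x, y}"
  by (auto simp: arcs_def)

lemma arc_rel_iff: "(x, y) \<in> arc_rel R \<longleftrightarrow> (\<exists>e. (e, x, y) \<in> R)"
  by (force simp: arc_rel_def)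

lemma is_graph_arc:
  assumes "is_graph G" "e \<in> edges G" "ends G e = {x, y}"
  shows "x \<in> verts G" "y \<in> verts G" "x \<noteq> y"
  using assms by (force simp: is_graph_def card_2_iff)+

lemma is_graph_ends:
  assumes "is_graph G" "e \<in> edges G"
  obtains x y where "ends G e = {x, y}" "x \<noteq> y" "x \<in> verts G" "y \<in> verts G"
  using assms by (force simp: is_graph_def card_2_iff)

lemma arc_rel_step: "(u, x) \<in> (arc_rel R)\<^sup>* \<Longrightarrow> (e, x, y) \<in> R \<Longrightarrow> (u, y) \<in> (arc_rel R)\<^sup>*"
  by (meson arc_rel_iff rtrancl_into_rtrancl)

lemma dpath_Nil [simp]: "dpath R vs [] \<longleftrightarrow> (\<exists>v. vs = [v])"
  by (cases vs) (auto simp: dpath_def)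

lemma dpath_Cons:
  "dpath R (u # vs) (e # es) \<longleftrightarrow> vs \<noteq> [] \<and> u \<notin> set vs \<and> (e, u, hd vs) \<in> R \<and> dpath R vs es"
  (is "?l \<longleftrightarrow> ?r")
proof
  assume l: ?l
  then have ne: "vs \<noteq> []" by (auto simp: dpath_def)
  have "(es ! i, vs ! i, vs ! Suc i) \<in> R" if "i < length es" for i
    using l that unfolding dpath_def by (auto dest: spec[of _ "Suc i"])
  moreover have "(e, u, hd vs) \<in> R"
    using l ne unfolding dpath_def by (auto dest: spec[of _ 0] simp: hd_conv_nth)
  ultimately show ?r using l ne by (auto simp: dpath_def)
next
  assume ?r
  then show ?l
    by (auto simp: dpath_def hd_conv_nth less_Suc_eq_0_disj)
qed

lemma dpath_Cons_E:
  assumes "dpath R vs (e # es)"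
  obtains u ws where "vs = u # ws" "ws \<noteq> []" "u \<notin> set ws" "(e, u, hd ws) \<in> R" "dpath R ws es"
proof -
  obtain u ws where "vs = u # ws"
    using assms by (cases vs) (auto simp: dpath_def)
  then show ?thesis using assms that by (auto simp: dpath_Cons)
qed

lemma dpath_nonempty: "dpath R vs es \<Longrightarrow> vs \<noteq> []"
  by (auto simp: dpath_def)

lemma dpath_mono: "dpath R vs es \<Longrightarrow> R \<subseteq> S \<Longrightarrow> dpath S vs es"
  by (auto simp: dpath_def)

lemma dpath_drop:
  assumes "dpath R vs es" "n < length vs"
  shows "dpath R (drop n vs) (drop n es)"
  using assms by (auto simp: dpath_def)

text \<open>If the new start already lies on the path, the path is cut at that occurrence instead of
  being extended; so no vertex is repeated.\<close>

lemma reachable_imp_dpath: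
  assumes "(u, v) \<in> (arc_rel R)\<^sup>*"
  shows "\<exists>vs es. dpath R vs es \<and> hd vs = u \<and> last vs = v"
  using assms
proof (induction rule: converse_rtrancl_induct)
  case base
  have "dpath R [v] [] \<and> hd [v] = v \<and> last [v] = v" by simp
  then show ?case by blast
next
  case (step u w)
  then obtain e vs es where e: "(e, u, w) \<in> R" and p: "dpath R vs es" "hd vs = w" "last vs = v"
    by (auto simp: arc_rel_iff)
  show ?case
  proof (cases "u \<in> set vs")
    case True
    then obtain n where n: "n < length vs" "vs ! n = u" by (auto simp: in_set_conv_nth)
    have "dpath R (drop n vs) (drop n es) \<and> hd (drop n vs) = u \<and> last (drop n vs) = v"
      using p n by (auto simp: dpath_drop hd_drop_conv_nth)
    then show ?thesis by blast
  next
    case False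
    have "vs \<noteq> []" using p(1) by (rule dpath_nonempty)
    then have "dpath R (u # vs) (e # es) \<and> hd (u # vs) = u \<and> last (u # vs) = v"
      using p e False by (auto simp: dpath_Cons)
    then show ?thesis by blast
  qed
qed

lemma dpath_imp_reachable:
  "dpath R vs es \<Longrightarrow> (hd vs, last vs) \<in> (arc_rel R)\<^sup>*"
proof (induction es arbitrary: vs)
  case (Cons e es)
  then obtain u ws where "vs = u # ws" "ws \<noteq> []" "(e, u, hd ws) \<in> R" "dpath R ws es"
    by (auto elim: dpath_Cons_E)
  with Cons.IH[of ws] show ?case
    by simp (meson arc_rel_iff converse_rtrancl_into_rtrancl)
qed auto

lemma path_between_iff_dpath:
  assumes "is_graph G"
  shows "path_between G u v vs es \<longleftrightarrow> dpath (arcs G) vs es \<and> hd vs = u \<and> last vs = v \<and> u \<in> verts G"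
    (is "?l \<longleftrightarrow> ?r")
proof
  assume l: ?l
  then have ne: "vs \<noteq> []" by (auto simp: path_between_def walk_def)
  with l have "u \<in> verts G" by (auto simp: path_between_def walk_def)
  with l show ?r by (auto simp: path_between_def walk_def dpath_def)
next
  assume r: ?r
  then have ne: "vs \<noteq> []" by (auto simp: dpath_def)
  have arc: "(es ! i, vs ! i, vs ! Suc i) \<in> arcs G" if "i < length es" for i
    using r that by (simp add: dpath_def del: arcs_iff)
  have "vs ! i \<in> verts G" if "i < length vs" for i
  proof (cases i)
    case 0 then show ?thesis using r ne by (simp add: hd_conv_nth)
  next
    case (Suc j) then show ?thesis using arc[of j] that r is_graph_arc(2)[OF assms]
      by (auto simp: dpath_def)
  qed
  then have "set vs \<subseteq> verts G" by (auto simp: in_set_conv_nth)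
  moreover have "set es \<subseteq> edges G" using arc by (auto simp: in_set_conv_nth)
  ultimately show ?l using r arc by (auto simp: path_between_def walk_def dpath_def)
qed

lemma ex_path_iff_conn:
  assumes "is_graph G"
  shows "(\<exists>vs es. path_between G u v vs es) \<longleftrightarrow> conn G u v"
  using reachable_imp_dpath[of u v "arcs G"] dpath_imp_reachable[of "arcs G"]
  unfolding path_between_iff_dpath[OF assms] conn_def by metis

lemma conn_comp_eq: "is_graph G \<Longrightarrow> conn_comp G u = {v. conn G u v}"
  by (simp add: conn_comp_def ex_path_iff_conn)

lemma conn_refl: "u \<in> verts G \<Longrightarrow> conn G u u"
  by (simp add: conn_def)

lemma conn_verts:
  assumes "is_graph G" "conn G u v"
  shows "u \<in> verts G" "v \<in> verts G"
proof -
  show u: "u \<in> verts G" using assms by (simp add: conn_def)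
  have "(u, v) \<in> (arc_rel (arcs G))\<^sup>*" using assms by (simp add: conn_def)
  then show "v \<in> verts G" using u
    by (induction) (auto simp: arc_rel_iff dest: is_graph_arc(2)[OF assms(1)])
qed

lemma conn_sym:
  assumes "is_graph G" "conn G u v" shows "conn G v u"
proof -
  have "sym (arc_rel (arcs G))" by (auto simp: sym_def arc_rel_iff insert_commute)
  then have "(v, u) \<in> (arc_rel (arcs G))\<^sup>*"
    using assms(2) by (metis conn_def sym_rtrancl symD)
  then show ?thesis using conn_verts(2)[OF assms] by (simp add: conn_def)
qed

lemma conn_trans: "conn G u v \<Longrightarrow> conn G v w \<Longrightarrow> conn G u w"
  by (auto simp: conn_def)

lemma conn_step:
  "conn G u v \<Longrightarrow> e \<in> edges G \<Longrightarrow> ends G e = {v, w} \<Longrightarrow> conn G u w"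
  using arc_rel_step[of u v "arcs G" e w] by (simp add: conn_def)

lemma conn_induct [consumes 1, case_names refl step]:
  assumes "conn G u v" "P u"
    "\<And>x y e. conn G u x \<Longrightarrow> e \<in> edges G \<Longrightarrow> ends G e = {x, y} \<Longrightarrow> P x \<Longrightarrow> P y"
  shows "P v"
proof -
  have u: "u \<in> verts G" and "(u, v) \<in> (arc_rel (arcs G))\<^sup>*" using assms(1) by (auto simp: conn_def)
  from this(2) show ?thesis
  proof (induction)
    case base then show ?case using assms(2) .
  next
    case (step y z)
    then show ?case using assms(3)[of y _ z] u by (auto simp: arc_rel_iff conn_def)
  qed
qed

lemma conn_comp_eq_iff:
  assumes "is_graph G" "u \<in> verts G" "v \<in> verts G"
  shows "conn_comp G u = conn_comp G v \<longleftrightarrow> conn G u v"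
  unfolding conn_comp_eq[OF assms(1)]
  using assms by (auto intro: conn_sym conn_trans conn_refl)

lemma is_graph_del_edges: "is_graph G \<Longrightarrow> is_graph (del_edges G F)"
  by (simp add: is_graph_def del_edges_def)

lemma del_edges_simps [simp]:
  "verts (del_edges G F) = verts G" "edges (del_edges G F) = edges G - F"
  "ends (del_edges G F) = ends G"
  by (simp_all add: del_edges_def)

lemma connected_graph_iff:
  "is_graph G \<Longrightarrow>
    connected_graph G \<longleftrightarrow> verts G \<noteq> {} \<and> (\<forall>u\<in>verts G. \<forall>v\<in>verts G. conn G u v)"
  by (simp add: connected_graph_def ex_path_iff_conn)


section \<open>Cuts\<close>

text \<open>Reduces membership in a cut to a propositional condition on the two ends of an edge.
  Inclusions between cuts can then be checked edge by edge.\<close>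

lemma in_cut_iff:
  assumes "is_graph G" "e \<in> edges G" "ends G e = {x, y}"
  shows "e \<in> cut G X \<longleftrightarrow> (x \<in> X) \<noteq> (y \<in> X)"
proof -
  have "x \<noteq> y" using assms is_graph_arc(3)[of G e x y] by blast
  then have "{x, y} \<inter> X = (if x \<in> X then {x} else {}) \<union> (if y \<in> X then {y} else {})" by auto
  then show ?thesis using assms \<open>x \<noteq> y\<close> by (auto simp: cut_def)
qed

lemma cut_subset: "cut G X \<subseteq> edges G"
  by (auto simp: cut_def)

lemma finite_cut [simp]: "is_graph G \<Longrightarrow> finite (cut G X)"
  by (rule finite_subset[OF cut_subset]) (simp add: is_graph_def)

lemma cut_compl:
  assumes "is_graph G" shows "cut G (verts G - X) = cut G X"
proof -
  have "e \<in> cut G (verts G - X) \<longleftrightarrow> e \<in> cut G X" if e: "e \<in> edges G" for e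
  proof -
    obtain x y where "ends G e = {x, y}" "x \<in> verts G" "y \<in> verts G"
      using is_graph_ends[OF assms e] by metis
    then show ?thesis using in_cut_iff[OF assms e, of x y] by auto
  qed
  then show ?thesis using cut_subset[of G] by blast
qed

lemma cut_empty [simp]: "cut G {} = {}"
  by (simp add: cut_def)

lemma cut_verts: "is_graph G \<Longrightarrow> cut G (verts G) = {}"
  using cut_compl[of G "{}"] by simp

lemma conn_crosses_cut:
  assumes G: "is_graph G" and "conn H u v" "edges H \<subseteq> edges G" "ends H = ends G" "u \<in> X" "v \<notin> X"
  shows "\<exists>e\<in>edges H. e \<in> cut G X"
proof (rule ccontr)
  assume no: "\<not> ?thesis"
  from assms(2) have "v \<in> X"
  proof (induction rule: conn_induct)
    case (step x y e)
    then show ?case using no in_cut_iff[OF G, of e x y X] assms by auto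
  qed (use assms in auto)
  then show False using assms by simp
qed

text \<open>Double counting: an element counts up to twice on either side, and the two inclusions
  say that it never counts more often on the left. Both uncrossing inequalities below are
  instances.\<close>

lemma card_Un_le_if_exchange:
  assumes "finite C" "finite D" "A \<union> B \<subseteq> C \<union> D" "A \<inter> B \<subseteq> C \<inter> D"
  shows "card A + card B \<le> card C + card D"
proof -
  have f: "finite A" "finite B" using assms by (meson finite_UnI finite_Un finite_subset)+
  have "card A + card B = card (A \<union> B) + card (A \<inter> B)" using f by (rule card_Un_Int)
  also have "\<dots> \<le> card (C \<union> D) + card (C \<inter> D)"
    using assms by (intro add_mono card_mono) auto
  also have "\<dots> = card C + card D" using assms card_Un_Int by metis
  finally show ?thesis .
qed

text \<open>Submodularity for partitions: \<open>X\<close> is moved from the other parts to the part \<open>M\<close>.\<close>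

lemma cut_family_uncross:
  assumes G: "is_graph G" and disj: "\<And>Z. Z \<in> \<Z> \<Longrightarrow> Z \<inter> M = {}"
  shows "card ((\<Union>Z\<in>\<Z>. cut G (Z - X)) \<union> cut G (M \<union> X)) + card (cut G (X \<inter> M))
       \<le> card ((\<Union>Z\<in>\<Z>. cut G Z) \<union> cut G M) + card (cut G X)"
proof (rule card_Un_le_if_exchange)
  have "finite (edges G)" using G by (simp add: is_graph_def)
  then show "finite ((\<Union>Z\<in>\<Z>. cut G Z) \<union> cut G M)"
    by (rule finite_subset[rotated]) (use cut_subset[of G] in blast)
  let ?N = "(\<Union>Z\<in>\<Z>. cut G Z) \<union> cut G M" and ?N' = "(\<Union>Z\<in>\<Z>. cut G (Z - X)) \<union> cut G (M \<union> X)"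
  have "(e \<in> ?N' \<union> cut G (X \<inter> M) \<longrightarrow> e \<in> ?N \<union> cut G X) \<and>
        (e \<in> ?N' \<inter> cut G (X \<inter> M) \<longrightarrow> e \<in> ?N \<inter> cut G X)" if e: "e \<in> edges G" for e
  proof -
    obtain x y where xy: "ends G e = {x, y}" using is_graph_ends[OF G e] by metis
    have c: "e \<in> cut G S \<longleftrightarrow> (x \<in> S) \<noteq> (y \<in> S)" for S by (rule in_cut_iff[OF G e xy])
    show ?thesis using disj unfolding Un_iff Int_iff UN_iff c by blast
  qed
  moreover have "?N' \<union> cut G (X \<inter> M) \<subseteq> edges G" using cut_subset[of G] by blast
  ultimately show "?N' \<union> cut G (X \<inter> M) \<subseteq> ?N \<union> cut G X" "?N' \<inter> cut G (X \<inter> M) \<subseteq> ?N \<inter> cut G X"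
    by blast+
qed (use G in auto)

text \<open>An edge in both cuts on the left joins \<open>Y - X\<close> to \<open>X - Y\<close> and
  so lies in both cuts on the right. Compared with intersection and union, the differences have the
  advantage that each set is replaced by a subset of itself.\<close>

lemma cut_posimodular:
  assumes G: "is_graph G"
  shows "card (cut G (Y - X)) + card (cut G (X - Y)) \<le> card (cut G Y) + card (cut G X)"
proof (rule card_Un_le_if_exchange)
  have "(e \<in> cut G (Y - X) \<union> cut G (X - Y) \<longrightarrow> e \<in> cut G Y \<union> cut G X) \<and>
        (e \<in> cut G (Y - X) \<inter> cut G (X - Y) \<longrightarrow> e \<in> cut G Y \<inter> cut G X)" if e: "e \<in> edges G" for e
  proof -
    obtain x y where xy: "ends G e = {x, y}" using is_graph_ends[OF G e] by metis
    show ?thesis unfolding Un_iff Int_iff in_cut_iff[OF G e xy] by blast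
  qed
  then show "cut G (Y - X) \<union> cut G (X - Y) \<subseteq> cut G Y \<union> cut G X"
    "cut G (Y - X) \<inter> cut G (X - Y) \<subseteq> cut G Y \<inter> cut G X"
    using cut_subset[of G "Y - X"] cut_subset[of G "X - Y"] by blast+
qed (use G in auto)


section \<open>Menger's theorem for edge-disjoint paths\<close>

text \<open>Injectivity of \<open>fst\<close> is the unit capacity: an edge is used at most once and
  in one direction only.\<close>

definition flow :: "('v, 'e) mgraph \<Rightarrow> ('e \<times> 'v \<times> 'v) set \<Rightarrow> bool" where
  "flow G D \<longleftrightarrow> D \<subseteq> arcs G \<and> inj_on fst D"

definition unit :: "'v \<Rightarrow> 'v \<Rightarrow> int" where
  "unit u x = of_bool (u = x)"

text \<open>Outflow minus inflow at \<open>x\<close>; an integer because it is negative at the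
  sink.\<close>

definition net :: "('e \<times> 'v \<times> 'v) set \<Rightarrow> 'v \<Rightarrow> int" where
  "net D x = (\<Sum>(e, a, b)\<in>D. unit a x - unit b x)"

lemma finite_arcs: "is_graph G \<Longrightarrow> finite (arcs G)"
proof -
  assume G: "is_graph G"
  have "arcs G \<subseteq> edges G \<times> verts G \<times> verts G"
    using is_graph_arc(1,2)[OF G] by auto
  then show ?thesis by (rule finite_subset) (use G in \<open>simp add: is_graph_def\<close>)
qed

lemma finite_flow: "is_graph G \<Longrightarrow> flow G D \<Longrightarrow> finite D"
  by (meson finite_arcs finite_subset flow_def)

lemma net_insert:
  "finite D \<Longrightarrow> (e, a, b) \<notin> D \<Longrightarrow> net (insert (e, a, b) D) x = net D x + unit a x - unit b x"
  by (simp add: net_def)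

lemma net_remove:
  "finite D \<Longrightarrow> (e, a, b) \<in> D \<Longrightarrow> net (D - {(e, a, b)}) x = net D x - unit a x + unit b x"
  by (simp add: net_def sum_diff1)

text \<open>The terms of an arc with both ends in \<open>R\<close> cancel; what remains is the
  number of arcs that leave \<open>R\<close> minus the number of those that enter it.\<close>

lemma sum_net:
  assumes "finite R" "finite D"
  shows "(\<Sum>x\<in>R. net D x) = (\<Sum>(e, a, b)\<in>D. of_bool (a \<in> R) - of_bool (b \<in> R))"
proof -
  have "(\<Sum>x\<in>R. net D x) = (\<Sum>d\<in>D. \<Sum>x\<in>R. case d of (e, a, b) \<Rightarrow> unit a x - unit b x)"
    unfolding net_def by (rule sum.swap)
  also have "\<dots> = (\<Sum>(e, a, b)\<in>D. of_bool (a \<in> R) - of_bool (b \<in> R))"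
    using assms(1) by (intro sum.cong) (auto simp: unit_def sum_subtractf of_bool_def sum.delta)
  finally show ?thesis .
qed

text \<open>Every arc of \<open>G\<close> outside \<open>D\<close> is residual: its edge is either unused or used by \<open>D\<close> in the
  opposite direction.\<close>

lemma flow_augment:
  assumes G: "is_graph G"
  shows "flow G D \<Longrightarrow> dpath (arcs G - D) vs es \<Longrightarrow>
    \<exists>D'. flow G D' \<and> (\<forall>x. net D' x = net D x + unit (hd vs) x - unit (last vs) x)"
proof (induction es arbitrary: vs D)
  case Nil
  then show ?case by auto
next
  case (Cons e es)
  then obtain u ws where vs: "vs = u # ws" "ws \<noteq> []" "u \<notin> set ws"
    and eu: "(e, u, hd ws) \<in> arcs G - D" and p: "dpath (arcs G - D) ws es"
    by (auto elim: dpath_Cons_E)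
  let ?w = "hd ws"
  have uw: "u \<noteq> ?w" using vs by (metis hd_in_set)
  have fin: "finite D" using finite_flow[OF G Cons.prems(1)] .
  define D1 where "D1 = (if (e, ?w, u) \<in> D then D - {(e, ?w, u)} else insert (e, u, ?w) D)"
  have only: "(x = u \<and> y = ?w) \<or> (x = ?w \<and> y = u)" if "(e, x, y) \<in> D" for x y
    using that eu Cons.prems(1) by (auto simp: flow_def doubleton_eq_iff subset_iff)
  have f1: "flow G D1"
  proof (cases "(e, ?w, u) \<in> D")
    case True
    then show ?thesis using Cons.prems(1) by (auto simp: D1_def flow_def inj_on_diff)
  next
    case False
    then have "e \<notin> fst ` D" using only eu by force
    then show ?thesis using Cons.prems(1) False eu by (auto simp: D1_def flow_def)
  qed
  \<comment> \<open>The rest of the path does not visit \<open>u\<close> again, so the arc just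
    added is not among its arcs and they all remain residual.\<close>
  have p1: "dpath (arcs G - D1) ws es"
  proof -
    have "(es ! i, ws ! i, ws ! Suc i) \<noteq> (e, u, ?w)" if "i < length es" for i
      using that p vs(3) by (auto simp: dpath_def)
    then show ?thesis using p by (auto simp: dpath_def D1_def)
  qed
  obtain D' where D': "flow G D'"
      "\<And>x. net D' x = net D1 x + unit ?w x - unit (last ws) x"
    using Cons.IH[OF f1 p1] by blast
  have "net D1 x = net D x + unit u x - unit ?w x" for x
    using fin eu by (auto simp: D1_def net_insert net_remove)
  then show ?case using D' vs by (intro exI[of _ D']) auto
qed

text \<open>That the remaining flow uses no edge of the removed path is what makes successively
  extracted paths edge-disjoint.\<close>

lemma flow_remove_path:
  assumes G: "is_graph G"
  shows "flow G D \<Longrightarrow> dpath D vs es \<Longrightarrow>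
    \<exists>D'\<subseteq>D. flow G D' \<and> fst ` D' \<inter> set es = {} \<and>
      (\<forall>x. net D' x = net D x - unit (hd vs) x + unit (last vs) x)"
proof (induction es arbitrary: vs D)
  case Nil
  then show ?case by auto
next
  case (Cons e es)
  then obtain u ws where vs: "vs = u # ws" "ws \<noteq> []" "u \<notin> set ws"
    and eu: "(e, u, hd ws) \<in> D" and p: "dpath D ws es"
    by (auto elim: dpath_Cons_E)
  let ?w = "hd ws"
  have fin: "finite D" using finite_flow[OF G Cons.prems(1)] .
  let ?D1 = "D - {(e, u, ?w)}"
  have f1: "flow G ?D1" using Cons.prems(1) by (auto simp: flow_def inj_on_diff)
  have p1: "dpath ?D1 ws es"
  proof -
    have "(es ! i, ws ! i, ws ! Suc i) \<noteq> (e, u, ?w)" if "i < length es" for i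
      using that p vs(3) by (auto simp: dpath_def)
    then show ?thesis using p by (auto simp: dpath_def)
  qed
  obtain D' where D': "D' \<subseteq> ?D1" "flow G D'" "fst ` D' \<inter> set es = {}"
      "\<And>x. net D' x = net ?D1 x - unit ?w x + unit (last ws) x"
    using Cons.IH[OF f1 p1] by blast
  have "e \<notin> fst ` ?D1"
  proof
    assume "e \<in> fst ` ?D1"
    then obtain d where "d \<in> ?D1" "fst d = e" by auto
    then show False using Cons.prems(1) eu by (auto simp: flow_def inj_on_def)
  qed
  then have "e \<notin> fst ` D'" using D'(1) by blast
  then show ?case using D' vs fin eu by (intro exI[of _ D']) (auto simp: net_remove)
qed

lemma reachable_closed:
  "x \<in> {x. (u, x) \<in> (arc_rel R)\<^sup>*} \<Longrightarrow> (e, x, y) \<in> R \<Longrightarrow> y \<in> {x. (u, x) \<in> (arc_rel R)\<^sup>*}"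
  by (simp add: arc_rel_step)

text \<open>Ford and Fulkerson: let \<open>R\<close> be the set reachable from \<open>u\<close> in
  the residual graph of a flow of value \<open>n\<close>. If \<open>v\<close> is in
  \<open>R\<close>, the flow is augmented. Otherwise every edge in the cut of \<open>R\<close>
  carries flow out of \<open>R\<close> and none carries flow into it, so the cut has at most
  \<open>n\<close> edges, against the assumption for \<open>Suc n\<close>.\<close>

lemma flow_exists:
  assumes G: "is_graph G" and uv: "u \<in> verts G" "u \<noteq> v"
    and cuts: "\<And>X. X \<subseteq> verts G \<Longrightarrow> u \<in> X \<Longrightarrow> v \<notin> X \<Longrightarrow> n \<le> card (cut G X)"
  shows "\<exists>D. flow G D \<and> (\<forall>x. net D x = int n * (unit u x - unit v x))"
  using cuts
proof (induction n)
  case 0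
  have "flow G {} \<and> (\<forall>x. net {} x = int 0 * (unit u x - unit v x))"
    by (simp add: flow_def net_def)
  then show ?case by blast
next
  case (Suc n)
  then obtain D where D: "flow G D" "\<And>x. net D x = int n * (unit u x - unit v x)"
    by (meson Suc_leD)
  define R where "R = {x. (u, x) \<in> (arc_rel (arcs G - D))\<^sup>*}"
  have closed: "y \<in> R" if "x \<in> R" "(e, x, y) \<in> arcs G - D" for x y e
    using that reachable_closed unfolding R_def by metis
  show ?case
  proof (cases "v \<in> R")
    case True
    then obtain vs es where p: "dpath (arcs G - D) vs es" "hd vs = u" "last vs = v"
      unfolding R_def using reachable_imp_dpath[of u v "arcs G - D"] by auto
    then obtain D' where "flow G D'" "\<And>x. net D' x = net D x + unit u x - unit v x"
      using flow_augment[OF G D(1)] by metis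
    then show ?thesis by (intro exI[of _ D']) (auto simp: D algebra_simps)
  next
    case False
    have "R \<subseteq> verts G"
    proof
      fix x assume "x \<in> R"
      then have "(u, x) \<in> (arc_rel (arcs G - D))\<^sup>*" by (simp add: R_def)
      then show "x \<in> verts G"
        by induction (use uv in \<open>auto simp: arc_rel_iff dest: is_graph_arc(2)[OF G]\<close>)
    qed
    then have finR: "finite R" using G by (auto simp: is_graph_def intro: finite_subset)
    have fin: "finite D" using finite_flow[OF G D(1)] .
    have uR: "u \<in> R" by (simp add: R_def)
    \<comment> \<open>The reverse of an arc of \<open>D\<close> entering \<open>R\<close> would be
      residual and would make its tail reachable.\<close>
    have into: "a \<in> R" if "(e, a, b) \<in> D" "b \<in> R" for e a b
    proof (rule ccontr)
      assume "a \<notin> R"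
      moreover have "(e, b, a) \<in> arcs G" using that D(1) by (auto simp: flow_def subset_iff insert_commute)
      ultimately have "(e, b, a) \<in> D" using closed[OF that(2)] by blast
      then have "(e, b, a) = (e, a, b)"
        using that D(1) unfolding flow_def by (intro inj_onD[of fst D]) simp_all
      then have "a = b" by (metis Pair_inject)
      then show False using \<open>a \<notin> R\<close> that by blast
    qed
    have "cut G R \<subseteq> fst ` (D \<inter> {(e, a, b). a \<in> R \<and> b \<notin> R})"
    proof
      fix e assume e: "e \<in> cut G R"
      then have eE: "e \<in> edges G" using cut_subset[of G] by blast
      obtain a b where ab: "ends G e = {a, b}" using is_graph_ends[OF G eE] by metis
      then have "(a \<in> R) \<noteq> (b \<in> R)" using in_cut_iff[OF G eE] e by blast
      then obtain x y where xy: "ends G e = {x, y}" "x \<in> R" "y \<notin> R"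
        using ab insert_commute[of a b "{}"] by (cases "a \<in> R") auto
      then have "(e, x, y) \<in> D" using closed[OF xy(2), of e y] eE by auto
      then show "e \<in> fst ` (D \<inter> {(e, a, b). a \<in> R \<and> b \<notin> R})" using xy by force
    qed
    then have "card (cut G R) \<le> card (D \<inter> {(e, a, b). a \<in> R \<and> b \<notin> R})"
      using fin by (intro surj_card_le) simp_all
    also have "int \<dots> = (\<Sum>d\<in>D. of_bool (case d of (e, a, b) \<Rightarrow> a \<in> R \<and> b \<notin> R))"
      using fin by simp
    also have "\<dots> = (\<Sum>(e, a, b)\<in>D. of_bool (a \<in> R) - of_bool (b \<in> R))"
    proof (intro sum.cong refl, clarify)
      fix e a b assume "(e, a, b) \<in> D"
      then have "b \<in> R \<Longrightarrow> a \<in> R" using into by blast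
      then show "of_bool (a \<in> R \<and> b \<notin> R) = of_bool (a \<in> R) - (of_bool (b \<in> R) :: int)"
        by (simp add: of_bool_def)
    qed
    also have "\<dots> = (\<Sum>x\<in>R. net D x)" using sum_net[OF finR fin] by simp
    also have "\<dots> = int n"
      using finR uR False
      by (simp add: D(2) sum_distrib_left[symmetric] sum_subtractf unit_def of_bool_def sum.delta)
    finally have "card (cut G R) \<le> n" by linarith
    then show ?thesis using Suc.prems[OF \<open>R \<subseteq> verts G\<close> uR False] by linarith
  qed
qed

text \<open>Paths are peeled off one at a time. While \<open>u\<close> has positive excess,
  \<open>v\<close> is reachable along arcs of \<open>D\<close>: no arc of \<open>D\<close> leaves
  the reachable set, so without \<open>v\<close> its total excess would be at most 0. Directed
  cycles in \<open>D\<close> are simply left over.\<close>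

lemma flow_decompose:
  assumes G: "is_graph G" and uv: "u \<in> verts G" "u \<noteq> v"
  shows "flow G D \<Longrightarrow> (\<And>x. net D x = int n * (unit u x - unit v x)) \<Longrightarrow>
    \<exists>P E. (\<forall>i<n. dpath D (P i) (E i) \<and> hd (P i) = u \<and> last (P i) = v) \<and>
      (\<forall>i<n. \<forall>j<n. i \<noteq> j \<longrightarrow> set (E i) \<inter> set (E j) = {})"
proof (induction n arbitrary: D)
  case 0
  then show ?case by simp
next
  case (Suc n)
  note D = Suc.prems
  define R where "R = {x. (u, x) \<in> (arc_rel D)\<^sup>*}"
  have closed: "y \<in> R" if "x \<in> R" "(e, x, y) \<in> D" for x y e
    using that reachable_closed unfolding R_def by metis
  have fin: "finite D" using finite_flow[OF G D(1)] .
  have "v \<in> R"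
  proof (rule ccontr)
    assume vR: "v \<notin> R"
    have "R \<subseteq> verts G"
    proof
      fix x assume "x \<in> R"
      then have "(u, x) \<in> (arc_rel D)\<^sup>*" by (simp add: R_def)
      then show "x \<in> verts G"
        by induction (use uv D(1) in \<open>auto simp: arc_rel_iff flow_def subset_iff dest: is_graph_arc(2)[OF G]\<close>)
    qed
    then have finR: "finite R" using G by (auto simp: is_graph_def intro: finite_subset)
    have uR: "u \<in> R" by (simp add: R_def)
    have "int (Suc n) = (\<Sum>x\<in>R. net D x)"
      using finR uR vR
      by (simp add: D(2) sum_distrib_left[symmetric] sum_subtractf unit_def of_bool_def sum.delta)
    also have "\<dots> = (\<Sum>(e, a, b)\<in>D. of_bool (a \<in> R) - of_bool (b \<in> R))"
      by (rule sum_net[OF finR fin])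
    also have "\<dots> \<le> 0" using closed by (intro sum_nonpos) (auto simp: of_bool_def)
    finally show False by simp
  qed
  then obtain vs es where p: "dpath D vs es" "hd vs = u" "last vs = v"
    unfolding R_def using reachable_imp_dpath[of u v D] by auto
  then obtain D' where D': "D' \<subseteq> D" "flow G D'" "fst ` D' \<inter> set es = {}"
    "\<And>x. net D' x = net D x - unit u x + unit v x"
    using flow_remove_path[OF G D(1) p(1)] by auto
  have "net D' x = int n * (unit u x - unit v x)" for x
    by (simp add: D' D algebra_simps)
  then obtain P E where PE: "\<And>i. i < n \<Longrightarrow> dpath D' (P i) (E i) \<and> hd (P i) = u \<and> last (P i) = v"
      "\<And>i j. i < n \<Longrightarrow> j < n \<Longrightarrow> i \<noteq> j \<Longrightarrow> set (E i) \<inter> set (E j) = {}"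
    using Suc.IH[OF D'(2)] by blast
  have sub: "set (E i) \<inter> set es = {}" if "i < n" for i
  proof -
    have "set (E i) \<subseteq> fst ` D'" using PE(1)[OF that] by (force simp: dpath_def in_set_conv_nth)
    then show ?thesis using D'(3) by blast
  qed
  have "dpath D (P i) (E i)" if "i < n" for i
    using PE(1)[OF that] D'(1) by (blast intro: dpath_mono)
  then show ?case
    using PE p sub
    by (intro exI[of _ "P(n := vs)"] exI[of _ "E(n := es)"]) (simp add: less_Suc_eq Int_commute)
qed

theorem edge_menger:
  assumes G: "is_graph G" and uv: "u \<in> verts G" "u \<noteq> v"
    and cuts: "\<And>X. X \<subseteq> verts G \<Longrightarrow> u \<in> X \<Longrightarrow> v \<notin> X \<Longrightarrow> n \<le> card (cut G X)"
  shows "\<exists>P E. (\<forall>i<n. path_between G u v (P i) (E i)) \<and>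
      (\<forall>i<n. \<forall>j<n. i \<noteq> j \<longrightarrow> set (E i) \<inter> set (E j) = {})"
proof -
  obtain D where D: "flow G D" "\<And>x. net D x = int n * (unit u x - unit v x)"
    using flow_exists[OF assms] by blast
  obtain P E where P: "\<forall>i<n. dpath D (P i) (E i) \<and> hd (P i) = u \<and> last (P i) = v"
    and E: "\<forall>i<n. \<forall>j<n. i \<noteq> j \<longrightarrow> set (E i) \<inter> set (E j) = {}"
    using flow_decompose[OF G uv D] by (elim exE conjE)
  have "D \<subseteq> arcs G" using D(1) by (simp add: flow_def)
  then have "path_between G u v (P i) (E i)" if "i < n" for i
    using P that uv(1) dpath_mono[of D "P i" "E i" "arcs G"]
    by (simp add: path_between_iff_dpath[OF G])
  then show ?thesis using E by blast
qed

lemma three_edge_connectedI: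
  assumes G: "is_graph G" and u: "u \<in> verts G"
    and cuts: "\<And>X. X \<subseteq> verts G \<Longrightarrow> u \<in> X \<Longrightarrow> v \<notin> X \<Longrightarrow> 3 \<le> card (cut G X)"
  shows "three_edge_connected G u v"
proof (cases "u = v")
  case False
  obtain P E where P: "\<forall>i<3::nat. path_between G u v (P i) (E i)"
    and E: "\<forall>i<3. \<forall>j<3. i \<noteq> j \<longrightarrow> set (E i) \<inter> set (E j) = {}"
    using edge_menger[where n = 3, OF G u False] cuts by (metis (no_types))
  have "path_between G u v (P 0) (E 0)" "path_between G u v (P 1) (E 1)"
    "path_between G u v (P 2) (E 2)" using P by simp_all
  moreover have "set (E 0) \<inter> set (E 1) = {}" "set (E 0) \<inter> set (E 2) = {}"
    "set (E 1) \<inter> set (E 2) = {}" using E by simp_all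
  ultimately show ?thesis unfolding three_edge_connected_def by blast
qed (simp add: three_edge_connected_def)

lemma path_crosses_cut:
  assumes G: "is_graph G" and p: "path_between G u v vs es" and "u \<in> X" "v \<notin> X"
  shows "\<exists>e\<in>set es. e \<in> cut G X"
proof -
  have "dpath (arcs G) vs es" "hd vs \<in> X" "last vs \<notin> X"
    using p assms(3,4) unfolding path_between_iff_dpath[OF G] by blast+
  then show ?thesis
  proof (induction es arbitrary: vs)
    case (Cons e es)
    obtain a ws where vs: "vs = a # ws" "ws \<noteq> []" "(e, a, hd ws) \<in> arcs G" "dpath (arcs G) ws es"
      using Cons.prems(1) by (rule dpath_Cons_E)
    have e: "e \<in> cut G X \<longleftrightarrow> (a \<in> X) \<noteq> (hd ws \<in> X)"
      using vs(3) in_cut_iff[OF G, of e a "hd ws" X] by simp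
    have "last ws \<notin> X" "a \<in> X" using Cons.prems vs by simp_all
    then show ?case using Cons.IH[OF vs(4)] e by (cases "hd ws \<in> X") simp_all
  next
    case Nil
    then show ?case unfolding dpath_Nil by force
  qed
qed

lemma three_edge_connected_cut:
  assumes G: "is_graph G" and "three_edge_connected G u v" "u \<in> X" "v \<notin> X"
  shows "3 \<le> card (cut G X)"
proof -
  obtain vs1 es1 vs2 es2 vs3 es3 where
    p: "path_between G u v vs1 es1" "path_between G u v vs2 es2" "path_between G u v vs3 es3"
    and d: "set es1 \<inter> set es2 = {}" "set es1 \<inter> set es3 = {}" "set es2 \<inter> set es3 = {}"
    using assms unfolding three_edge_connected_def by blast
  obtain e1 where "e1 \<in> set es1" "e1 \<in> cut G X"
    using path_crosses_cut[OF G p(1) assms(3,4)] by blast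
  moreover obtain e2 where "e2 \<in> set es2" "e2 \<in> cut G X"
    using path_crosses_cut[OF G p(2) assms(3,4)] by blast
  moreover obtain e3 where "e3 \<in> set es3" "e3 \<in> cut G X"
    using path_crosses_cut[OF G p(3) assms(3,4)] by blast
  ultimately have e: "e1 \<in> set es1" "e2 \<in> set es2" "e3 \<in> set es3" "{e1, e2, e3} \<subseteq> cut G X" by auto
  have "e1 \<noteq> e2" "e1 \<noteq> e3" "e2 \<noteq> e3" using e d by blast+
  then have "card {e1, e2, e3} = 3" by simp
  then show ?thesis using card_mono[OF finite_cut[OF G] e(4)] by simp
qed

section \<open>Dismantlable vertex sets\<close>

definition bold_cut :: "('v, 'e) mgraph \<Rightarrow> 'v set \<Rightarrow> 'e set" where
  "bold_cut G Y = (if 3 \<le> card (cut G Y) then cut G Y else {})"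

text \<open>In a rooted tree-cut decomposition \<open>Y\<close> is the union of the bags below a node. The edge towards
  the root has adhesion set \<^term>\<open>cut G Y\<close>, so \<^term>\<open>bold_cut G Y\<close> is its contribution to the adhesion
  at the node.\<close>

inductive dismantlable :: "('v, 'e) mgraph \<Rightarrow> nat \<Rightarrow> 'v set set \<Rightarrow> 'v set \<Rightarrow> bool"
  for G k L where
  leaf: "Y \<in> L \<Longrightarrow> Y \<subseteq> verts G \<Longrightarrow> card (bold_cut G Y) < k \<Longrightarrow> dismantlable G k L Y"
| node: "(\<And>Z. Z \<in> \<Y> \<Longrightarrow> dismantlable G k L Z) \<Longrightarrow> disjoint \<Y> \<Longrightarrow> B \<inter> \<Union> \<Y> = {} \<Longrightarrow>
    B \<subseteq> verts G \<Longrightarrow> card B < k \<Longrightarrow>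
    card (bold_cut G (B \<union> \<Union> \<Y>) \<union> (\<Union>Z\<in>\<Y>. bold_cut G Z)) < k \<Longrightarrow>
    dismantlable G k L (B \<union> \<Union> \<Y>)"

text \<open>With these leaves a leaf is just a childless node whose bag is the whole set. Larger
  choices of \<open>L\<close> admit leaves that are too big for a bag.\<close>

definition small_sets :: "('v, 'e) mgraph \<Rightarrow> nat \<Rightarrow> 'v set set" where
  "small_sets G k = {Y. Y \<subseteq> verts G \<and> card Y < k}"

lemma is_graph_finite: "is_graph G \<Longrightarrow> finite (verts G)" "is_graph G \<Longrightarrow> finite (edges G)"
  by (simp_all add: is_graph_def)

lemma finite_edge_set: "is_graph G \<Longrightarrow> S \<subseteq> edges G \<Longrightarrow> finite S"
  by (meson is_graph_finite(2) finite_subset)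

lemma bold_cut_subset_cut: "bold_cut G Y \<subseteq> cut G Y"
  by (simp add: bold_cut_def)

lemma bold_cut_subset: "bold_cut G Y \<subseteq> edges G"
  using bold_cut_subset_cut[of G Y] cut_subset[of G Y] by blast

lemma bold_cuts_subset: "bold_cut G Y \<union> (\<Union>Z\<in>\<Y>. bold_cut G Z) \<subseteq> edges G"
  by (simp add: bold_cut_subset UN_least)

lemma bold_cut_compl: "is_graph G \<Longrightarrow> bold_cut G (verts G - Y) = bold_cut G Y"
  by (simp add: bold_cut_def cut_compl)

lemma bold_cut_thin: "card (cut G Y) < 3 \<Longrightarrow> bold_cut G Y = {}"
  by (simp add: bold_cut_def)

lemma bold_cut_empty [simp]: "bold_cut G {} = {}"
  by (simp add: bold_cut_def)

lemma bold_cut_verts: "is_graph G \<Longrightarrow> bold_cut G (verts G) = {}"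
  by (simp add: bold_cut_def cut_verts)

lemma dismantlable_subset: "dismantlable G k L Y \<Longrightarrow> Y \<subseteq> verts G"
  by (induction rule: dismantlable.induct) blast+

lemma dismantlable_bold_cut:
  assumes G: "is_graph G" and "dismantlable G k L Y"
  shows "card (bold_cut G Y) < k"
  using assms(2)
proof cases
  case (node \<Y> B)
  have "card (bold_cut G Y) \<le> card (bold_cut G (B \<union> \<Union> \<Y>) \<union> (\<Union>Z\<in>\<Y>. bold_cut G Z))"
    by (rule card_mono[OF finite_edge_set[OF G bold_cuts_subset]]) (simp add: node(1))
  then show ?thesis using node by linarith
qed auto

text \<open>Re-rooting at the leaf \<open>A\<close> turns the complement of \<open>A\<close> into the set below a node. As \<open>A\<close> is
  nonempty, it can occur only once among the disjoint leaves.\<close>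

lemma dismantlable_reroot:
  assumes G: "is_graph G" and A: "A \<noteq> {}" and "dismantlable G k (insert A L) Y"
  shows "dismantlable G k L Y \<or>
    A \<subseteq> Y \<and> (dismantlable G k L (verts G - Y) \<longrightarrow> dismantlable G k L (verts G - A))"
  using assms(3)
proof (induction rule: dismantlable.induct)
  case (leaf Y)
  then show ?case by (auto intro: dismantlable.leaf)
next
  case (node \<Y> B)
  let ?Y = "B \<union> \<Union> \<Y>"
  show ?case
  proof (cases "\<forall>Z\<in>\<Y>. dismantlable G k L Z")
    case True
    then have "dismantlable G k L ?Y"
      using dismantlable.node[of \<Y> G k L B] node.hyps by blast
    then show ?thesis ..
  next
    case False
    then obtain Z where Z: "Z \<in> \<Y>" "\<not> dismantlable G k L Z" by blast
    then have AZ: "A \<subseteq> Z" and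
      imp: "dismantlable G k L (verts G - Z) \<Longrightarrow> dismantlable G k L (verts G - A)"
      using node.IH by blast+
    have ZV: "Z' \<subseteq> verts G" if "Z' \<in> \<Y>" for Z'
      using node.hyps(1)[OF that] by (rule dismantlable_subset)
    have disjZ: "Z' \<inter> Z = {}" if "Z' \<in> \<Y> - {Z}" for Z'
      using node.hyps(2) that Z(1) by (auto dest: disjointD)
    have other: "dismantlable G k L Z'" if "Z' \<in> \<Y> - {Z}" for Z'
    proof -
      show ?thesis using node.IH[of Z'] disjZ[OF that] that AZ A by blast
    qed
    have "dismantlable G k L (verts G - A)" if Yc: "dismantlable G k L (verts G - ?Y)"
    proof (rule imp)
      \<comment> \<open>The same node seen from \<open>Z\<close>: everything above it takes the
        place of \<open>Z\<close> among the children. Complementary sets have the same cut, so the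
        adhesion set of the node is unchanged.\<close>
      let ?\<Z> = "insert (verts G - ?Y) (\<Y> - {Z})"
      have eq: "B \<union> \<Union> ?\<Z> = verts G - Z"
      proof -
        have "\<Union> (\<Y> - {Z}) = \<Union> \<Y> - Z" using disjZ Z(1) by blast
        moreover have "Z \<subseteq> \<Union> \<Y>" "\<Union> \<Y> \<subseteq> verts G" using Z(1) ZV by blast+
        ultimately show ?thesis using node.hyps(3,4) by auto
      qed
      have "dismantlable G k L (B \<union> \<Union> ?\<Z>)"
      proof (rule dismantlable.node)
        show "dismantlable G k L Z'" if "Z' \<in> ?\<Z>" for Z' using that other Yc by blast
        show "disjoint ?\<Z>" using node.hyps(2) unfolding disjoint_def by blast
        show "B \<inter> \<Union> ?\<Z> = {}" using node.hyps(3) by blast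
        have "bold_cut G (B \<union> \<Union> ?\<Z>) \<union> (\<Union>Z\<in>?\<Z>. bold_cut G Z)
            = bold_cut G ?Y \<union> (\<Union>Z\<in>\<Y>. bold_cut G Z)"
          unfolding eq bold_cut_compl[OF G] UN_insert using Z(1) by blast
        then show "card (bold_cut G (B \<union> \<Union> ?\<Z>) \<union> (\<Union>Z\<in>?\<Z>. bold_cut G Z)) < k"
          using node.hyps(6) by simp
      qed (use node.hyps in auto)
      then show "dismantlable G k L (verts G - Z)" unfolding eq .
    qed
    then show ?thesis using AZ Z(1) by blast
  qed
qed

text \<open>What a minimum cut guarantees for one of its sides. Minimality is asked only of sets
  between \<open>A\<close> and \<open>X\<close>; the set to be separated from \<open>A\<close> is
  not mentioned, so the notion applies to both sides of the cut.\<close>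

definition tight :: "('v, 'e) mgraph \<Rightarrow> 'v set \<Rightarrow> 'v set \<Rightarrow> bool" where
  "tight G A X \<longleftrightarrow> A \<subseteq> X \<and> X \<subseteq> verts G \<and>
     (\<forall>X'. A \<subseteq> X' \<longrightarrow> X' \<subseteq> X \<longrightarrow> card (cut G X) \<le> card (cut G X'))"

lemma tightD:
  "tight G A X \<Longrightarrow> A \<subseteq> X' \<Longrightarrow> X' \<subseteq> X \<Longrightarrow> card (cut G X) \<le> card (cut G X')"
  by (simp add: tight_def)

text \<open>As \<open>Y\<close> misses \<open>A\<close>, the set \<open>X - Y\<close> competes with
  \<open>X\<close> and cannot have a smaller cut. Posimodularity then yields the bound on
  \<open>Y - X\<close>. In particular thin sets that miss \<open>A\<close> stay thin.\<close>

lemma tight_card_cut_Diff: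
  assumes "is_graph G" "tight G A X" "Y \<inter> A = {}"
  shows "card (cut G (Y - X)) \<le> card (cut G Y)"
proof -
  have "card (cut G X) \<le> card (cut G (X - Y))"
    by (rule tightD[OF assms(2)]) (use assms in \<open>auto simp: tight_def\<close>)
  then show ?thesis using cut_posimodular[OF assms(1), of Y X] by linarith
qed

lemma tight_bold_cut_Diff:
  assumes "is_graph G" "tight G A X" "Y \<inter> A = {}" "card (cut G Y) < 3"
  shows "bold_cut G (Y - X) = {}"
  using tight_card_cut_Diff[OF assms(1-3)] assms(4) by (intro bold_cut_thin) linarith

lemma cut_Union_subset:
  assumes G: "is_graph G"
  shows "cut G (\<Union> \<Z>) \<subseteq> (\<Union>Z\<in>\<Z>. cut G Z)"
proof
  fix e assume e: "e \<in> cut G (\<Union> \<Z>)"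
  then have eE: "e \<in> edges G" using cut_subset[of G] by blast
  obtain x y where xy: "ends G e = {x, y}" using is_graph_ends[OF G eE] by metis
  show "e \<in> (\<Union>Z\<in>\<Z>. cut G Z)"
    using e unfolding UN_iff in_cut_iff[OF G eE xy] by blast
qed

text \<open>\<open>X\<close> is removed from every bag and leaf. The only danger is that the
  adhesion at a node grows. There the bold parts \<open>\<Z>\<close> and a part \<open>M\<close>
  containing \<open>A\<close> are uncrossed with \<open>X\<close>: the vertices of \<open>X\<close>
  are moved to \<open>M\<close>, and the price, the cut of \<open>X \<inter> M\<close>, is at least
  the cut of \<open>X\<close> because \<open>X\<close> is tight.\<close>

lemma dismantlable_shift:
  assumes G: "is_graph G" and t: "tight G A X"
    and down: "\<And>Y Y'. Y \<in> L \<Longrightarrow> Y' \<subseteq> Y \<Longrightarrow> Y' \<in> L"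
    and "dismantlable G k L Y" "Y \<inter> A = {}"
  shows "dismantlable G k L (Y - X)"
  using assms(4,5)
proof (induction rule: dismantlable.induct)
  case (leaf Y)
  have "card (bold_cut G (Y - X)) \<le> card (bold_cut G Y)"
    using tight_card_cut_Diff[OF G t leaf.prems] by (auto simp: bold_cut_def)
  then show ?case using leaf by (intro dismantlable.leaf) (auto intro: down)
next
  case (node \<Y> B)
  let ?Y = "B \<union> \<Union> \<Y>" and ?\<Y>' = "(\<lambda>Z. Z - X) ` \<Y>"
  have AX: "A \<subseteq> X" and XV: "X \<subseteq> verts G" using t by (auto simp: tight_def)
  have disjA: "Z \<inter> A = {}" if "Z \<in> \<Y>" for Z using node.prems that by blast
  have YV: "?Y \<subseteq> verts G"
    using node.hyps(1,4) dismantlable_subset by (metis Sup_le_iff Un_subset_iff)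
  define \<Z> where "\<Z> = {Z \<in> \<Y>. 3 \<le> card (cut G Z)}"
  \<comment> \<open>Thin parts do not count towards the adhesion, so they are merged into the part containing \<open>A\<close>.\<close>
  define M where "M = (if 3 \<le> card (cut G ?Y) then verts G - ?Y else verts G - \<Union> \<Z>)"
  define N where "N = (\<Union>Z\<in>\<Z>. cut G Z) \<union> cut G M"
  define N' where "N' = (\<Union>Z\<in>\<Z>. cut G (Z - X)) \<union> cut G (M \<union> X)"
  let ?O = "bold_cut G ?Y \<union> (\<Union>Z\<in>\<Y>. bold_cut G Z)"
  let ?O' = "bold_cut G (?Y - X) \<union> (\<Union>Z\<in>\<Y>. bold_cut G (Z - X))"
  have N_sub: "N \<subseteq> ?O"
  proof -
    have "cut G Z \<subseteq> ?O" if "Z \<in> \<Z>" for Z using that by (auto simp: \<Z>_def bold_cut_def)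
    then have 1: "(\<Union>Z\<in>\<Z>. cut G Z) \<subseteq> ?O" by blast
    moreover have "cut G M \<subseteq> ?O"
    proof (cases "3 \<le> card (cut G ?Y)")
      case True
      then show ?thesis by (simp add: M_def cut_compl[OF G] bold_cut_def)
    next
      \<comment> \<open>A thin \<open>?Y\<close> contributes nothing to \<open>?O\<close>, but now
        \<open>M\<close> is the complement of the union of the bold children, whose cut is covered
        by their cuts.\<close>
      case False
      then show ?thesis using 1 cut_Union_subset[OF G, of \<Z>] by (simp add: M_def cut_compl[OF G])
    qed
    ultimately show ?thesis by (simp add: N_def)
  qed
  \<comment> \<open>A cut that was thin before the shift stays thin, so only those that were bold
    can contribute to \<open>?O'\<close>.\<close>
  have N'_sup: "?O' \<subseteq> N'"
  proof -
    have "bold_cut G (Z - X) \<subseteq> N'" if "Z \<in> \<Y>" for Z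
    proof (cases "Z \<in> \<Z>")
      case True
      then show ?thesis using bold_cut_subset_cut[of G "Z - X"] by (auto simp: N'_def)
    next
      case False
      then show ?thesis using tight_bold_cut_Diff[OF G t disjA[OF that]] that by (simp add: \<Z>_def)
    qed
    moreover have "bold_cut G (?Y - X) \<subseteq> N'"
    proof (cases "3 \<le> card (cut G ?Y)")
      case True
      then have "M \<union> X = verts G - (?Y - X)" using XV by (auto simp: M_def)
      then show ?thesis
        using bold_cut_subset_cut[of G "?Y - X"] cut_compl[OF G, of "?Y - X"] by (auto simp: N'_def)
    next
      case False
      then show ?thesis using tight_bold_cut_Diff[OF G t node.prems] by simp
    qed
    ultimately show ?thesis by blast
  qed
  have "card N' + card (cut G (X \<inter> M)) \<le> card N + card (cut G X)"
    unfolding N_def N'_def by (rule cut_family_uncross[OF G]) (auto simp: M_def \<Z>_def)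
  \<comment> \<open>\<open>X \<inter> M\<close> still contains \<open>A\<close>, so tightness lets
    the two extra terms of the uncrossing inequality cancel.\<close>
  moreover have "card (cut G X) \<le> card (cut G (X \<inter> M))"
  proof -
    have "A \<subseteq> M" using AX XV node.prems by (auto simp: M_def \<Z>_def)
    then show ?thesis by (intro tightD[OF t]) (use AX in auto)
  qed
  moreover have "card ?O' \<le> card N'"
    by (rule card_mono[OF _ N'_sup], rule finite_edge_set[OF G])
      (simp add: N'_def cut_subset UN_least)
  moreover have "card N \<le> card ?O"
    by (rule card_mono[OF finite_edge_set[OF G bold_cuts_subset] N_sub])
  ultimately have le: "card ?O' < k" using node.hyps(6) by linarith
  have eq: "(B - X) \<union> \<Union> ?\<Y>' = ?Y - X" by blast
  have "dismantlable G k L ((B - X) \<union> \<Union> ?\<Y>')"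
  proof (rule dismantlable.node)
    show "dismantlable G k L Z" if "Z \<in> ?\<Y>'" for Z using that node.IH disjA by blast
    show "disjoint ?\<Y>'" using node.hyps(2) unfolding disjoint_def by blast
    show "(B - X) \<inter> \<Union> ?\<Y>' = {}" using node.hyps(3) by blast
    show "B - X \<subseteq> verts G" using node.hyps(4) by blast
    have "finite B" using node.hyps(4) is_graph_finite(1)[OF G] finite_subset by blast
    then show "card (B - X) < k" using node.hyps(5) card_mono[of B "B - X"] by force
    show "card (bold_cut G ((B - X) \<union> \<Union> ?\<Y>') \<union> (\<Union>Z\<in>?\<Y>'. bold_cut G Z)) < k"
      using le unfolding eq by simp
  qed
  then show ?case unfolding eq .
qed


section \<open>From undismantlable graphs to brambles\<close>

lemma ex_minimal_notin:
  assumes "finite A" "A \<notin> L"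
  shows "\<exists>A0\<subseteq>A. A0 \<notin> L \<and> (\<forall>A'. A' \<subset> A0 \<longrightarrow> A' \<in> L)"
  using assms
proof (induction A rule: finite_psubset_induct)
  case (psubset A)
  then show ?case by (cases "\<forall>A'. A' \<subset> A \<longrightarrow> A' \<in> L") (blast, meson psubset_imp_subset subset_trans)
qed

lemma big_sets_touch:
  assumes G: "is_graph G" and k: "0 < k"
    and down: "\<And>Y Y'. Y \<in> L \<Longrightarrow> Y' \<subseteq> Y \<Longrightarrow> Y' \<in> L" and ne: "{} \<in> L"
    and not: "\<not> dismantlable G k L (verts G)"
    and maxi: "\<And>A. A \<subseteq> verts G \<Longrightarrow> A \<notin> L \<Longrightarrow> (\<forall>A'. A' \<subset> A \<longrightarrow> A' \<in> L) \<Longrightarrow>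
      dismantlable G k (insert A L) (verts G)"
    and A: "A \<subseteq> verts G" "A \<notin> L" and B: "B \<subseteq> verts G" "B \<notin> L"
  shows "A \<inter> B \<noteq> {}"
proof
  assume AB: "A \<inter> B = {}"
  have empty: "dismantlable G k L {}" using ne k by (intro dismantlable.leaf) simp_all
  have compl: "dismantlable G k L (verts G - A)"
    if "A \<subseteq> verts G" "A \<notin> L" "\<forall>A'. A' \<subset> A \<longrightarrow> A' \<in> L" for A
  proof -
    have "A \<noteq> {}" using that ne by blast
    from dismantlable_reroot[OF G this maxi[OF that]] not empty show ?thesis by simp
  qed
  \<comment> \<open>Minimal sets are taken because \<open>maxi\<close> speaks of these only. Any
    separation of \<open>A0\<close> from \<open>B0\<close> will do afterwards; it need not separate
    \<open>A\<close> from \<open>B\<close>.\<close>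
  obtain A0 where A0: "A0 \<subseteq> A" "A0 \<notin> L" "\<forall>A'. A' \<subset> A0 \<longrightarrow> A' \<in> L"
    using ex_minimal_notin[OF finite_subset[OF A(1) is_graph_finite(1)[OF G]] A(2)] by blast
  obtain B0 where B0: "B0 \<subseteq> B" "B0 \<notin> L" "\<forall>A'. A' \<subset> B0 \<longrightarrow> A' \<in> L"
    using ex_minimal_notin[OF finite_subset[OF B(1) is_graph_finite(1)[OF G]] B(2)] by blast
  define sep where "sep X \<longleftrightarrow> A0 \<subseteq> X \<and> X \<subseteq> verts G \<and> B0 \<inter> X = {}" for X
  have "sep A0" using A0(1) A(1) B0(1) AB unfolding sep_def by blast
  then have "\<exists>X. sep X \<and> (\<forall>X'. sep X' \<longrightarrow> card (cut G X) \<le> card (cut G X'))"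
    using ex_has_least_nat[of sep A0 "\<lambda>X. card (cut G X)"] by simp
  then obtain X where X: "sep X" and "\<forall>X'. sep X' \<longrightarrow> card (cut G X) \<le> card (cut G X')"
    by (elim exE conjE)
  then have mini: "card (cut G X) \<le> card (cut G X')" if "sep X'" for X' using that by simp
  have tA: "tight G A0 X"
    unfolding tight_def
  proof (intro conjI allI impI)
    show "A0 \<subseteq> X" "X \<subseteq> verts G" using X unfolding sep_def by blast+
    fix X' assume "A0 \<subseteq> X'" "X' \<subseteq> X"
    then have "sep X'" using X unfolding sep_def by blast
    then show "card (cut G X) \<le> card (cut G X')" by (rule mini)
  qed
  have tB: "tight G B0 (verts G - X)"
    unfolding tight_def cut_compl[OF G]
  proof (intro conjI allI impI)
    show "B0 \<subseteq> verts G - X" using X B0(1) B(1) unfolding sep_def by blast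
    fix X' assume "B0 \<subseteq> X'" "X' \<subseteq> verts G - X"
    then have "sep (verts G - X')" using X A0(1) A(1) unfolding sep_def by blast
    from mini[OF this] show "card (cut G X) \<le> card (cut G X')" by (simp add: cut_compl[OF G])
  qed simp
  have "dismantlable G k L (verts G - A0 - X)"
    by (rule dismantlable_shift[OF G tA down compl[OF subset_trans[OF A0(1) A(1)] A0(2,3)]]) auto
  moreover have "dismantlable G k L (verts G - B0 - (verts G - X))"
    by (rule dismantlable_shift[OF G tB down compl[OF subset_trans[OF B0(1) B(1)] B0(2,3)]]) auto
  moreover have "verts G - A0 - X = verts G - X" "verts G - B0 - (verts G - X) = X"
    using X by (auto simp: sep_def)
  ultimately have dX: "dismantlable G k L X" and dX': "dismantlable G k L (verts G - X)" by simp_all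
  have eq: "{} \<union> \<Union> {X, verts G - X} = verts G" using X by (auto simp: sep_def)
  \<comment> \<open>The two halves are joined by a node with an empty bag. Both children have the
    same cut, and the root has none, so its adhesion is that of a single edge.\<close>
  have "dismantlable G k L ({} \<union> \<Union> {X, verts G - X})"
  proof (rule dismantlable.node)
    show "dismantlable G k L Z" if "Z \<in> {X, verts G - X}" for Z using that dX dX' by auto
    show "disjoint {X, verts G - X}" by (auto simp: disjoint_def)
    show "card (bold_cut G ({} \<union> \<Union> {X, verts G - X}) \<union> (\<Union>Z\<in>{X, verts G - X}. bold_cut G Z)) < k"
      unfolding eq using dismantlable_bold_cut[OF G dX] by (simp add: bold_cut_verts[OF G] bold_cut_compl[OF G])
  qed (use k in auto)
  then have "dismantlable G k L (verts G)" by (simp only: eq)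
  then show False using not by simp
qed

lemma ex_maximal_undismantlable:
  assumes G: "is_graph G" and k: "0 < k" and not: "\<not> dismantlable G k (small_sets G k) (verts G)"
  obtains L where "small_sets G k \<subseteq> L" "\<And>Y Y'. Y \<in> L \<Longrightarrow> Y' \<subseteq> Y \<Longrightarrow> Y' \<in> L"
    "\<not> dismantlable G k L (verts G)"
    "\<And>A B. A \<subseteq> verts G \<Longrightarrow> A \<notin> L \<Longrightarrow> B \<subseteq> verts G \<Longrightarrow> B \<notin> L \<Longrightarrow> A \<inter> B \<noteq> {}"
proof -
  define \<C> where "\<C> = {L. L \<subseteq> Pow (verts G) \<and> small_sets G k \<subseteq> L \<and>
    (\<forall>Y\<in>L. \<forall>Y'\<subseteq>Y. Y' \<in> L) \<and> \<not> dismantlable G k L (verts G)}"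
  have fV: "finite (verts G)" using G by (rule is_graph_finite)
  have "\<C> \<subseteq> Pow (Pow (verts G))" unfolding \<C>_def by blast
  then have "finite \<C>" by (rule finite_subset) (simp add: fV)
  moreover have "small_sets G k \<in> \<C>"
  proof -
    have "Y' \<in> small_sets G k" if "Y \<in> small_sets G k" "Y' \<subseteq> Y" for Y Y'
    proof -
      have "finite Y" using that fV by (auto simp: small_sets_def intro: finite_subset)
      then show ?thesis using that card_mono[of Y Y'] by (auto simp: small_sets_def)
    qed
    moreover have "small_sets G k \<subseteq> Pow (verts G)" by (auto simp: small_sets_def)
    ultimately show ?thesis using not unfolding \<C>_def by blast
  qed
  ultimately obtain L where L: "L \<in> \<C>" and maxL: "\<And>L'. L' \<in> \<C> \<Longrightarrow> L \<subseteq> L' \<Longrightarrow> L = L'"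
    using finite_has_maximal[of \<C>] by blast
  have down: "\<And>Y Y'. Y \<in> L \<Longrightarrow> Y' \<subseteq> Y \<Longrightarrow> Y' \<in> L" and sub: "small_sets G k \<subseteq> L"
    and notL: "\<not> dismantlable G k L (verts G)" and LV: "L \<subseteq> Pow (verts G)"
    using L unfolding \<C>_def by blast+
  have ne: "{} \<in> L" using sub k by (auto simp: small_sets_def)
  have maxi: "dismantlable G k (insert A L) (verts G)"
    if A: "A \<subseteq> verts G" "A \<notin> L" "\<forall>A'. A' \<subset> A \<longrightarrow> A' \<in> L" for A
  proof (rule ccontr)
    assume "\<not> ?thesis"
    \<comment> \<open>Minimality of \<open>A\<close> keeps the enlarged family closed under
      subsets.\<close>
    moreover have "\<forall>Y\<in>insert A L. \<forall>Y'\<subseteq>Y. Y' \<in> insert A L" using A(3) down by blast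
    ultimately have "insert A L \<in> \<C>" using A(1) LV sub unfolding \<C>_def by blast
    from maxL[OF this] show False using A(2) by blast
  qed
  show ?thesis
    by (rule that[OF sub down notL big_sets_touch[OF G k down ne notL maxi]])
qed

text \<open>The common edges of the two cuts are those between \<open>D\<close> and
  \<open>D'\<close>; they are counted twice on the right and vanish from the cut of the
  union.\<close>

lemma card_cut_disjoint_Un:
  assumes G: "is_graph G" and disj: "D \<inter> D' = {}"
  shows "card (cut G (D \<union> D')) + 2 * card (cut G D \<inter> cut G D') = card (cut G D) + card (cut G D')"
proof -
  have eq: "cut G (D \<union> D') = (cut G D \<union> cut G D') - (cut G D \<inter> cut G D')"
  proof -
    have "e \<in> cut G (D \<union> D') \<longleftrightarrow> e \<in> (cut G D \<union> cut G D') - (cut G D \<inter> cut G D')"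
      if e: "e \<in> edges G" for e
    proof -
      obtain x y where xy: "ends G e = {x, y}" using is_graph_ends[OF G e] by metis
      show ?thesis unfolding Un_iff Int_iff Diff_iff in_cut_iff[OF G e xy] using disj by blast
    qed
    then show ?thesis using cut_subset[of G "D \<union> D'"] cut_subset[of G D] cut_subset[of G D'] by blast
  qed
  have "card (cut G (D \<union> D')) = card (cut G D \<union> cut G D') - card (cut G D \<inter> cut G D')"
    unfolding eq by (intro card_Diff_subset) (use G in auto)
  moreover have "card (cut G D) + card (cut G D') = card (cut G D \<union> cut G D') + card (cut G D \<inter> cut G D')"
    using G by (intro card_Un_Int) simp_all
  moreover have "card (cut G D \<inter> cut G D') \<le> card (cut G D \<union> cut G D')"
    using G by (intro card_mono) auto
  ultimately show ?thesis by linarith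
qed

section \<open>Cutting off thin sets down to a 3-edge-connected remainder\<close>

locale big_sets =
  fixes G :: "('v, 'e) mgraph" and k :: nat and L :: "'v set set"
  assumes G: "is_graph G" and k: "0 < k"
    and small: "small_sets G k \<subseteq> L"
    and down: "Y \<in> L \<Longrightarrow> Y' \<subseteq> Y \<Longrightarrow> Y' \<in> L"
    and undismantlable: "\<not> dismantlable G k L (verts G)"
    and touch: "A \<subseteq> verts G \<Longrightarrow> A \<notin> L \<Longrightarrow> B \<subseteq> verts G \<Longrightarrow> B \<notin> L \<Longrightarrow> A \<inter> B \<noteq> {}"
begin

definition thin_sets :: "'v set set" where
  "thin_sets = {X \<in> L. X \<subseteq> verts G \<and> X \<noteq> {} \<and> card (cut G X) < 3}"

lemma finite_verts: "finite (verts G)"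
  using G by (rule is_graph_finite)

text \<open>Otherwise a star with an empty centre and these sets as leaves would dismantle
  \<open>V(G)\<close>: none of its edges is bold.\<close>

lemma thin_not_cover:
  assumes "\<A> \<subseteq> L" "\<And>X. X \<in> \<A> \<Longrightarrow> X \<subseteq> verts G" "\<And>X. X \<in> \<A> \<Longrightarrow> card (cut G X) < 3" "disjoint \<A>"
  shows "\<Union> \<A> \<noteq> verts G"
proof
  assume eq: "\<Union> \<A> = verts G"
  have "dismantlable G k L ({} \<union> \<Union> \<A>)"
  proof (rule dismantlable.node)
    show "dismantlable G k L X" if "X \<in> \<A>" for X
      using that assms k bold_cut_thin[OF assms(3)[OF that]] by (intro dismantlable.leaf) auto
    have "bold_cut G ({} \<union> \<Union> \<A>) \<union> (\<Union>Z\<in>\<A>. bold_cut G Z) = {}"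
      using bold_cut_thin[OF assms(3)] by (simp add: eq bold_cut_verts[OF G])
    then show "card (bold_cut G ({} \<union> \<Union> \<A>) \<union> (\<Union>Z\<in>\<A>. bold_cut G Z)) < k"
      using k by simp
  qed (use assms k in auto)
  then show False using undismantlable eq by simp
qed

lemma thin_dichotomy:
  assumes "X \<subseteq> verts G"
  shows "X \<in> L \<or> verts G - X \<in> L"
  using touch[of X "verts G - X"] assms by blast

definition families :: "'v set set set" where
  "families = {\<A>. \<A> \<subseteq> thin_sets \<and> disjoint \<A>}"

text \<open>Lexicographic optimality: maximality of the union makes its complement 3-edge-connected,
  minimality of the sum forbids adjacent members, and maximality of the number of members makes each
  of them connected.\<close>

definition family_measure :: "('v set set \<times> 'v set set) set" where
  "family_measure = measures [\<lambda>\<A>. card (verts G - \<Union> \<A>), \<lambda>\<A>. \<Sum>A\<in>\<A>. card (cut G A),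
     \<lambda>\<A>. card (Pow (verts G)) - card \<A>]"

lemma ex_optimal_family:
  obtains \<A> where "\<A> \<in> families" "\<And>\<A>'. \<A>' \<in> families \<Longrightarrow> (\<A>', \<A>) \<notin> family_measure"
proof -
  have "{} \<in> families" by (simp add: families_def disjoint_def)
  moreover have "wf family_measure" by (simp add: family_measure_def)
  ultimately obtain \<A> where "\<A> \<in> families" "\<And>\<A>'. (\<A>', \<A>) \<in> family_measure \<Longrightarrow> \<A>' \<notin> families"
    by (metis wfE_min)
  then show ?thesis using that by blast
qed

end

locale optimal_family = big_sets G k L
  for G :: "('v, 'e) mgraph" and k L +
  fixes \<A> :: "'v set set"
  assumes fam: "\<A> \<in> families"
    and optimal: "\<A>' \<in> families \<Longrightarrow> (\<A>', \<A>) \<notin> family_measure"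
begin

definition Q :: "'v set" where
  "Q = verts G - \<Union> \<A>"

lemma family_disjoint: "disjoint \<A>"
  using fam by (simp add: families_def)

lemma family_thin: "A \<in> \<A> \<Longrightarrow> A \<in> thin_sets"
  using fam by (auto simp: families_def)

lemma family_subset: "A \<in> \<A> \<Longrightarrow> A \<subseteq> verts G"
  using family_thin by (simp add: thin_sets_def)

lemma finite_family: "finite \<A>"
  by (rule finite_subset[of _ "Pow (verts G)"]) (use family_subset finite_verts in auto)

lemma Q_nonempty: "Q \<noteq> {}"
proof
  assume "Q = {}"
  then have "\<Union> \<A> = verts G" using family_subset by (auto simp: Q_def)
  moreover have "\<Union> \<A> \<noteq> verts G"
    using family_thin family_disjoint by (intro thin_not_cover) (auto simp: thin_sets_def)
  ultimately show False by blast
qed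

text \<open>A thin cut splitting \<open>Q\<close> provides a thin set of \<open>L\<close> that meets
  \<open>Q\<close>, namely \<open>X\<close> or its complement. A smallest such set \<open>A\<close>
  can be added to the family if the members are shrunk to \<open>Z - A\<close>, and then the union
  has grown.\<close>

lemma Q_not_separated:
  assumes X: "X \<subseteq> verts G" "X \<inter> Q \<noteq> {}" "Q - X \<noteq> {}"
  shows "3 \<le> card (cut G X)"
proof (rule ccontr)
  assume "\<not> ?thesis"
  then have thin: "card (cut G X) < 3" by simp
  define S where "S Y \<longleftrightarrow> Y \<in> thin_sets \<and> Y \<inter> Q \<noteq> {}" for Y
  have "\<exists>Y. S Y"
  proof (cases "X \<in> L")
    case True
    then have "S X" using X thin by (auto simp: S_def thin_sets_def)
    then show ?thesis ..
  next
    case False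
    then have "verts G - X \<in> L" using thin_dichotomy[OF X(1)] by blast
    then have "S (verts G - X)" using X thin
      by (auto simp: S_def thin_sets_def cut_compl[OF G] Q_def)
    then show ?thesis ..
  qed
  then obtain Y0 where "S Y0" ..
  then have "\<exists>A. S A \<and> (\<forall>Y. S Y \<longrightarrow> card A \<le> card Y)"
    using ex_has_least_nat[of S Y0 card] by simp
  then obtain A where A: "S A" and mini: "\<forall>Y. S Y \<longrightarrow> card A \<le> card Y"
    by (elim exE conjE)
  have AL: "A \<in> L" and AV: "A \<subseteq> verts G" and AQ: "A \<inter> Q \<noteq> {}" and At: "card (cut G A) < 3"
    using A by (auto simp: S_def thin_sets_def)
  have finA: "finite A" using AV finite_verts by (rule finite_subset)
  \<comment> \<open>The cuts of \<open>Z\<close> and \<open>A\<close> have at most 2 edges each, so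
    by posimodularity \<open>Z - A\<close> and \<open>A - Z\<close> cannot both have 3 or more. If
    \<open>Z\<close> meets \<open>A\<close>, then \<open>A - Z\<close> is not thin: it still meets
    \<open>Q\<close>, lies in \<open>L\<close> and is smaller than \<open>A\<close>.\<close>
  have thin_diff: "card (cut G (Z - A)) < 3" if Z: "Z \<in> \<A>" for Z
  proof (cases "Z \<inter> A = {}")
    case True
    then have "Z - A = Z" by blast
    then show ?thesis using family_thin[OF Z] by (simp add: thin_sets_def)
  next
    case False
    have "card (A - Z) < card A" using False by (intro psubset_card_mono finA) blast
    then have "\<not> S (A - Z)" using mini by force
    moreover have "(A - Z) \<inter> Q \<noteq> {}" using AQ Z by (auto simp: Q_def)
    moreover have "A - Z \<in> L" by (rule down[OF AL]) blast
    ultimately have "\<not> card (cut G (A - Z)) < 3" using AV by (auto simp: S_def thin_sets_def)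
    moreover have "card (cut G Z) < 3" using family_thin[OF Z] by (simp add: thin_sets_def)
    ultimately show ?thesis using cut_posimodular[OF G, of Z A] At by linarith
  qed
  define \<A>' where "\<A>' = insert A ((\<lambda>Z. Z - A) ` \<A> - {{}})"
  have "Z - A \<in> thin_sets" if "Z \<in> \<A>" "Z - A \<noteq> {}" for Z
    using family_thin[OF that(1)] thin_diff[OF that(1)] that(2) down[of Z "Z - A"] by (auto simp: thin_sets_def)
  then have "\<A>' \<subseteq> thin_sets" using A by (auto simp: \<A>'_def S_def)
  moreover have "disjoint \<A>'" using family_disjoint unfolding \<A>'_def disjoint_def by blast
  ultimately have "\<A>' \<in> families" by (simp add: families_def)
  moreover have "verts G - \<Union> \<A>' \<subset> verts G - \<Union> \<A>"
    using AQ unfolding \<A>'_def Q_def by blast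
  then have "card (verts G - \<Union> \<A>') < card (verts G - \<Union> \<A>)"
    using finite_verts by (intro psubset_card_mono) simp_all
  then have "(\<A>', \<A>) \<in> family_measure" by (simp add: family_measure_def)
  ultimately show False using optimal by blast
qed

lemma three_edge_connected_Q: "three_edge_connected_set G Q"
  unfolding three_edge_connected_set_def
proof (intro conjI ballI)
  show "Q \<subseteq> verts G" by (auto simp: Q_def)
  fix u v assume uv: "u \<in> Q" "v \<in> Q"
  show "three_edge_connected G u v"
  proof (rule three_edge_connectedI[OF G])
    show "u \<in> verts G" using uv by (simp add: Q_def)
    fix X assume "X \<subseteq> verts G" "u \<in> X" "v \<notin> X"
    then show "3 \<le> card (cut G X)" using uv by (intro Q_not_separated) auto
  qed
qed

text \<open>Without an edge between \<open>D\<close> and \<open>A - D\<close> the boundary of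
  \<open>A\<close> is divided between the two. Replacing \<open>A\<close> by both pieces would
  preserve the union and the sum of the boundaries and produce one more member.\<close>

lemma family_member_connected:
  assumes A: "A \<in> \<A>" and D: "D \<subseteq> A" "D \<noteq> {}" "D \<noteq> A"
  shows "cut G D \<inter> cut G (A - D) \<noteq> {}"
proof
  assume none: "cut G D \<inter> cut G (A - D) = {}"
  have "D \<union> (A - D) = A" using D by blast
  then have sum: "card (cut G A) = card (cut G D) + card (cut G (A - D))"
    using card_cut_disjoint_Un[OF G, of D "A - D"] none by simp
  let ?R = "\<A> - {A}"
  define \<A>' where "\<A>' = insert D (insert (A - D) ?R)"
  have tA: "A \<in> L" "A \<subseteq> verts G" "card (cut G A) < 3" using family_thin[OF A] by (auto simp: thin_sets_def)
  have "D \<in> L" "A - D \<in> L" using D tA by (auto intro: down)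
  then have "D \<in> thin_sets" "A - D \<in> thin_sets" using D tA sum by (auto simp: thin_sets_def)
  then have "\<A>' \<subseteq> thin_sets" using family_thin by (auto simp: \<A>'_def)
  have RA: "Z \<inter> A = {}" if "Z \<in> ?R" for Z using family_disjoint A that by (auto dest: disjointD)
  have nonempty: "Z \<noteq> {}" if "Z \<in> ?R" for Z using family_thin[of Z] that by (auto simp: thin_sets_def)
  have "D \<notin> ?R" "A - D \<notin> ?R" "D \<noteq> A - D" using RA[of D] RA[of "A - D"] D by blast+
  have "disjoint \<A>'"
    unfolding disjoint_def \<A>'_def using family_disjoint[unfolded disjoint_def] RA D(1) by blast
  with \<open>\<A>' \<subseteq> thin_sets\<close> have fam': "\<A>' \<in> families" by (simp add: families_def)
  have "\<Union> \<A>' = \<Union> \<A>" using A D(1) by (auto simp: \<A>'_def)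
  moreover have "(\<Sum>A\<in>\<A>'. card (cut G A)) = (\<Sum>A\<in>\<A>. card (cut G A))"
    using finite_family A \<open>D \<notin> ?R\<close> \<open>A - D \<notin> ?R\<close> \<open>D \<noteq> A - D\<close> sum
    by (simp add: \<A>'_def sum.remove[of \<A> A])
  moreover have "card \<A>' = Suc (card \<A>)"
  proof -
    have "card \<A>' = Suc (Suc (card ?R))"
      using finite_family \<open>D \<notin> ?R\<close> \<open>A - D \<notin> ?R\<close> \<open>D \<noteq> A - D\<close> by (simp add: \<A>'_def)
    moreover have "card \<A> = Suc (card ?R)" using finite_family A by (rule card.remove)
    ultimately show ?thesis by simp
  qed
  \<comment> \<open>This bound keeps the truncated subtraction in \<open>family_measure\<close>
    strictly decreasing.\<close>
  moreover have "card \<A>' \<le> card (Pow (verts G))"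
    using fam' finite_verts by (intro card_mono) (auto simp: families_def thin_sets_def)
  ultimately have "(\<A>', \<A>) \<in> family_measure" by (simp add: family_measure_def)
  then show False using optimal fam' by blast
qed

text \<open>Merging two adjacent members preserves the union and lowers the sum by at least 2. The
  merged set is thin, and it lies in \<open>L\<close>: otherwise its complement does, and this
  complement together with \<open>A\<close> and \<open>B\<close> would cover \<open>V(G)\<close> by
  thin sets of \<open>L\<close>.\<close>

lemma family_members_not_adjacent:
  assumes A: "A \<in> \<A>" and B: "B \<in> \<A>" "A \<noteq> B"
  shows "cut G A \<inter> cut G B = {}"
proof (rule ccontr)
  assume adj: "cut G A \<inter> cut G B \<noteq> {}"
  have disj: "A \<inter> B = {}" using family_disjoint A B by (auto dest: disjointD)
  have tA: "A \<in> L" "A \<subseteq> verts G" "card (cut G A) < 3" "A \<noteq> {}"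
    and tB: "B \<in> L" "B \<subseteq> verts G" "card (cut G B) < 3" "B \<noteq> {}"
    using family_thin A B by (auto simp: thin_sets_def)
  have "1 \<le> card (cut G A \<inter> cut G B)"
    using adj G by (simp add: Suc_le_eq card_gt_0_iff)
  then have le: "card (cut G (A \<union> B)) + 2 \<le> card (cut G A) + card (cut G B)"
    using card_cut_disjoint_Un[OF G disj] by linarith
  have "A \<union> B \<in> L"
  proof (rule ccontr)
    assume "A \<union> B \<notin> L"
    then have "verts G - (A \<union> B) \<in> L" using thin_dichotomy[of "A \<union> B"] tA tB by blast
    moreover have "card (cut G (verts G - (A \<union> B))) < 3"
      using le tA tB by (simp add: cut_compl[OF G])
    ultimately have "\<Union> {A, B, verts G - (A \<union> B)} \<noteq> verts G"
      using tA tB disj by (intro thin_not_cover) (auto simp: disjoint_def)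
    moreover have "\<Union> {A, B, verts G - (A \<union> B)} = verts G" using tA(2) tB(2) by auto
    ultimately show False by simp
  qed
  then have tAB: "A \<union> B \<in> thin_sets" using le tA tB by (simp add: thin_sets_def)
  let ?R = "\<A> - {A} - {B}"
  define \<A>' where "\<A>' = insert (A \<union> B) ?R"
  have RA: "Z \<inter> (A \<union> B) = {}" if "Z \<in> ?R" for Z
    using family_disjoint A B that by (auto dest: disjointD)
  have "\<A>' \<subseteq> thin_sets" using family_thin tAB by (auto simp: \<A>'_def)
  moreover have "disjoint \<A>'"
    unfolding disjoint_def \<A>'_def using family_disjoint[unfolded disjoint_def] RA by blast
  ultimately have fam': "\<A>' \<in> families" by (simp add: families_def)
  have "A \<union> B \<notin> ?R" using RA[of "A \<union> B"] tA by blast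
  have "\<Union> \<A>' = \<Union> \<A>" using A B by (auto simp: \<A>'_def)
  moreover have "(\<Sum>A\<in>\<A>'. card (cut G A)) < (\<Sum>A\<in>\<A>. card (cut G A))"
  proof -
    have "(\<Sum>A\<in>\<A>. card (cut G A)) = card (cut G A) + (card (cut G B) + (\<Sum>A\<in>?R. card (cut G A)))"
      using finite_family A B by (simp add: sum.remove[of \<A> A] sum.remove[of "\<A> - {A}" B])
    moreover have "(\<Sum>A\<in>\<A>'. card (cut G A)) = card (cut G (A \<union> B)) + (\<Sum>A\<in>?R. card (cut G A))"
      using finite_family \<open>A \<union> B \<notin> ?R\<close> unfolding \<A>'_def by (intro sum.insert) auto
    ultimately show ?thesis using le by linarith
  qed
  ultimately have "(\<A>', \<A>) \<in> family_measure" by (simp add: family_measure_def)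
  then show False using optimal fam' by blast
qed

lemma family_cut_ends:
  assumes A: "A \<in> \<A>" and e: "e \<in> cut G A"
  obtains a q where "ends G e = {a, q}" "a \<in> A" "q \<in> Q"
proof -
  have eE: "e \<in> edges G" using e cut_subset[of G A] by blast
  obtain x y where xy: "ends G e = {x, y}" "x \<in> verts G" "y \<in> verts G"
    using is_graph_ends[OF G eE] by metis
  have xyA: "(x \<in> A) \<noteq> (y \<in> A)" using e in_cut_iff[OF G eE xy(1)] by blast
  then obtain a q where aq: "ends G e = {a, q}" "a \<in> A" "q \<notin> A" "q \<in> verts G"
    using xy by (metis insert_commute)
  have "q \<in> Q"
  proof (rule ccontr)
    assume "q \<notin> Q"
    then obtain B where B: "B \<in> \<A>" "q \<in> B" using aq by (auto simp: Q_def)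
    then have "B \<noteq> A" using aq by blast
    then have "A \<inter> B = {}" using family_disjoint A B by (auto dest: disjointD)
    then have "a \<notin> B" using aq(2) by blast
    then have "e \<in> cut G B" using B(2) in_cut_iff[OF G eE aq(1)] by blast
    then show False using family_members_not_adjacent[OF A B(1)] \<open>B \<noteq> A\<close> e by blast
  qed
  then show ?thesis using that aq by blast
qed

lemma ex_attachment:
  assumes A: "A \<in> \<A>"
  shows "\<exists>q\<in>Q. cut G A \<noteq> {} \<longrightarrow> (\<exists>e\<in>cut G A. q \<in> ends G e)"
proof (cases "cut G A = {}")
  case True
  then show ?thesis using Q_nonempty by blast
next
  case False
  then obtain e where e: "e \<in> cut G A" by blast
  obtain a q where "ends G e = {a, q}" "q \<in> Q" using family_cut_ends[OF A e] by metis
  then show ?thesis using e by blast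
qed

text \<open>A member with an empty boundary, possible when \<open>G\<close> is disconnected, may be
  attached to any vertex of \<open>Q\<close>.\<close>

definition attach :: "'v set \<Rightarrow> 'v" where
  "attach A = (SOME q. q \<in> Q \<and> (cut G A \<noteq> {} \<longrightarrow> (\<exists>e\<in>cut G A. q \<in> ends G e)))"

definition retract :: "'v \<Rightarrow> 'v" where
  "retract x = (if x \<in> Q then x else attach (THE A. A \<in> \<A> \<and> x \<in> A))"

lemma attach:
  assumes "A \<in> \<A>"
  shows "attach A \<in> Q" "cut G A \<noteq> {} \<Longrightarrow> \<exists>e\<in>cut G A. attach A \<in> ends G e"
proof -
  let ?P = "\<lambda>q. q \<in> Q \<and> (cut G A \<noteq> {} \<longrightarrow> (\<exists>e\<in>cut G A. q \<in> ends G e))"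
  have "\<exists>q. ?P q" using ex_attachment[OF assms] by (elim bexE) (rule exI, erule conjI)
  then have *: "?P (attach A)" unfolding attach_def by (rule someI_ex)
  from * show "attach A \<in> Q" by (rule conjunct1)
  assume "cut G A \<noteq> {}"
  with * show "\<exists>e\<in>cut G A. attach A \<in> ends G e" by simp
qed

lemma retract_Q: "x \<in> Q \<Longrightarrow> retract x = x"
  by (simp add: retract_def)

lemma retract_family:
  assumes "A \<in> \<A>" "x \<in> A"
  shows "retract x = attach A"
proof -
  have "(THE A. A \<in> \<A> \<and> x \<in> A) = A"
    using assms family_disjoint by (intro the_equality) (auto dest: disjointD)
  moreover have "x \<notin> Q" using assms by (auto simp: Q_def)
  ultimately show ?thesis by (simp add: retract_def)
qed

lemma retract_in_Q:
  assumes "x \<in> verts G"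
  shows "retract x \<in> Q"
proof (cases "x \<in> Q")
  case True
  then show ?thesis by (simp add: retract_Q)
next
  case False
  then obtain A where "A \<in> \<A>" "x \<in> A" using assms by (auto simp: Q_def)
  then show ?thesis using retract_family[of A x] attach(1)[of A] by simp
qed

end

lemma enat_le_bramble_order_iff:
  "enat k \<le> bramble_order G \<B> \<longleftrightarrow>
    (\<forall>F. disconnecting_set G \<B> F \<longrightarrow> k \<le> card F) \<and> (\<forall>s\<in>\<B>. k \<le> card (snd s))"
  by (auto simp: bramble_order_def adhesion_order_def bag_order_def le_INF_iff)

section \<open>Moving the thin members into \<open>Q\<close>\<close>

context optimal_family
begin

lemma Q_subset: "Q \<subseteq> verts G"
  by (auto simp: Q_def)

lemma Q_disjoint: "A \<in> \<A> \<Longrightarrow> x \<in> A \<Longrightarrow> x \<notin> Q"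
  by (auto simp: Q_def)

text \<open>What becomes of \<open>F\<close> after every thin member has been moved to its
  attachment vertex: these edges contain the boundary of every \<open>part F q\<close>.\<close>

definition crossing :: "'e set \<Rightarrow> 'e set" where
  "crossing F = {e \<in> edges G. \<exists>x y. ends G e = {x, y} \<and> \<not> conn (del_edges G F) (retract x) (retract y)}"

lemma attach_edge:
  assumes A: "A \<in> \<A>" and ne: "cut G A \<noteq> {}"
  obtains e a where "e \<in> cut G A" "ends G e = {a, attach A}" "a \<in> A"
proof -
  obtain e where e: "e \<in> cut G A" "attach A \<in> ends G e" using attach(2)[OF A ne] by blast
  obtain a q where aq: "ends G e = {a, q}" "a \<in> A" "q \<in> Q" using family_cut_ends[OF A e(1)] by metis
  then have "attach A \<noteq> a" using Q_disjoint[OF A aq(2)] attach(1)[OF A] by blast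
  then have "attach A = q" using e(2) aq(1) by simp
  then show ?thesis using that e(1) aq by blast
qed

text \<open>A crossing edge at a member \<open>A\<close> is charged to an edge of \<open>F\<close> meeting \<open>A\<close>. At most one edge at \<open>A\<close>
  crosses, because \<open>A\<close> has at most two boundary edges and one of them leads to the attachment vertex.\<close>

lemma crossing_meets:
  assumes A: "A \<in> \<A>" and e: "e \<in> cut G A" "e \<in> crossing F"
  shows "\<exists>f\<in>F. ends G f \<inter> A \<noteq> {}"
proof (rule ccontr)
  assume none: "\<not> ?thesis"
  let ?H = "del_edges G F"
  have H: "is_graph ?H" using G by (rule is_graph_del_edges)
  let ?c = "attach A"
  have cV: "?c \<in> verts G" using attach(1)[OF A] Q_subset by blast
  obtain e1 a1 where e1: "e1 \<in> cut G A" "ends G e1 = {a1, ?c}" "a1 \<in> A"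
    using attach_edge[OF A] e(1) by blast
  have step: "conn ?H ?c t" if "conn ?H ?c s" "f \<in> edges G" "ends G f = {s, t}" "s \<in> A \<or> t \<in> A" for s t f
  proof (rule conn_step[OF that(1)])
    have "f \<notin> F" using none that by auto
    then show "f \<in> edges ?H" "ends ?H f = {s, t}" using that by simp_all
  qed
  have edge: "f \<in> edges G" if "f \<in> cut G Y" for f Y using that cut_subset[of G Y] by blast
  have "conn ?H ?c a1"
  proof (rule step)
    show "conn ?H ?c ?c" using cV by (intro conn_refl) simp
    show "e1 \<in> edges G" using e1(1) by (rule edge)
    show "ends G e1 = {?c, a1}" using e1(2) by (simp add: insert_commute)
    show "?c \<in> A \<or> a1 \<in> A" using e1(3) by simp
  qed
  \<comment> \<open>No edge meeting \<open>A\<close> is in \<open>F\<close>, so the connectedness of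
    \<open>A\<close> spreads the connection with the attachment vertex from \<open>a1\<close> to all
    of \<open>A\<close>, and then along \<open>e\<close> to its end in \<open>Q\<close>.\<close>
  define D where "D = {a \<in> A. conn ?H ?c a}"
  have "D = A"
  proof (rule ccontr)
    assume "D \<noteq> A"
    moreover have "D \<subseteq> A" "D \<noteq> {}" using \<open>conn ?H ?c a1\<close> e1(3) by (auto simp: D_def)
    ultimately obtain f where f: "f \<in> cut G D" "f \<in> cut G (A - D)"
      using family_member_connected[OF A] by blast
    have fE: "f \<in> edges G" using edge[OF f(1)] .
    obtain s t where st: "ends G f = {s, t}" using is_graph_ends[OF G fE] by metis
    have "(s \<in> D) \<noteq> (t \<in> D)" "(s \<in> A - D) \<noteq> (t \<in> A - D)"
      using f in_cut_iff[OF G fE st, of D] in_cut_iff[OF G fE st, of "A - D"] by simp_all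
    then have "s \<in> D \<and> t \<in> A - D \<or> t \<in> D \<and> s \<in> A - D" by blast
    then show False
    proof
      assume "s \<in> D \<and> t \<in> A - D"
      then show False using step[OF _ fE st] by (simp add: D_def)
    next
      assume "t \<in> D \<and> s \<in> A - D"
      then show False using step[OF _ fE, of t s] st by (simp add: D_def insert_commute)
    qed
  qed
  obtain a q where aq: "ends G e = {a, q}" "a \<in> A" "q \<in> Q" using family_cut_ends[OF A e(1)] by metis
  have "conn ?H ?c a" using aq(2) \<open>D = A\<close> by (auto simp: D_def)
  then have "conn ?H ?c q" using aq edge[OF e(1)] by (intro step[of a e q]) auto
  obtain x y where xy: "ends G e = {x, y}" "\<not> conn ?H (retract x) (retract y)"
    using e(2) by (auto simp: crossing_def)
  have "retract a = ?c" "retract q = q" using aq A by (simp_all add: retract_family retract_Q)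
  moreover have "x = a \<and> y = q \<or> x = q \<and> y = a" using xy aq by (auto simp: doubleton_eq_iff)
  ultimately show False using xy(2) \<open>conn ?H ?c q\<close> conn_sym[OF H \<open>conn ?H ?c q\<close>] by auto
qed

lemma crossing_inside_Q:
  assumes "e \<in> crossing F" "ends G e \<subseteq> Q"
  shows "e \<in> F"
proof (rule ccontr)
  assume "e \<notin> F"
  obtain x y where xy: "e \<in> edges G" "ends G e = {x, y}"
      "\<not> conn (del_edges G F) (retract x) (retract y)"
    using assms(1) by (auto simp: crossing_def)
  have "x \<in> Q" "y \<in> Q" using xy assms by auto
  then have "\<not> conn (del_edges G F) x y" using xy(3) by (simp add: retract_Q)
  moreover have "conn (del_edges G F) x y"
    using \<open>e \<notin> F\<close> xy \<open>x \<in> Q\<close> Q_subset by (intro conn_step[OF conn_refl]) auto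
  ultimately show False by blast
qed

text \<open>An edge inside a member never crosses, since both ends retract to the same
  vertex.\<close>

lemma crossing_outside_Q:
  assumes "e \<in> crossing F" "\<not> ends G e \<subseteq> Q"
  shows "\<exists>A\<in>\<A>. e \<in> cut G A"
proof -
  obtain x y where xy: "e \<in> edges G" "ends G e = {x, y}"
      "\<not> conn (del_edges G F) (retract x) (retract y)"
    using assms(1) by (auto simp: crossing_def)
  have V: "x \<in> verts G" "y \<in> verts G" using is_graph_arc[OF G xy(1,2)] by simp_all
  have "x \<notin> Q \<or> y \<notin> Q" using assms(2) xy(2) by auto
  then obtain A where A: "A \<in> \<A>" "x \<in> A \<or> y \<in> A" using V by (auto simp: Q_def)
  have "\<not> (x \<in> A \<and> y \<in> A)"
  proof
    assume "x \<in> A \<and> y \<in> A"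
    then have "retract x = attach A" "retract y = attach A" using A(1) by (simp_all add: retract_family)
    moreover have "attach A \<in> verts G" using attach(1)[OF A(1)] Q_subset by blast
    ultimately show False using xy(3) by (simp add: conn_refl)
  qed
  then have "e \<in> cut G A" using A(2) in_cut_iff[OF G xy(1,2), of A] by blast
  then show ?thesis using A(1) by blast
qed

text \<open>An edge inside \<open>Q\<close> is charged to itself, any other to an edge of
  \<open>F\<close> at a member. The charges are injective across members as well: an edge of
  \<open>F\<close> that met two members would make them adjacent, and one that meets a member does
  not lie inside \<open>Q\<close>.\<close>

lemma card_crossing:
  assumes F: "F \<subseteq> edges G"
  shows "card (crossing F) \<le> card F"
proof -
  define \<Phi> where "\<Phi> e f \<longleftrightarrow> f \<in> F \<and>
    (ends G e \<subseteq> Q \<and> f = e \<or> (\<exists>A\<in>\<A>. e \<in> cut G A \<and> ends G f \<inter> A \<noteq> {}))" for e f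
  have "\<exists>f. \<Phi> e f" if e: "e \<in> crossing F" for e
  proof (cases "ends G e \<subseteq> Q")
    case True
    then show ?thesis using crossing_inside_Q[OF e] by (auto simp: \<Phi>_def)
  next
    case False
    then obtain A where A: "A \<in> \<A>" "e \<in> cut G A" using crossing_outside_Q[OF e] by blast
    then obtain f where "f \<in> F" "ends G f \<inter> A \<noteq> {}" using crossing_meets[OF A e] by blast
    then show ?thesis using A by (auto simp: \<Phi>_def)
  qed
  then have "\<exists>g. \<forall>e\<in>crossing F. \<Phi> e (g e)" by (intro bchoice) blast
  then obtain g where g: "\<And>e. e \<in> crossing F \<Longrightarrow> \<Phi> e (g e)" by blast
  \<comment> \<open>Both ends of such an edge retract to \<open>attach A\<close>.\<close>
  have not_attach: False if hyp: "A \<in> \<A>" "e \<in> crossing F" "ends G e = {a, attach A}" "a \<in> A" for A e a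
  proof -
    obtain x y where xy: "ends G e = {x, y}" "\<not> conn (del_edges G F) (retract x) (retract y)"
      using hyp(2) by (auto simp: crossing_def)
    have "retract a = attach A" "retract (attach A) = attach A"
      using hyp attach(1) by (simp_all add: retract_family retract_Q)
    then have "retract x = attach A" "retract y = attach A"
      using xy(1) hyp(3) by (auto simp: doubleton_eq_iff)
    moreover have "attach A \<in> verts G" using attach(1)[OF hyp(1)] Q_subset by blast
    ultimately show False using xy(2) by (simp add: conn_refl)
  qed
  have "inj_on g (crossing F)"
  proof (rule inj_onI, rule ccontr)
    fix e e' assume e: "e \<in> crossing F" and e': "e' \<in> crossing F" and eq: "g e = g e'" and ne: "e \<noteq> e'"
    let ?f = "g e"
    have fE: "?f \<in> edges G" using g[OF e] F by (auto simp: \<Phi>_def)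
    obtain x y where xy: "ends G ?f = {x, y}" using is_graph_ends[OF G fE] by metis
    have inQ: "\<not> ends G h \<subseteq> Q" if "A \<in> \<A>" "ends G h \<inter> A \<noteq> {}" for A h
      using that Q_disjoint by blast
    consider "?f = e" "?f = e'" | A where "A \<in> \<A>" "ends G ?f \<inter> A \<noteq> {}" "ends G ?f \<subseteq> Q"
      | A A' where "A \<in> \<A>" "e \<in> cut G A" "ends G ?f \<inter> A \<noteq> {}"
        "A' \<in> \<A>" "e' \<in> cut G A'" "ends G ?f \<inter> A' \<noteq> {}"
      using g[OF e] g[OF e'] eq unfolding \<Phi>_def by metis
    then show False
    proof cases
      case 1
      then show False using ne by simp
    next
      case 2
      then show False using inQ by blast
    next
      case 3
      show False
      proof (cases "A = A'")
        case False
        then have disj: "A \<inter> A' = {}" using family_disjoint 3 by (auto dest: disjointD)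
        have "(x \<in> A \<or> y \<in> A) \<and> (x \<in> A' \<or> y \<in> A')" using 3 xy by auto
        then have "(x \<in> A) \<noteq> (y \<in> A)" "(x \<in> A') \<noteq> (y \<in> A')" using disj by blast+
        then have "?f \<in> cut G A" "?f \<in> cut G A'"
          using in_cut_iff[OF G fE xy, of A] in_cut_iff[OF G fE xy, of A'] by simp_all
        then show False using family_members_not_adjacent[OF 3(1,4) False] by blast
      next
        case True
        obtain e1 a1 where e1: "e1 \<in> cut G A" "ends G e1 = {a1, attach A}" "a1 \<in> A"
          using attach_edge[OF 3(1)] 3(2) by blast
        then have "e1 \<notin> crossing F" using not_attach[OF 3(1)] by blast
        then have "card {e, e', e1} = 3" using e e' ne by (auto simp: card_insert_if)
        moreover have "card {e, e', e1} \<le> card (cut G A)"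
          using 3 True e1 G by (intro card_mono) auto
        moreover have "card (cut G A) < 3" using family_thin[OF 3(1)] by (simp add: thin_sets_def)
        ultimately show False by simp
      qed
    qed
  qed
  moreover have "g ` crossing F \<subseteq> F" using g by (auto simp: \<Phi>_def)
  ultimately show ?thesis using finite_edge_set[OF G F] by (rule card_inj_on_le)
qed

text \<open>The vertices of \<open>Q\<close> in the component of \<open>q\<close> in
  \<open>G - F\<close>, with all members attached to them. A member is taken as a whole even if
  \<open>F\<close> cuts through it.\<close>

definition part :: "'e set \<Rightarrow> 'v \<Rightarrow> 'v set" where
  "part F q = {x \<in> verts G. conn (del_edges G F) q (retract x)}"

lemma cut_part_subset:
  shows "cut G (part F q) \<subseteq> crossing F"
proof
  let ?H = "del_edges G F"
  have H: "is_graph ?H" using G by (rule is_graph_del_edges)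
  fix e assume e: "e \<in> cut G (part F q)"
  then have eE: "e \<in> edges G" using cut_subset[of G "part F q"] by blast
  obtain x y where xy: "ends G e = {x, y}" "x \<in> verts G" "y \<in> verts G"
    using is_graph_ends[OF G eE] by metis
  have ne: "conn ?H q (retract x) \<noteq> conn ?H q (retract y)"
    using e in_cut_iff[OF G eE xy(1)] xy by (simp add: part_def)
  have "\<not> conn ?H (retract x) (retract y)"
  proof
    assume c: "conn ?H (retract x) (retract y)"
    show False using ne conn_trans[OF _ c] conn_trans[OF _ conn_sym[OF H c]] by blast
  qed
  then show "e \<in> crossing F" using eE xy by (auto simp: crossing_def)
qed

lemma family_part:
  assumes "A \<in> \<A>"
  shows "A \<subseteq> part F q \<or> A \<inter> part F q = {}"
  using assms retract_family[OF assms] family_subset[OF assms] by (auto simp: part_def)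

text \<open>Otherwise all parts are dismantlable, and hanging them on a node with an empty bag
  dismantles \<open>V(G)\<close>: all bold cuts involved consist of crossing edges, of which there
  are at most \<open>card F\<close>.\<close>

lemma ex_big_part:
  assumes F: "F \<subseteq> edges G" "card F < k"
  shows "\<exists>q\<in>Q. part F q \<notin> L \<and> k \<le> card (part F q \<inter> Q)"
proof (rule ccontr)
  assume none: "\<not> ?thesis"
  let ?H = "del_edges G F"
  have H: "is_graph ?H" using G by (rule is_graph_del_edges)
  have le: "card S < k" if "S \<subseteq> crossing F" for S
  proof -
    have "crossing F \<subseteq> edges G" by (auto simp: crossing_def)
    then have "card S \<le> card (crossing F)" using that finite_edge_set[OF G] by (intro card_mono) auto
    then show ?thesis using card_crossing[OF F(1)] F(2) by linarith
  qed
  have bold_sub: "bold_cut G (part F q) \<subseteq> crossing F" for q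
    using bold_cut_subset_cut[of G "part F q"] cut_part_subset[of F q] by blast
  have dism: "dismantlable G k L (part F q)" if q: "q \<in> Q" for q
  proof (cases "part F q \<in> L")
    case True
    then show ?thesis using le[OF bold_sub] by (intro dismantlable.leaf) (auto simp: part_def)
  next
    case False
    then have small: "card (part F q \<inter> Q) < k" using none q by force
    \<comment> \<open>A part outside \<open>L\<close> becomes a node whose bag is its few vertices
      of \<open>Q\<close> and whose leaves are its thin members; these contribute nothing to the
      adhesion.\<close>
    define \<B> where "\<B> = {A \<in> \<A>. A \<subseteq> part F q}"
    have eq: "(part F q \<inter> Q) \<union> \<Union> \<B> = part F q"
    proof
      show "part F q \<subseteq> (part F q \<inter> Q) \<union> \<Union> \<B>"
      proof
        fix x assume x: "x \<in> part F q"
        then have "x \<in> verts G" by (simp add: part_def)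
        show "x \<in> (part F q \<inter> Q) \<union> \<Union> \<B>"
        proof (cases "x \<in> Q")
          case False
          then obtain A where A: "A \<in> \<A>" "x \<in> A" using \<open>x \<in> verts G\<close> by (auto simp: Q_def)
          then have "A \<subseteq> part F q" using family_part[OF A(1), of F q] x by blast
          then show ?thesis using A by (auto simp: \<B>_def)
        qed (use x in blast)
      qed
    qed (auto simp: \<B>_def)
    have bold: "bold_cut G A = {}" if "A \<in> \<B>" for A
      using that family_thin[of A] by (intro bold_cut_thin) (auto simp: \<B>_def thin_sets_def)
    have "dismantlable G k L ((part F q \<inter> Q) \<union> \<Union> \<B>)"
    proof (rule dismantlable.node)
      show "dismantlable G k L A" if "A \<in> \<B>" for A
        using that bold[OF that] family_thin[of A] k
        by (intro dismantlable.leaf) (auto simp: \<B>_def thin_sets_def)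
      show "disjoint \<B>" using family_disjoint by (auto simp: \<B>_def disjoint_def)
      show "part F q \<inter> Q \<inter> \<Union> \<B> = {}" using Q_disjoint by (auto simp: \<B>_def)
      show "part F q \<inter> Q \<subseteq> verts G" using Q_subset by blast
      have "bold_cut G (part F q) \<union> (\<Union>A\<in>\<B>. bold_cut G A) = bold_cut G (part F q)" using bold by simp
      then show "card (bold_cut G ((part F q \<inter> Q) \<union> \<Union> \<B>) \<union> (\<Union>A\<in>\<B>. bold_cut G A)) < k"
        using le[OF bold_sub] by (simp add: eq)
    qed (rule small)
    then show ?thesis by (simp only: eq)
  qed
  have eq: "{} \<union> \<Union> (part F ` Q) = verts G"
  proof
    show "verts G \<subseteq> {} \<union> \<Union> (part F ` Q)"
    proof
      fix x assume x: "x \<in> verts G"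
      then have r: "retract x \<in> Q" by (rule retract_in_Q)
      then have "retract x \<in> verts ?H" using Q_subset by auto
      then have "x \<in> part F (retract x)" using x by (simp add: part_def conn_refl)
      then show "x \<in> {} \<union> \<Union> (part F ` Q)" using r by blast
    qed
  qed (auto simp: part_def)
  have "dismantlable G k L ({} \<union> \<Union> (part F ` Q))"
  proof (rule dismantlable.node)
    show "dismantlable G k L Z" if "Z \<in> part F ` Q" for Z using that dism by blast
    show "disjoint (part F ` Q)"
    proof (rule disjointI)
      fix Z Z' assume "Z \<in> part F ` Q" "Z' \<in> part F ` Q" "Z \<noteq> Z'"
      then obtain q q' where q: "Z = part F q" "Z' = part F q'" by blast
      have "part F q = part F q'" if "x \<in> part F q" "x \<in> part F q'" for x
      proof -
        have "conn ?H q (retract x)" "conn ?H q' (retract x)" using that by (auto simp: part_def)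
        then have "conn ?H q q'" "conn ?H q' q" using conn_sym[OF H] conn_trans by metis+
        then show ?thesis unfolding part_def using conn_trans by metis
      qed
      then show "Z \<inter> Z' = {}" using q \<open>Z \<noteq> Z'\<close> by blast
    qed
    have "bold_cut G (verts G) \<union> (\<Union>Z\<in>part F ` Q. bold_cut G Z) \<subseteq> crossing F"
      using bold_sub by (auto simp: bold_cut_verts[OF G])
    then show "card (bold_cut G ({} \<union> \<Union> (part F ` Q)) \<union> (\<Union>Z\<in>part F ` Q. bold_cut G Z)) < k"
      unfolding eq by (rule le)
  qed (use k in auto)
  then show False using undismantlable by (simp only: eq)
qed

section \<open>The bramble of components\<close>

definition component :: "'e set \<Rightarrow> 'v \<Rightarrow> ('v, 'e) mgraph" where
  "component F q = (let C = {x. conn (del_edges G F) q x} in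
     \<lparr>verts = C, edges = {e \<in> edges G - F. ends G e \<subseteq> C}, ends = ends G\<rparr>)"

lemma component_simps:
  "verts (component F q) = {x. conn (del_edges G F) q x}"
  "edges (component F q) = {e \<in> edges G - F. ends G e \<subseteq> {x. conn (del_edges G F) q x}}"
  "ends (component F q) = ends G"
  by (simp_all add: component_def Let_def)

lemma component_verts_subset: "verts (component F q) \<subseteq> verts G"
  using conn_verts(2)[OF is_graph_del_edges[OF G]] by (auto simp: component_simps)

lemma subgraph_component: "subgraph (component F q) G"
proof -
  have "finite (verts (component F q))" using component_verts_subset finite_verts by (rule finite_subset)
  moreover have "finite (edges (component F q))"
    by (rule finite_edge_set[OF G]) (auto simp: component_simps)
  ultimately have "is_graph (component F q)"
    using G by (auto simp: is_graph_def component_simps)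
  then show ?thesis using component_verts_subset by (auto simp: subgraph_def component_simps)
qed

lemma component_conn:
  assumes "q \<in> verts G" "conn (del_edges G F) q x"
  shows "conn (component F q) q x"
  using assms(2)
proof (induction rule: conn_induct)
  case refl
  then show ?case using assms by (intro conn_refl) (simp add: component_simps conn_refl)
next
  case (step x y e)
  have "conn (del_edges G F) q y" using step by (intro conn_step[OF step(1)]) auto
  then have "e \<in> edges (component F q)" using step by (auto simp: component_simps)
  then show ?case using step by (intro conn_step[OF step.IH]) (auto simp: component_simps)
qed

lemma component_conn_all:
  assumes q: "q \<in> verts G" and "x \<in> verts (component F q)" "y \<in> verts (component F q)"
  shows "conn (component F q) x y"
proof -
  have g: "is_graph (component F q)" using subgraph_component by (auto simp: subgraph_def)
  have "conn (component F q) q x" "conn (component F q) q y"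
    using assms by (auto intro!: component_conn simp: component_simps)
  then show ?thesis using conn_sym[OF g] conn_trans by metis
qed

text \<open>A component leaves out the edges of \<open>F\<close> even between its own vertices, so
  \<open>F\<close> has no edge to delete from it.\<close>

lemma component_not_disconnected:
  assumes q: "q \<in> verts G" and "K \<subseteq> verts (component F q)"
  shows "\<not> disconnects F (component F q, K)"
proof -
  have g: "is_graph (component F q)" using subgraph_component by (auto simp: subgraph_def)
  have "F \<inter> edges (component F q) = {}" by (auto simp: component_simps)
  then have "del_edges (component F q) (F \<inter> edges (component F q)) = component F q"
    by (simp add: del_edges_def)
  then show ?thesis
    using assms component_conn_all[OF q] conn_comp_eq_iff[OF g] by (auto simp: subset_iff)
qed

lemma has_bramble: "has_bramble_of_order_ge G k"
proof -
  let ?core = "\<lambda>F q. part F q \<inter> Q"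
  have "\<forall>F\<in>{F. F \<subseteq> edges G \<and> card F < k}. \<exists>q. q \<in> Q \<and> part F q \<notin> L \<and> k \<le> card (?core F q)"
    using ex_big_part by blast
  then have "\<exists>c. \<forall>F\<in>{F. F \<subseteq> edges G \<and> card F < k}.
      c F \<in> Q \<and> part F (c F) \<notin> L \<and> k \<le> card (?core F (c F))"
    by (rule bchoice)
  then obtain c where c': "\<forall>F\<in>{F. F \<subseteq> edges G \<and> card F < k}.
      c F \<in> Q \<and> part F (c F) \<notin> L \<and> k \<le> card (?core F (c F))" ..
  have c: "c F \<in> Q" "part F (c F) \<notin> L" "k \<le> card (?core F (c F))"
    if "F \<subseteq> edges G" "card F < k" for F using c' that by auto
  define \<B> where "\<B> = {(component F (c F), ?core F (c F)) | F. F \<subseteq> edges G \<and> card F < k}"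
  have core_sub: "?core F q \<subseteq> verts (component F q)" for F q
    by (auto simp: component_simps part_def retract_Q)
  have slab: "is_slab G (component F (c F), ?core F (c F))" if F: "F \<subseteq> edges G" "card F < k" for F
  proof -
    have q: "c F \<in> verts G" using c(1)[OF F] Q_subset by blast
    have g: "is_graph (component F (c F))" using subgraph_component by (auto simp: subgraph_def)
    have ne: "?core F (c F) \<noteq> {}" using c(3)[OF F] k by auto
    then have "connected_graph (component F (c F))"
      using connected_graph_iff[OF g] component_conn_all[OF q] core_sub[of F "c F"] by auto
    moreover have "three_edge_connected_set G (?core F (c F))"
      using three_edge_connected_Q by (auto simp: three_edge_connected_set_def)
    ultimately show ?thesis using ne core_sub subgraph_component by simp
  qed
  have touching: "?core F (c F) \<inter> ?core F' (c F') \<noteq> {}"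
    if F: "F \<subseteq> edges G" "card F < k" and F': "F' \<subseteq> edges G" "card F' < k" for F F'
  proof -
    \<comment> \<open>Sets outside \<open>L\<close> intersect, though perhaps only in a thin member.
      A part contains \<open>x\<close> exactly if it contains \<open>retract x\<close>, so the
      intersection can be moved into \<open>Q\<close> and hence into both cores.\<close>
    have "part F (c F) \<inter> part F' (c F') \<noteq> {}"
      using touch[OF _ c(2)[OF F] _ c(2)[OF F']] by (auto simp: part_def)
    then obtain x where x: "x \<in> part F (c F)" "x \<in> part F' (c F')" by blast
    then have r: "retract x \<in> Q" using retract_in_Q by (auto simp: part_def)
    then have "retract x \<in> ?core F (c F)" "retract x \<in> ?core F' (c F')"
      using x Q_subset by (auto simp: part_def retract_Q)
    then show ?thesis by blast
  qed
  have "bramble G \<B>"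
    unfolding bramble_def
  proof (intro conjI ballI)
    show "is_slab G s" if "s \<in> \<B>" for s using that slab by (auto simp: \<B>_def simp del: is_slab.simps)
    show "Defs.touch s s'" if s: "s \<in> \<B>" "s' \<in> \<B>" for s s'
    proof -
      obtain F where F: "s = (component F (c F), ?core F (c F))" "F \<subseteq> edges G" "card F < k"
        using s(1) unfolding \<B>_def by blast
      obtain F' where F': "s' = (component F' (c F'), ?core F' (c F'))" "F' \<subseteq> edges G" "card F' < k"
        using s(2) unfolding \<B>_def by blast
      show ?thesis unfolding F(1) F'(1) using touching[OF F(2,3) F'(2,3)] by simp
    qed
  qed
  moreover have "enat k \<le> bramble_order G \<B>"
    unfolding enat_le_bramble_order_iff
  proof (intro conjI allI impI ballI)
    show "k \<le> card (snd s)" if "s \<in> \<B>" for s using that c(3) by (auto simp: \<B>_def)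
    fix F assume F: "disconnecting_set G \<B> F"
    show "k \<le> card F"
    proof (rule ccontr)
      assume "\<not> ?thesis"
      then have F': "F \<subseteq> edges G" "card F < k" using F by (auto simp: disconnecting_set_def)
      then have "disconnects F (component F (c F), ?core F (c F))"
        using F unfolding disconnecting_set_def \<B>_def by blast
      moreover have "c F \<in> verts G" using c(1)[OF F'] Q_subset by blast
      ultimately show False using component_not_disconnected[OF _ core_sub] by blast
    qed
  qed
  ultimately show ?thesis unfolding has_bramble_of_order_ge_def by blast
qed

end

lemma undismantlable_imp_bramble:
  assumes G: "is_graph G" and k: "0 < k" and not: "\<not> dismantlable G k (small_sets G k) (verts G)"
  shows "has_bramble_of_order_ge G k"
proof -
  obtain L where L: "small_sets G k \<subseteq> L" "\<And>Y Y'. Y \<in> L \<Longrightarrow> Y' \<subseteq> Y \<Longrightarrow> Y' \<in> L"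
    "\<not> dismantlable G k L (verts G)"
    "\<And>A B. A \<subseteq> verts G \<Longrightarrow> A \<notin> L \<Longrightarrow> B \<subseteq> verts G \<Longrightarrow> B \<notin> L \<Longrightarrow> A \<inter> B \<noteq> {}"
    using ex_maximal_undismantlable[OF assms] by blast
  interpret big_sets G k L
    by unfold_locales (fact G k L)+
  obtain \<A> where A: "\<A> \<in> families" "\<And>\<A>'. \<A>' \<in> families \<Longrightarrow> (\<A>', \<A>) \<notin> family_measure"
    using ex_optimal_family by blast
  interpret optimal_family G k L \<A>
    by unfold_locales (fact A)+
  show ?thesis by (rule has_bramble)
qed

section \<open>Brambles and tangles obstruct dismantling\<close>

declare disconnects.simps [simp del]

lemma slab_subset: "is_slab G (H, K) \<Longrightarrow> K \<subseteq> verts G"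
  by (auto simp: three_edge_connected_set_def)

text \<open>Splitting \<open>K\<close> takes a cut with at least three edges, since \<open>K\<close>
  is 3-edge-connected in \<open>G\<close>. Such a cut is bold and hence contained in
  \<open>F\<close>, but \<open>K\<close> stays connected in \<open>H - F\<close>.\<close>

lemma slab_on_one_side:
  assumes G: "is_graph G" and slab: "is_slab G (H, K)" and nd: "\<not> disconnects F (H, K)"
    and sub: "bold_cut G X \<subseteq> F"
  shows "K \<subseteq> X \<or> K \<inter> X = {}"
proof (rule ccontr)
  assume "\<not> ?thesis"
  then obtain u v where uv: "u \<in> K" "u \<in> X" "v \<in> K" "v \<notin> X" by blast
  have "three_edge_connected G u v"
    using slab uv by (simp add: three_edge_connected_set_def)
  then have "3 \<le> card (cut G X)" using three_edge_connected_cut[OF G] uv by blast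
  then have cutF: "cut G X \<subseteq> F" using sub by (simp add: bold_cut_def)
  let ?H = "del_edges H (F \<inter> edges H)"
  have H: "is_graph H" "edges H \<subseteq> edges G" "ends H = ends G" "K \<subseteq> verts H"
    using slab by (auto simp: subgraph_def)
  have g: "is_graph ?H" using H(1) by (rule is_graph_del_edges)
  have "conn_comp ?H u = conn_comp ?H v"
    using nd uv(1,3) unfolding disconnects.simps by blast
  moreover have "u \<in> verts ?H" "v \<in> verts ?H" using uv(1,3) H(4) by auto
  ultimately have "conn ?H u v" using conn_comp_eq_iff[OF g] by blast
  moreover have "edges ?H \<subseteq> edges G" "ends ?H = ends G" using H(2,3) by auto
  ultimately have "\<exists>e\<in>edges ?H. e \<in> cut G X" using uv(2,4) by (rule conn_crosses_cut[OF G])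
  then obtain e where "e \<in> edges ?H" "e \<in> cut G X" ..
  then show False using cutF by auto
qed

lemma bramble_avoids:
  assumes B: "bramble G \<B>" "enat k \<le> bramble_order G \<B>" and F: "F \<subseteq> edges G" "card F < k"
  obtains H K where "(H, K) \<in> \<B>" "\<not> disconnects F (H, K)" "k \<le> card K"
proof -
  have "\<not> disconnecting_set G \<B> F"
  proof
    assume "disconnecting_set G \<B> F"
    then have "k \<le> card F" using B(2) unfolding enat_le_bramble_order_iff by blast
    then show False using F(2) by simp
  qed
  then obtain s where s: "s \<in> \<B>" "\<not> disconnects F s"
    using F(1) unfolding disconnecting_set_def by blast
  obtain H K where "s = (H, K)" by (cases s)
  then have HK: "(H, K) \<in> \<B>" "\<not> disconnects F (H, K)" using s by simp_all
  have "\<forall>s\<in>\<B>. k \<le> card (snd s)" using B(2) unfolding enat_le_bramble_order_iff by blast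
  from bspec[OF this HK(1)] have "k \<le> card K" by simp
  with HK show ?thesis by (rule that)
qed

lemma bramble_slab: "bramble G \<B> \<Longrightarrow> (H, K) \<in> \<B> \<Longrightarrow> is_slab G (H, K)"
  unfolding bramble_def by blast

lemma bramble_touch: "bramble G \<B> \<Longrightarrow> (H, K) \<in> \<B> \<Longrightarrow> (H', K') \<in> \<B> \<Longrightarrow> K \<inter> K' \<noteq> {}"
  unfolding bramble_def by (metis touch.simps)

text \<open>Take a slab that the adhesion set of the node does not disconnect. Its core is on one
  side of each child \<open>Z\<close>, and it is not inside \<open>Z\<close> because it meets a core
  that misses \<open>Z\<close>. Being too large for the bag, it is not inside the node's set either,
  so it misses that set.\<close>

lemma dismantlable_misses_core:
  assumes G: "is_graph G" and B: "bramble G \<B>" "enat k \<le> bramble_order G \<B>"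
    and "dismantlable G k (small_sets G k) Y"
  shows "\<exists>H K. (H, K) \<in> \<B> \<and> K \<inter> Y = {}"
  using assms(4)
proof (induction rule: dismantlable.induct)
  case (leaf Y)
  obtain H K where HK: "(H, K) \<in> \<B>" "\<not> disconnects (bold_cut G Y) (H, K)" "k \<le> card K"
    using bramble_avoids[OF B bold_cut_subset leaf(3)] by blast
  have "\<not> K \<subseteq> Y"
  proof
    assume "K \<subseteq> Y"
    moreover have "finite Y" using leaf(2) is_graph_finite(1)[OF G] by (rule finite_subset)
    ultimately have "card K \<le> card Y" by (intro card_mono)
    then show False using HK(3) leaf(1) by (simp add: small_sets_def)
  qed
  then have "K \<inter> Y = {}"
    using slab_on_one_side[OF G bramble_slab[OF B(1) HK(1)] HK(2), of Y] by blast
  then show ?case using HK(1) by blast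
next
  case (node \<Y> B')
  let ?Y = "B' \<union> \<Union> \<Y>" and ?F = "bold_cut G (B' \<union> \<Union> \<Y>) \<union> (\<Union>Z\<in>\<Y>. bold_cut G Z)"
  obtain H K where HK: "(H, K) \<in> \<B>" "\<not> disconnects ?F (H, K)" "k \<le> card K"
    using bramble_avoids[OF B bold_cuts_subset node.hyps(6)] by blast
  note side = slab_on_one_side[OF G bramble_slab[OF B(1) HK(1)] HK(2)]
  have "K \<inter> Z = {}" if Z: "Z \<in> \<Y>" for Z
  proof -
    obtain H' K' where HK': "(H', K') \<in> \<B>" "K' \<inter> Z = {}" using node.IH[OF Z] by blast
    have "K \<inter> K' \<noteq> {}" using bramble_touch[OF B(1) HK(1) HK'(1)] .
    then have "\<not> K \<subseteq> Z" using HK'(2) by blast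
    moreover have "bold_cut G Z \<subseteq> ?F" using Z by blast
    ultimately show ?thesis using side[of Z] by blast
  qed
  then have outside: "K \<inter> \<Union> \<Y> = {}" by blast
  have "\<not> K \<subseteq> ?Y"
  proof
    assume "K \<subseteq> ?Y"
    then have "K \<subseteq> B'" using outside by blast
    moreover have "finite B'" using node.hyps(4) is_graph_finite(1)[OF G] by (rule finite_subset)
    ultimately have "card K \<le> card B'" by (intro card_mono)
    then show False using HK(3) node.hyps(5) by simp
  qed
  then have "K \<inter> ?Y = {}" using side[of ?Y] by blast
  then show ?case using HK(1) by blast
qed

lemma bramble_imp_undismantlable:
  assumes G: "is_graph G" and "has_bramble_of_order_ge G k"
  shows "\<not> dismantlable G k (small_sets G k) (verts G)"
proof
  obtain \<B> where B: "bramble G \<B>" "enat k \<le> bramble_order G \<B>"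
    using assms(2) unfolding has_bramble_of_order_ge_def by blast
  assume "dismantlable G k (small_sets G k) (verts G)"
  then obtain H K where HK: "(H, K) \<in> \<B>" "K \<inter> verts G = {}"
    using dismantlable_misses_core[OF G B] by blast
  have slab: "is_slab G (H, K)" using bramble_slab[OF B(1) HK(1)] .
  then have "K \<noteq> {}" by simp
  then show False using slab_subset[OF slab] HK(2) by blast
qed

section \<open>Tangles\<close>

lemma separations_belowD:
  assumes "{A, B} \<in> separations_below G a"
  shows "A \<inter> B = {}" "A \<union> B = verts G" "card (cut G A) < a"
proof -
  obtain A' B' where AB: "{A, B} = {A', B'}" "A' \<inter> B' = {}" "A' \<union> B' = verts G"
    using assms by (auto simp: separations_below_def separations_def)
  then show "A \<inter> B = {}" "A \<union> B = verts G" by (auto simp: doubleton_eq_iff)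
  show "card (cut G A) < a" using assms by (simp add: separations_below_def)
qed

lemma separations_belowI:
  assumes "is_graph G" "Y \<subseteq> verts G" "card (cut G Y) < a"
  shows "{Y, verts G - Y} \<in> separations_below G a"
proof -
  have "{Y, verts G - Y} \<in> separations G"
    unfolding separations_def using assms(2) by blast
  then show ?thesis using assms by (simp add: separations_below_def cut_compl)
qed

text \<open>Every separation is oriented towards the side that contains a core; as cores pairwise
  intersect, this is unambiguous and consistent. For a forbidden star, a slab not disconnected by
  its bold cuts would have its core in every large side, hence in their intersection, which has
  fewer than \<open>k\<close> vertices.\<close>

lemma bramble_imp_tangle:
  assumes G: "is_graph G" and k: "0 < k" and "has_bramble_of_order_ge G k"
  shows "has_tangle_of_order_ge G k"
proof -
  obtain \<B> where B: "bramble G \<B>" "enat k \<le> bramble_order G \<B>"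
    using assms(3) unfolding has_bramble_of_order_ge_def by blast
  define L where "L = {(A, B). {A, B} \<in> separations_below G k \<and> (\<exists>H K. (H, K) \<in> \<B> \<and> K \<subseteq> B)}"
  have not_both: False if "(H, K) \<in> \<B>" "(H', K') \<in> \<B>" "K \<subseteq> A" "K' \<subseteq> B" "A \<inter> B = {}" for H K H' K' A B
    using bramble_touch[OF B(1) that(1,2)] that(3-5) by blast
  have "orientation (separations_below G k) L"
    unfolding orientation_def
  proof (intro conjI ballI)
    show "L \<subseteq> oriented (separations_below G k)" by (auto simp: L_def oriented_def)
    fix S assume S: "S \<in> separations_below G k"
    then obtain A B where AB: "S = {A, B}" by (auto simp: separations_below_def separations_def)
    note sep = separations_belowD[OF S[unfolded AB]]
    obtain H K where HK: "(H, K) \<in> \<B>" "\<not> disconnects (cut G A) (H, K)"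
      using bramble_avoids[OF B cut_subset sep(3)] by blast
    have KV: "K \<subseteq> verts G" using slab_subset[OF bramble_slab[OF B(1) HK(1)]] .
    have "K \<subseteq> A \<or> K \<subseteq> B"
      using slab_on_one_side[OF G bramble_slab[OF B(1) HK(1)] HK(2) bold_cut_subset_cut] KV sep(2) by blast
    then obtain X Y where XY: "S = {X, Y}" "X \<inter> Y = {}" "K \<subseteq> Y"
    proof
      assume "K \<subseteq> A"
      then show ?thesis using that[of B A] AB sep(1) by (auto simp: insert_commute)
    next
      assume "K \<subseteq> B"
      then show ?thesis using that[of A B] AB sep(1) by auto
    qed
    show "\<exists>!p. p \<in> L \<and> p \<in> oriented {S}"
    proof (intro ex1I conjI)
      show "(X, Y) \<in> L" using S XY HK(1) by (auto simp: L_def)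
      show "(X, Y) \<in> oriented {S}" using XY by (simp add: oriented_def)
      fix p assume p: "p \<in> L \<and> p \<in> oriented {S}"
      then obtain C D where CD: "p = (C, D)" "{C, D} = {X, Y}" using XY by (auto simp: oriented_def)
      then obtain H' K' where HK': "(H', K') \<in> \<B>" "K' \<subseteq> D" using p by (auto simp: L_def)
      have "D \<noteq> X" using not_both[OF HK(1) HK'(1) XY(3), of X] HK'(2) XY(2) by blast
      then show "p = (X, Y)" using CD by (auto simp: doubleton_eq_iff)
    qed
  qed
  moreover have "consistent L"
    unfolding consistent_def
  proof
    assume "\<exists>A B C D. (A, B) \<in> L \<and> (C, D) \<in> L \<and> B \<inter> D = {}"
    then obtain B D H K H' K' where "(H, K) \<in> \<B>" "K \<subseteq> B" "(H', K') \<in> \<B>" "K' \<subseteq> D" "B \<inter> D = {}"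
      unfolding L_def by blast
    then show False using not_both by blast
  qed
  moreover have "avoids L (forbidden_stars G k k)"
    unfolding avoids_def
  proof (intro allI impI notI)
    fix \<sigma> assume \<sigma>: "\<sigma> \<subseteq> L" "\<sigma> \<in> forbidden_stars G k k"
    let ?F = "\<Union> {cut G A | A B. (A, B) \<in> \<sigma> \<and> card (cut G A) \<ge> 3}"
    let ?I = "\<Inter> {B | A B. (A, B) \<in> \<sigma>}"
    have F: "card ?F < k" and I: "card ?I < k" and ne: "\<sigma> \<noteq> {}"
      using \<sigma>(2) by (simp_all add: forbidden_stars_def is_star_def)
    have "?F \<subseteq> edges G" using cut_subset[of G] by blast
    then obtain H K where HK: "(H, K) \<in> \<B>" "\<not> disconnects ?F (H, K)" "k \<le> card K"
      using bramble_avoids[OF B _ F] by blast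
    note slab = bramble_slab[OF B(1) HK(1)]
    have "K \<subseteq> D" if CD: "(C, D) \<in> \<sigma>" for C D
    proof -
      have L: "(C, D) \<in> L" using CD \<sigma>(1) by blast
      then have "{C, D} \<in> separations_below G k" by (simp add: L_def)
      note sep = separations_belowD[OF this]
      obtain H' K' where HK': "(H', K') \<in> \<B>" "K' \<subseteq> D" using L by (auto simp: L_def)
      have "bold_cut G C \<subseteq> ?F" using CD by (auto simp: bold_cut_def)
      from slab_on_one_side[OF G slab HK(2) this]
      have "K \<subseteq> C \<or> K \<inter> C = {}" .
      moreover have "\<not> K \<subseteq> C" using not_both[OF HK(1) HK'(1) _ HK'(2) sep(1)] by blast
      ultimately show ?thesis using slab_subset[OF slab] sep(2) by blast
    qed
    then have "K \<subseteq> ?I" by blast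
    moreover have "finite ?I"
    proof -
      obtain C D where CD: "(C, D) \<in> \<sigma>" using ne by (metis equals0I surj_pair)
      then have "{C, D} \<in> separations_below G k" using \<sigma>(1) by (auto simp: L_def)
      then have "D \<subseteq> verts G" using separations_belowD(2) by blast
      then have "?I \<subseteq> verts G" using CD by blast
      then show ?thesis using is_graph_finite(1)[OF G] by (rule finite_subset)
    qed
    ultimately have "card K \<le> card ?I" by (intro card_mono)
    then show False using HK(3) I by simp
  qed
  ultimately have "tangle G k k L" by (simp add: tangle_def)
  then show ?thesis unfolding has_tangle_of_order_ge_def using k by (metis min.idem order_refl)
qed

lemma tangle_orients:
  assumes G: "is_graph G" and t: "tangle G a b L" and Y: "Y \<subseteq> verts G" "card (cut G Y) < a"
  shows "(Y, verts G - Y) \<in> L \<or> (verts G - Y, Y) \<in> L"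
proof -
  have "{Y, verts G - Y} \<in> separations_below G a" using G Y by (rule separations_belowI)
  then obtain p where p: "p \<in> L" "p \<in> oriented {{Y, verts G - Y}}"
    using t unfolding tangle_def orientation_def by (metis (no_types, lifting))
  then obtain C D where "p = (C, D)" "{C, D} = {Y, verts G - Y}" by (auto simp: oriented_def)
  then show ?thesis using p(1) by (auto simp: doubleton_eq_iff)
qed

text \<open>Translates a node into a star: one separation for each child and one for everything
  above the node. Their large sides have only vertices of the bag \<open>B\<close> in common, and
  their bold cuts form the adhesion set.\<close>

lemma tangle_star:
  assumes G: "is_graph G" and t: "tangle G a b L"
    and Y: "(verts G - (B \<union> \<Union> \<Y>), B \<union> \<Union> \<Y>) \<in> L"
    and \<Y>: "\<And>Z. Z \<in> \<Y> \<Longrightarrow> (Z, verts G - Z) \<in> L" "disjoint \<Y>"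
    and B: "finite B" "card B < b"
    and bold: "card (bold_cut G (B \<union> \<Union> \<Y>) \<union> (\<Union>Z\<in>\<Y>. bold_cut G Z)) < a"
  shows False
proof -
  let ?Y = "B \<union> \<Union> \<Y>"
  define \<sigma> where "\<sigma> = insert (verts G - ?Y, ?Y) ((\<lambda>Z. (Z, verts G - Z)) ` \<Y>)"
  have \<sigma>L: "\<sigma> \<subseteq> L" using Y \<Y>(1) by (auto simp: \<sigma>_def)
  have "L \<subseteq> oriented (separations_below G a)" "consistent L"
    using t by (auto simp: tangle_def orientation_def)
  then have or: "\<sigma> \<subseteq> oriented (separations_below G a)" and cons: "consistent \<sigma>"
    using \<sigma>L unfolding consistent_def by blast+
  have "is_star \<sigma>"
    unfolding is_star_def
  proof (intro conjI allI impI)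
    show "\<sigma> \<noteq> {}" by (simp add: \<sigma>_def)
    show "consistent \<sigma>" by (rule cons)
    fix A A' C C' assume AC: "(A, A') \<in> \<sigma>" "(C, C') \<in> \<sigma>" "(A, A') \<noteq> (C, C')"
    have *: "A = verts G - ?Y \<and> A' = ?Y \<or> A \<in> \<Y> \<and> A' = verts G - A" using AC(1) by (auto simp: \<sigma>_def)
    have **: "C = verts G - ?Y \<and> C' = ?Y \<or> C \<in> \<Y> \<and> C' = verts G - C" using AC(2) by (auto simp: \<sigma>_def)
    have d: "Z \<inter> Z' = {}" if "Z \<in> \<Y>" "Z' \<in> \<Y>" "Z \<noteq> Z'" for Z Z'
      using \<Y>(2) that by (auto dest: disjointD)
    show "A \<inter> C = {}" using * ** AC(3) d[of A C] by blast
  qed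
  moreover have "card (\<Union> {cut G A | A B. (A, B) \<in> \<sigma> \<and> card (cut G A) \<ge> 3}) < a"
  proof -
    have "\<Union> {cut G A | A B. (A, B) \<in> \<sigma> \<and> card (cut G A) \<ge> 3}
        \<subseteq> bold_cut G ?Y \<union> (\<Union>Z\<in>\<Y>. bold_cut G Z)"
    proof (rule Union_least, clarify)
      fix e A A' assume A: "(A, A') \<in> \<sigma>" "3 \<le> card (cut G A)" "e \<in> cut G A"
        "e \<notin> (\<Union>Z\<in>\<Y>. bold_cut G Z)"
      then have e: "e \<in> bold_cut G A" by (simp add: bold_cut_def)
      then have "A \<notin> \<Y>" using A(4) by blast
      then have "A = verts G - ?Y" using A(1) by (auto simp: \<sigma>_def)
      then show "e \<in> bold_cut G ?Y" using e by (simp only: bold_cut_compl[OF G])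
    qed
    then have "card (\<Union> {cut G A | A B. (A, B) \<in> \<sigma> \<and> card (cut G A) \<ge> 3})
        \<le> card (bold_cut G ?Y \<union> (\<Union>Z\<in>\<Y>. bold_cut G Z))"
      by (rule card_mono[OF finite_edge_set[OF G bold_cuts_subset]])
    then show ?thesis using bold by linarith
  qed
  moreover have "card (\<Inter> {D | C D. (C, D) \<in> \<sigma>}) < b"
  proof -
    have "\<Inter> {D | C D. (C, D) \<in> \<sigma>} \<subseteq> B"
    proof
      fix x assume x: "x \<in> \<Inter> {D | C D. (C, D) \<in> \<sigma>}"
      have "(verts G - ?Y, ?Y) \<in> \<sigma>" by (simp add: \<sigma>_def)
      then have "x \<in> ?Y" using x by blast
      moreover have "x \<notin> Z" if "Z \<in> \<Y>" for Z
      proof -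
        have "(Z, verts G - Z) \<in> \<sigma>" using that by (simp add: \<sigma>_def)
        then have "x \<in> verts G - Z" using x by blast
        then show ?thesis by blast
      qed
      ultimately show "x \<in> B" by blast
    qed
    then have "card (\<Inter> {D | C D. (C, D) \<in> \<sigma>}) \<le> card B" by (rule card_mono[OF B(1)])
    then show ?thesis using B(2) by linarith
  qed
  ultimately have "\<sigma> \<in> forbidden_stars G a b" using or by (simp add: forbidden_stars_def)
  then show False using t \<sigma>L unfolding tangle_def avoids_def by blast
qed

text \<open>If the tangle regards all children of a node as small, it cannot regard the node's set
  as large without containing the star of that node. At the root this gives
  \<open>(verts G, {})\<close>, which is inconsistent with itself.\<close>

lemma tangle_imp_undismantlable:
  assumes G: "is_graph G" and t: "tangle G a b L" and k: "3 \<le> k" "k \<le> a" "k \<le> b"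
  shows "\<not> dismantlable G k (small_sets G k) (verts G)"
proof
  have "(Y, verts G - Y) \<in> L" if "dismantlable G k (small_sets G k) Y" for Y
    using that
  proof (induction rule: dismantlable.induct)
    case (leaf Y)
    \<comment> \<open>A bold cut has fewer than \<open>k\<close> edges, a thin one at most 2;
      because of \<open>3 \<le> k\<close> either is below \<open>a\<close>, so the tangle orients
      the separation.\<close>
    have "card (cut G Y) < a" using leaf(3) k by (cases "3 \<le> card (cut G Y)") (auto simp: bold_cut_def)
    moreover have "(verts G - Y, Y) \<notin> L"
    proof
      assume "(verts G - Y, Y) \<in> L"
      moreover have "finite Y" using leaf(2) is_graph_finite(1)[OF G] by (rule finite_subset)
      moreover have "card Y < b" "card (bold_cut G Y) < a" using leaf(1,3) k by (auto simp: small_sets_def)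
      ultimately show False using tangle_star[OF G t, of Y "{}"] by (simp add: disjoint_def)
    qed
    ultimately show ?case using tangle_orients[OF G t leaf(2)] by blast
  next
    case (node \<Y> B)
    let ?Y = "B \<union> \<Union> \<Y>"
    have d: "dismantlable G k (small_sets G k) ?Y"
      using node.hyps by (intro dismantlable.node) auto
    have "card (bold_cut G ?Y) < k" using dismantlable_bold_cut[OF G d] .
    then have "card (cut G ?Y) < a" using k by (cases "3 \<le> card (cut G ?Y)") (auto simp: bold_cut_def)
    moreover have "(verts G - ?Y, ?Y) \<notin> L"
    proof
      assume Y: "(verts G - ?Y, ?Y) \<in> L"
      have "finite B" using node.hyps(4) is_graph_finite(1)[OF G] by (rule finite_subset)
      then show False
        using tangle_star[OF G t Y node.IH node.hyps(2)] node.hyps(5,6) k by linarith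
    qed
    ultimately show ?case using tangle_orients[OF G t dismantlable_subset[OF d]] by blast
  qed
  moreover assume "dismantlable G k (small_sets G k) (verts G)"
  ultimately have "(verts G, {}) \<in> L" by force
  then show False using t unfolding tangle_def consistent_def by blast
qed

section \<open>Tree-cut decompositions and dismantling\<close>

definition side :: "('t, 'f) mgraph \<Rightarrow> 'f \<Rightarrow> 't \<Rightarrow> 't set" where
  "side T f s = {x. conn (del_edges T {f}) s x}"

definition bags :: "('t \<Rightarrow> 'v set) \<Rightarrow> 't set \<Rightarrow> 'v set" where
  "bags X S = (\<Union>t\<in>S. X t)"

lemma walk_imp_conn:
  assumes "\<And>i. i < length es \<Longrightarrow> es ! i \<in> edges H \<and> ends H (es ! i) = {vs ! i, vs ! Suc i}"
    and "vs ! 0 \<in> verts H"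
  shows "i \<le> length es \<Longrightarrow> conn H (vs ! 0) (vs ! i)"
proof (induction i)
  case 0
  then show ?case using assms(2) by (simp add: conn_refl)
next
  case (Suc i)
  then have "i < length es" by simp
  note e = assms(1)[OF this]
  have "conn H (vs ! 0) (vs ! i)" using Suc by simp
  then show ?case using e[THEN conjunct1] e[THEN conjunct2] by (rule conn_step)
qed

text \<open>A path between the ends that avoids \<open>f\<close> closes up with \<open>f\<close> to
  a cycle. Its edges are distinct because its vertices are.\<close>

lemma tree_edge_is_bridge:
  assumes T: "is_tree T" and f: "f \<in> edges T" "ends T f = {s, t}"
  shows "\<not> conn (del_edges T {f}) s t"
proof
  let ?H = "del_edges T {f}"
  have g: "is_graph T" using T by (simp add: is_tree_def)
  have H: "is_graph ?H" using g by (rule is_graph_del_edges)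
  assume "conn ?H s t"
  then obtain vs es where p: "path_between ?H s t vs es" using ex_path_iff_conn[OF H] by metis
  have st: "s \<noteq> t" using is_graph_arc(3)[OF g f] .
  have w: "length vs = Suc (length es)" "set vs \<subseteq> verts T" "set es \<subseteq> edges T - {f}"
      "\<forall>i<length es. ends T (es ! i) = {vs ! i, vs ! Suc i}" "distinct vs" "hd vs = s" "last vs = t"
    using p by (auto simp: path_between_def walk_def)
  have ne: "vs \<noteq> []" using w(1) by auto
  have "es \<noteq> []" using w(1,6,7) st by (cases vs) auto
  have "distinct es"
    unfolding distinct_conv_nth
  proof (intro allI impI notI)
    fix i j assume ij: "i < length es" "j < length es" "i \<noteq> j" "es ! i = es ! j"
    then have "{vs ! i, vs ! Suc i} = {vs ! j, vs ! Suc j}" using w(4) by metis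
    then have "vs ! i = vs ! j \<or> vs ! i = vs ! Suc j \<and> vs ! Suc i = vs ! j"
      by (auto simp: doubleton_eq_iff)
    then show False using ij w(1,5) by (auto simp: nth_eq_iff_index_eq)
  qed
  have "is_cycle T (t # vs) (f # es)"
    unfolding is_cycle_def walk_def
  proof (intro conjI allI impI)
    show "length (t # vs) = Suc (length (f # es))" using w(1) by simp
    show "set (t # vs) \<subseteq> verts T" using w(2,7) ne by auto
    show "set (f # es) \<subseteq> edges T" using w(3) f(1) by auto
    show "2 \<le> length (f # es)" using \<open>es \<noteq> []\<close> by (cases es) simp_all
    show "hd (t # vs) = last (t # vs)" using w(7) ne by simp
    show "distinct (tl (t # vs))" using w(5) by simp
    show "distinct (f # es)" using w(3) \<open>distinct es\<close> by auto
    fix i assume "i < length (f # es)"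
    then show "ends T ((f # es) ! i) = {(t # vs) ! i, (t # vs) ! Suc i}"
      using w(4,6) f(2) ne by (cases i) (auto simp: hd_conv_nth insert_commute)
  qed
  then show False using T by (auto simp: is_tree_def)
qed

text \<open>The rest of a cycle connects the ends of its first edge. The criterion spares the tree
  built from positions any direct analysis of cycles.\<close>

lemma bridges_imp_no_cycle:
  assumes "is_graph T"
    and bridge: "\<And>f s t. f \<in> edges T \<Longrightarrow> ends T f = {s, t} \<Longrightarrow> \<not> conn (del_edges T {f}) s t"
  shows "\<not> is_cycle T vs es"
proof
  assume c: "is_cycle T vs es"
  then have w: "length vs = Suc (length es)" "set vs \<subseteq> verts T" "set es \<subseteq> edges T"
      "\<forall>i<length es. ends T (es ! i) = {vs ! i, vs ! Suc i}" "2 \<le> length es" "hd vs = last vs" "distinct es"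
    by (auto simp: is_cycle_def walk_def)
  let ?f = "es ! 0"
  have ne: "es \<noteq> []" "vs \<noteq> []" using w(1,5) by auto
  let ?H = "del_edges T {?f}"
  have "conn ?H (tl vs ! 0) (tl vs ! (length (tl es)))"
  proof (rule walk_imp_conn[of "tl es"])
    fix i assume i: "i < length (tl es)"
    then have "es ! Suc i \<noteq> ?f" using w(7) ne by (simp add: nth_eq_iff_index_eq)
    moreover have "es ! Suc i \<in> edges T" using w(3) i by (auto simp: subset_iff)
    ultimately show "tl es ! i \<in> edges ?H \<and> ends ?H (tl es ! i) = {tl vs ! i, tl vs ! Suc i}"
      using i w(1,4) ne by (auto simp: nth_tl)
  next
    show "tl vs ! 0 \<in> verts ?H" using w(1,2,5) ne by (auto simp: nth_tl subset_iff)
  qed simp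
  moreover have "tl vs ! length (tl es) = vs ! 0"
    using w(1,5,6) ne by (auto simp: nth_tl last_conv_nth hd_conv_nth)
  moreover have "tl vs ! 0 = vs ! 1" using w(1,5) by (cases vs) auto
  ultimately have "conn ?H (vs ! 1) (vs ! 0)" by simp
  moreover have "?f \<in> edges T" "ends T ?f = {vs ! 1, vs ! 0}"
    using w(3,4) ne by (auto simp: insert_commute)
  ultimately show False using bridge by blast
qed

section \<open>Branches of a tree\<close>

locale tree =
  fixes T :: "('t, 'f) mgraph"
  assumes T: "is_tree T"
begin

lemma is_graph_tree: "is_graph T" and conn_all: "s \<in> verts T \<Longrightarrow> t \<in> verts T \<Longrightarrow> conn T s t"
  using T connected_graph_iff[of T] by (simp_all add: is_tree_def)

lemma is_graph_del: "is_graph (del_edges T F)"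
  using is_graph_tree by (rule is_graph_del_edges)

lemma edge_verts: "f \<in> edges T \<Longrightarrow> ends T f = {s, t} \<Longrightarrow> s \<in> verts T \<and> t \<in> verts T \<and> s \<noteq> t"
  using is_graph_arc[OF is_graph_tree] by blast

lemma side_self: "s \<in> verts T \<Longrightarrow> s \<in> side T f s"
  by (simp add: side_def conn_refl)

lemma side_step:
  "x \<in> side T f s \<Longrightarrow> e \<in> edges T \<Longrightarrow> e \<noteq> f \<Longrightarrow> ends T e = {x, y} \<Longrightarrow> y \<in> side T f s"
  unfolding side_def by (auto intro: conn_step)

lemma side_verts: "side T f s \<subseteq> verts T"
  using conn_verts(2)[OF is_graph_del] by (auto simp: side_def)

lemma side_disjoint:
  assumes "f \<in> edges T" "ends T f = {s, p}"
  shows "side T f s \<inter> side T f p = {}"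
proof (rule ccontr)
  assume "\<not> ?thesis"
  then obtain x where "conn (del_edges T {f}) s x" "conn (del_edges T {f}) p x"
    by (auto simp: side_def)
  then have "conn (del_edges T {f}) s p" using conn_sym[OF is_graph_del] conn_trans by metis
  then show False using tree_edge_is_bridge[OF T assms] by blast
qed

lemma side_cover:
  assumes f: "f \<in> edges T" "ends T f = {s, p}"
  shows "side T f s \<union> side T f p = verts T"
proof
  show "verts T \<subseteq> side T f s \<union> side T f p"
  proof
    fix x assume "x \<in> verts T"
    then have "conn T s x" using conn_all edge_verts[OF f] by blast
    then show "x \<in> side T f s \<union> side T f p"
    proof (induction rule: conn_induct)
      case refl
      then show ?case using side_self edge_verts[OF f] by blast
    next
      case (step x y e)
      show ?case
      proof (cases "e = f")
        case True
        then have "y = s \<or> y = p" using step(3) f(2) by (auto simp: doubleton_eq_iff)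
        then show ?thesis using side_self edge_verts[OF f] by blast
      next
        case False
        then show ?thesis using step side_step by blast
      qed
    qed
  qed
qed (use side_verts in blast)

lemma branch_cover:
  assumes s: "s \<in> verts T" and x: "x \<in> verts T"
  shows "x = s \<or> (\<exists>f p. f \<in> edges T \<and> ends T f = {s, p} \<and> x \<in> side T f p)"
  using conn_all[OF s x]
proof (induction rule: conn_induct)
  case (step x y e)
  note e = step(2,3)
  show ?case
  proof (cases "x = s")
    case True
    then have "y \<in> side T e y" using side_self edge_verts[OF e] by blast
    then show ?thesis using e True by blast
  next
    case False
    then obtain f p where f: "f \<in> edges T" "ends T f = {s, p}" "x \<in> side T f p" using step.IH by blast
    show ?thesis
    proof (cases "e = f")
      case True
      then have "y = s \<or> y = p" using e(2) f(2) by (auto simp: doubleton_eq_iff)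
      moreover have "p \<in> side T f p" using side_self edge_verts[OF f(1,2)] by blast
      ultimately show ?thesis using f by blast
    next
      case False
      then show ?thesis using side_step[OF f(3) e(1) _ e(2)] f(1,2) by blast
    qed
  qed
qed simp

text \<open>From a common node, walk to \<open>q\<close> inside the second branch. The walk does not
  use \<open>f\<close>, whose end \<open>s\<close> is outside that branch, so it stays in the first
  branch. Then \<open>g\<close> leads from \<open>q\<close> to \<open>s\<close> within the first
  branch, which does not contain \<open>s\<close>.\<close>

lemma branch_disjoint:
  assumes f: "f \<in> edges T" "ends T f = {s, p}" and g: "g \<in> edges T" "ends T g = {s, q}" and fg: "f \<noteq> g"
  shows "side T f p \<inter> side T g q = {}"
proof (rule ccontr)
  assume "\<not> ?thesis"
  then obtain x where x: "x \<in> side T f p" "x \<in> side T g q" by blast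
  have sp: "s \<notin> side T f p" and sq: "s \<notin> side T g q"
    using side_disjoint[OF f] side_disjoint[OF g] side_self edge_verts[OF f] by blast+
  define S where "S = side T g q"
  have "conn (del_edges T {g}) x q" using conn_sym[OF is_graph_del] x(2) by (simp add: side_def)
  then have "q \<in> side T f p \<inter> S"
  proof (induction rule: conn_induct)
    case refl
    then show ?case using x by (simp add: S_def)
  next
    case (step y z e)
    have e: "e \<in> edges T" "e \<noteq> g" "ends T e = {y, z}" using step(2,3) by auto
    have z: "z \<in> S" using step.IH e unfolding S_def by (intro side_step[of y g q e z]) auto
    have "e \<noteq> f"
    proof
      assume "e = f"
      then have "y = s \<or> z = s" using e(3) f(2) by (auto simp: doubleton_eq_iff)
      then show False using z step.IH sq by (auto simp: S_def)
    qed
    then have "z \<in> side T f p" using step.IH e by (intro side_step[of y f p e z]) auto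
    then show ?case using z by blast
  qed
  then have "s \<in> side T f p"
    using g fg by (intro side_step[of q f p g s]) (auto simp: insert_commute)
  then show False using sp by blast
qed

end

section \<open>From tree-cut decompositions to dismantlable sets\<close>

locale tree_cut = tree T for T :: "('t, 'f) mgraph" +
  fixes G :: "('v, 'e) mgraph" and X :: "'t \<Rightarrow> 'v set"
  assumes G: "is_graph G" and X: "near_partition (verts G) (verts T) X"
begin

lemma X_disjoint: "s \<in> verts T \<Longrightarrow> t \<in> verts T \<Longrightarrow> s \<noteq> t \<Longrightarrow> X s \<inter> X t = {}"
  using X by (simp add: near_partition_def)

lemma X_cover: "bags X (verts T) = verts G"
  using X by (simp add: near_partition_def bags_def)

lemma in_bags_iff:
  assumes "S \<subseteq> verts T" "t \<in> verts T" "u \<in> X t"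
  shows "u \<in> bags X S \<longleftrightarrow> t \<in> S"
proof
  assume "u \<in> bags X S"
  then obtain t' where "t' \<in> S" "u \<in> X t'" by (auto simp: bags_def)
  then show "t \<in> S" using X_disjoint[of t t'] assms by blast
qed (use assms in \<open>auto simp: bags_def\<close>)

text \<open>Deleting \<open>f\<close> leaves exactly two components, so lying in different ones
  means that exactly one of two nodes is on the side of \<open>s\<close>.\<close>

lemma adh_eq_cut:
  assumes f: "f \<in> edges T" "ends T f = {s, p}"
  shows "adh G T X f = cut G (bags X (side T f s))"
proof -
  let ?H = "del_edges T {f}" and ?S = "side T f s"
  have sep: "conn_comp ?H a \<noteq> conn_comp ?H b \<longleftrightarrow> (a \<in> ?S) \<noteq> (b \<in> ?S)"
    if a: "a \<in> verts T" and b: "b \<in> verts T" for a b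
  proof -
    have "conn ?H a b \<longleftrightarrow> (a \<in> ?S) = (b \<in> ?S)"
    proof
      assume c: "conn ?H a b"
      show "(a \<in> ?S) = (b \<in> ?S)"
        using conn_trans[OF _ c] conn_trans[OF _ conn_sym[OF is_graph_del c]] by (auto simp: side_def)
    next
      assume eq: "(a \<in> ?S) = (b \<in> ?S)"
      have "\<exists>r. conn ?H r a \<and> conn ?H r b"
      proof (cases "a \<in> ?S")
        case True
        then show ?thesis using eq by (auto simp: side_def)
      next
        case False
        then have "a \<in> side T f p" "b \<in> side T f p" using eq a b side_cover[OF f] by blast+
        then show ?thesis by (auto simp: side_def)
      qed
      then show "conn ?H a b" using conn_sym[OF is_graph_del] conn_trans by metis
    qed
    then show ?thesis using conn_comp_eq_iff[where G = ?H and u = a and v = b, OF is_graph_del] a b by simp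
  qed
  have "e \<in> adh G T X f \<longleftrightarrow> e \<in> cut G (bags X ?S)" if e: "e \<in> edges G" for e
  proof -
    obtain u v where uv: "ends G e = {u, v}" "u \<in> verts G" "v \<in> verts G"
      using is_graph_ends[OF G e] by metis
    obtain a where a: "a \<in> verts T" "u \<in> X a" using uv(2) X_cover by (auto simp: bags_def)
    obtain b where b: "b \<in> verts T" "v \<in> X b" using uv(3) X_cover by (auto simp: bags_def)
    have cut: "e \<in> cut G (bags X ?S) \<longleftrightarrow> (a \<in> ?S) \<noteq> (b \<in> ?S)"
      using in_cut_iff[OF G e uv(1), of "bags X ?S"] in_bags_iff[where S = ?S, OF side_verts a]
        in_bags_iff[where S = ?S, OF side_verts b] by simp
    show ?thesis
    proof
      assume "e \<in> adh G T X f"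
      then obtain u' v' a' b' where h: "ends G e = {u', v'}" "a' \<in> verts T" "b' \<in> verts T"
        "u' \<in> X a'" "v' \<in> X b'" "conn_comp ?H a' \<noteq> conn_comp ?H b'"
        unfolding adh_def by blast
      have "(a' \<in> ?S) \<noteq> (b' \<in> ?S)" using sep[OF h(2,3)] h(6) by simp
      then show "e \<in> cut G (bags X ?S)"
        using in_cut_iff[OF G e h(1), of "bags X ?S"] in_bags_iff[where S = ?S, OF side_verts h(2,4)]
          in_bags_iff[where S = ?S, OF side_verts h(3,5)] by simp
    next
      assume "e \<in> cut G (bags X ?S)"
      then have "conn_comp ?H a \<noteq> conn_comp ?H b" using sep[OF a(1) b(1)] cut by simp
      then show "e \<in> adh G T X f" unfolding adh_def using e uv(1) a b by blast
    qed
  qed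
  moreover have "adh G T X f \<subseteq> edges G" by (auto simp: adh_def)
  ultimately show ?thesis using cut_subset[of G "bags X ?S"] by blast
qed

lemma bold_cut_subset_adh_node:
  assumes f: "f \<in> edges T" "ends T f = {s, p}"
  shows "bold_cut G (bags X (side T f s)) \<subseteq> adh_node G T X s"
    and "bold_cut G (bags X (side T f p)) \<subseteq> adh_node G T X s"
proof -
  have "adh G T X f \<subseteq> adh_node G T X s" if "3 \<le> card (adh G T X f)"
    using f that by (auto simp: adh_node_def bold_def)
  moreover have "adh G T X f = cut G (bags X (side T f s))" using f by (rule adh_eq_cut)
  moreover have "adh G T X f = cut G (bags X (side T f p))"
    using f by (intro adh_eq_cut) (auto simp: insert_commute)
  ultimately show "bold_cut G (bags X (side T f s)) \<subseteq> adh_node G T X s"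
    "bold_cut G (bags X (side T f p)) \<subseteq> adh_node G T X s"
    by (simp_all add: bold_cut_def)
qed

lemma adh_node_subset: "adh_node G T X t \<subseteq> edges G"
  by (auto simp: adh_node_def adh_def)

context
  fixes k :: nat
  assumes adhesion: "\<And>t. t \<in> verts T \<Longrightarrow> card (adh_node G T X t) < k"
    and bag: "\<And>t. t \<in> verts T \<Longrightarrow> card (X t) < k"
begin

text \<open>\<open>E\<close> lists the branches regarded as children: all but one edge at
  \<open>s\<close> in the recursion, all of them at the root.\<close>

lemma dismantlable_at_node:
  assumes s: "s \<in> verts T"
    and E: "\<And>f p. (f, p) \<in> E \<Longrightarrow> f \<in> edges T \<and> ends T f = {s, p} \<and>
      dismantlable G k (small_sets G k) (bags X (side T f p))"
    and Y: "Y = X s \<union> (\<Union>(f, p)\<in>E. bags X (side T f p))" "bold_cut G Y \<subseteq> adh_node G T X s"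
  shows "dismantlable G k (small_sets G k) Y"
proof -
  \<comment> \<open>Branches with only empty bags coincide in this set; they contribute neither
    vertices nor cuts.\<close>
  let ?\<Y> = "(\<lambda>(f, p). bags X (side T f p)) ` E"
  have eq: "Y = X s \<union> \<Union> ?\<Y>" using Y(1) by simp
  have "dismantlable G k (small_sets G k) (X s \<union> \<Union> ?\<Y>)"
  proof (rule dismantlable.node)
    show "dismantlable G k (small_sets G k) Z" if Z: "Z \<in> ?\<Y>" for Z using Z E by auto
    show "disjoint ?\<Y>"
    proof (rule disjointI)
      fix Z Z' assume Z: "Z \<in> ?\<Y>" "Z' \<in> ?\<Y>" "Z \<noteq> Z'"
      obtain f p where f: "(f, p) \<in> E" "Z = bags X (side T f p)" using Z(1) by auto
      obtain g q where g: "(g, q) \<in> E" "Z' = bags X (side T g q)" using Z(2) by auto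
      have fp: "f \<in> edges T" "ends T f = {s, p}" and gq: "g \<in> edges T" "ends T g = {s, q}"
        using E f(1) g(1) by blast+
      have "f \<noteq> g"
      proof
        assume "f = g"
        then have "p = q" using fp(2) gq(2) by (auto simp: doubleton_eq_iff)
        then show False using \<open>f = g\<close> f g Z(3) by simp
      qed
      then have disj: "side T f p \<inter> side T g q = {}" using branch_disjoint[OF fp gq] by blast
      show "Z \<inter> Z' = {}"
      proof (rule ccontr)
        assume "Z \<inter> Z' \<noteq> {}"
        then obtain u a b where "u \<in> X a" "u \<in> X b" "a \<in> side T f p" "b \<in> side T g q"
          unfolding f(2) g(2) bags_def by blast
        then show False using X_disjoint[of a b] side_verts disj by blast
      qed
    qed
    show "X s \<inter> \<Union> ?\<Y> = {}"
    proof (rule ccontr)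
      assume "X s \<inter> \<Union> ?\<Y> \<noteq> {}"
      then obtain u f p where u: "u \<in> X s" "(f, p) \<in> E" "u \<in> bags X (side T f p)" by auto
      have fp: "f \<in> edges T" "ends T f = {s, p}" using E u(2) by blast+
      have "s \<in> side T f p" using in_bags_iff[OF side_verts s u(1)] u(3) by blast
      then show False using side_disjoint[OF fp] side_self[OF s] by blast
    qed
    show "X s \<subseteq> verts G" using s X_cover by (auto simp: bags_def)
    show "card (X s) < k" using s by (rule bag)
    have "bold_cut G Z \<subseteq> adh_node G T X s" if Z: "Z \<in> ?\<Y>" for Z
    proof -
      obtain f p where f: "(f, p) \<in> E" "Z = bags X (side T f p)" using Z by auto
      then show ?thesis using bold_cut_subset_adh_node(2)[of f s p] E by blast
    qed
    then have "bold_cut G (X s \<union> \<Union> ?\<Y>) \<union> (\<Union>Z\<in>?\<Y>. bold_cut G Z) \<subseteq> adh_node G T X s"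
      using Y(2) unfolding eq by blast
    then have "card (bold_cut G (X s \<union> \<Union> ?\<Y>) \<union> (\<Union>Z\<in>?\<Y>. bold_cut G Z)) \<le> card (adh_node G T X s)"
      by (intro card_mono finite_edge_set[OF G adh_node_subset])
    then show "card (bold_cut G (X s \<union> \<Union> ?\<Y>) \<union> (\<Union>Z\<in>?\<Y>. bold_cut G Z)) < k"
      using adhesion[OF s] by linarith
  qed
  then show ?thesis by (simp only: eq)
qed

text \<open>No root is fixed: the end \<open>p\<close> of \<open>f\<close> takes the place of the
  parent, and the branches at \<open>s\<close> other than the one through \<open>f\<close> have
  fewer nodes than the side of \<open>s\<close>.\<close>

lemma dismantlable_side:
  "f \<in> edges T \<Longrightarrow> ends T f = {s, p} \<Longrightarrow> dismantlable G k (small_sets G k) (bags X (side T f s))"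
proof (induction "card (side T f s)" arbitrary: f s p rule: less_induct)
  case less
  note f = less.prems
  have s: "s \<in> verts T" using edge_verts[OF f] by blast
  let ?E = "{(g, q). g \<in> edges T \<and> ends T g = {s, q} \<and> g \<noteq> f}"
  have sub: "side T g q \<subset> side T f s" if g: "(g, q) \<in> ?E" for g q
  proof -
    have gq: "g \<in> edges T" "ends T g = {s, q}" "g \<noteq> f" using g by auto
    have "side T g q \<inter> side T f p = {}" using branch_disjoint[OF gq(1,2) f gq(3)] .
    then have "side T g q \<subseteq> side T f s" using side_cover[OF f] side_verts by blast
    moreover have "s \<in> side T f s" "s \<notin> side T g q"
      using side_self[OF s] side_disjoint[OF gq(1,2)] by blast+
    ultimately show ?thesis by blast
  qed
  show ?case
  proof (rule dismantlable_at_node[OF s, of ?E])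
    fix g q assume g: "(g, q) \<in> ?E"
    have "finite (side T f s)" using side_verts is_graph_finite(1)[OF is_graph_tree]
      by (rule finite_subset)
    then have "card (side T g q) < card (side T f s)" using sub[OF g] by (rule psubset_card_mono)
    moreover have "ends T g = {q, s}" using g by (auto simp: insert_commute)
    ultimately have "dismantlable G k (small_sets G k) (bags X (side T g q))"
      using g less.hyps by blast
    then show "g \<in> edges T \<and> ends T g = {s, q} \<and> dismantlable G k (small_sets G k) (bags X (side T g q))"
      using g by auto
  next
    have "side T f s = {s} \<union> (\<Union>(g, q)\<in>?E. side T g q)"
    proof
      show "{s} \<union> (\<Union>(g, q)\<in>?E. side T g q) \<subseteq> side T f s" using sub side_self[OF s] by fast
      show "side T f s \<subseteq> {s} \<union> (\<Union>(g, q)\<in>?E. side T g q)"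
      proof
        fix x assume x: "x \<in> side T f s"
        then have xT: "x \<in> verts T" using side_verts by blast
        show "x \<in> {s} \<union> (\<Union>(g, q)\<in>?E. side T g q)"
        proof (cases "x = s")
          case False
          then obtain g q where g: "g \<in> edges T" "ends T g = {s, q}" "x \<in> side T g q"
            using branch_cover[OF s xT] by blast
          have "g \<noteq> f"
          proof
            assume "g = f"
            then have "q = p" using g(2) f(2) by (auto simp: doubleton_eq_iff)
            then show False using g(3) x side_disjoint[OF f] \<open>g = f\<close> by blast
          qed
          then show ?thesis using g by auto
        qed simp
      qed
    qed
    then show "bags X (side T f s) = X s \<union> (\<Union>(g, q)\<in>?E. bags X (side T g q))"
      unfolding bags_def by auto
    show "bold_cut G (bags X (side T f s)) \<subseteq> adh_node G T X s"
      using f by (rule bold_cut_subset_adh_node(1))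
  qed
qed

lemma dismantlable_verts: "dismantlable G k (small_sets G k) (verts G)"
proof -
  obtain s where s: "s \<in> verts T" using T connected_graph_iff[OF is_graph_tree] by (auto simp: is_tree_def)
  let ?E = "{(g, q). g \<in> edges T \<and> ends T g = {s, q}}"
  show ?thesis
  proof (rule dismantlable_at_node[OF s, of ?E])
    fix g q assume g: "(g, q) \<in> ?E"
    then have "ends T g = {q, s}" by (auto simp: insert_commute)
    then show "g \<in> edges T \<and> ends T g = {s, q} \<and> dismantlable G k (small_sets G k) (bags X (side T g q))"
      using g dismantlable_side[of g q s] by auto
  next
    have "verts T = {s} \<union> (\<Union>(g, q)\<in>?E. side T g q)"
    proof
      show "{s} \<union> (\<Union>(g, q)\<in>?E. side T g q) \<subseteq> verts T" using s side_verts by fast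
      show "verts T \<subseteq> {s} \<union> (\<Union>(g, q)\<in>?E. side T g q)" using branch_cover[OF s] by auto
    qed
    then have "bags X (verts T) = X s \<union> (\<Union>(g, q)\<in>?E. bags X (side T g q))"
      unfolding bags_def by auto
    then show "verts G = X s \<union> (\<Union>(g, q)\<in>?E. bags X (side T g q))" by (simp only: X_cover)
  qed (simp add: bold_cut_verts[OF G])
qed

end

end

section \<open>From dismantlable sets to tree-cut decompositions\<close>

definition below :: "nat list set \<Rightarrow> (nat list \<Rightarrow> 'v set) \<Rightarrow> nat list \<Rightarrow> 'v set" where
  "below N \<beta> p = (\<Union>r\<in>{r. p @ r \<in> N}. \<beta> (p @ r))"

text \<open>The first term stands for the edge to the parent. At the root it anticipates the edge by
  which the piece will be attached; it is empty if the piece covers \<open>V(G)\<close>.\<close>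

definition node_cuts :: "('v, 'e) mgraph \<Rightarrow> nat list set \<Rightarrow> (nat list \<Rightarrow> 'v set) \<Rightarrow> nat list \<Rightarrow> 'e set" where
  "node_cuts G N \<beta> p = bold_cut G (below N \<beta> p) \<union> (\<Union>i\<in>{i. p @ [i] \<in> N}. bold_cut G (below N \<beta> (p @ [i])))"

text \<open>A rooted tree is encoded by a set of positions that is closed under prefixes; the parent of a
  nonempty position is \<^const>\<open>butlast\<close>.\<close>

definition rooted_decomp ::
  "('v, 'e) mgraph \<Rightarrow> nat \<Rightarrow> nat list set \<Rightarrow> (nat list \<Rightarrow> 'v set) \<Rightarrow> 'v set \<Rightarrow> bool" where
  "rooted_decomp G k N \<beta> Y \<longleftrightarrow> finite N \<and> [] \<in> N \<and> (\<forall>p i. p @ [i] \<in> N \<longrightarrow> p \<in> N) \<and>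
     (\<forall>p\<in>N. \<forall>q\<in>N. p \<noteq> q \<longrightarrow> \<beta> p \<inter> \<beta> q = {}) \<and> below N \<beta> [] = Y \<and>
     (\<forall>p\<in>N. card (\<beta> p) < k) \<and> (\<forall>p\<in>N. card (node_cuts G N \<beta> p) < k)"

lemma below_root: "below N \<beta> [] = (\<Union>p\<in>N. \<beta> p)"
  by (simp add: below_def)

lemma dismantlable_imp_rooted_decomp:
  assumes G: "is_graph G" and "dismantlable G k (small_sets G k) Y"
  shows "\<exists>N \<beta>. rooted_decomp G k N \<beta> Y"
  using assms(2)
proof (induction rule: dismantlable.induct)
  case (leaf Y)
  have b: "below {[]} (\<lambda>_. Y) [] = Y" by (simp add: below_root)
  have "rooted_decomp G k {[]} (\<lambda>_. Y) Y"
    using leaf by (simp add: rooted_decomp_def node_cuts_def b small_sets_def)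
  then show ?case by blast
next
  case (node \<Y> B)
  let ?Y = "B \<union> \<Union> \<Y>"
  have "Z \<subseteq> verts G" if "Z \<in> \<Y>" for Z using node.hyps(1)[OF that] by (rule dismantlable_subset)
  then have "\<Y> \<subseteq> Pow (verts G)" by blast
  then have "finite \<Y>" using is_graph_finite(1)[OF G] by (simp add: finite_subset)
  \<comment> \<open>Children form a set of vertex sets; an injection into the naturals supplies the
    letters of their positions.\<close>
  then obtain idx :: "'a set \<Rightarrow> nat" where idx: "inj_on idx \<Y>"
    using finite_imp_inj_to_nat_seg by metis
  have "\<forall>Z\<in>\<Y>. \<exists>M. rooted_decomp G k (fst M) (snd M) Z" using node.IH by force
  then have "\<exists>M. \<forall>Z\<in>\<Y>. rooted_decomp G k (fst (M Z)) (snd (M Z)) Z" by (rule bchoice)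
  then obtain M where M: "\<And>Z. Z \<in> \<Y> \<Longrightarrow> rooted_decomp G k (fst (M Z)) (snd (M Z)) Z" by blast
  define n where "n Z = fst (M Z)" for Z
  define b where "b Z = snd (M Z)" for Z
  have nb: "rooted_decomp G k (n Z) (b Z) Z" if "Z \<in> \<Y>" for Z using M[OF that] by (simp add: n_def b_def)
  define N where "N = insert [] {idx Z # p | Z p. Z \<in> \<Y> \<and> p \<in> n Z}"
  define \<beta> where "\<beta> l = (case l of [] \<Rightarrow> B | i # p \<Rightarrow> b (the_inv_into \<Y> idx i) p)" for l
  have N_iff: "idx Z # p \<in> N \<longleftrightarrow> p \<in> n Z" if "Z \<in> \<Y>" for Z p
    using that idx by (auto simp: N_def dest: inj_onD)
  have N_cases: "\<exists>Z\<in>\<Y>. i = idx Z \<and> p \<in> n Z" if "i # p \<in> N" for i p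
    using that by (auto simp: N_def)
  have \<beta>_Cons: "\<beta> (idx Z # p) = b Z p" if "Z \<in> \<Y>" for Z p
    using that idx by (simp add: \<beta>_def the_inv_into_f_f)
  \<comment> \<open>\<open>below\<close> ranges over suffixes, so grafting a child's tree under a
    new first letter leaves its sets unchanged.\<close>
  have below_Cons: "below N \<beta> (idx Z # p) = below (n Z) (b Z) p" if "Z \<in> \<Y>" for Z p
    using that by (simp add: below_def N_iff \<beta>_Cons)
  have below_nb: "below (n Z) (b Z) [] = Z" if "Z \<in> \<Y>" for Z
    using nb[OF that] by (simp add: rooted_decomp_def)
  have b_sub: "b Z p \<subseteq> Z" if "Z \<in> \<Y>" "p \<in> n Z" for Z p
    using below_nb[OF that(1)] that(2) by (auto simp: below_root)
  have below_Nil: "below N \<beta> [] = ?Y"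
  proof -
    have "below N \<beta> [] = \<beta> [] \<union> (\<Union>Z\<in>\<Y>. \<Union>p\<in>n Z. \<beta> (idx Z # p))"
      unfolding below_root N_def by blast
    also have "\<dots> = B \<union> (\<Union>Z\<in>\<Y>. below (n Z) (b Z) [])"
      by (simp add: \<beta>_Cons below_root) (simp add: \<beta>_def)
    finally show ?thesis by (simp add: below_nb)
  qed
  have "rooted_decomp G k N \<beta> ?Y"
    unfolding rooted_decomp_def
  proof (intro conjI ballI allI impI)
    have "N = insert [] (\<Union>Z\<in>\<Y>. (\<lambda>p. idx Z # p) ` n Z)" by (auto simp: N_def)
    then show "finite N" using \<open>finite \<Y>\<close> nb by (simp add: rooted_decomp_def)
    show "[] \<in> N" by (simp add: N_def)
    show "below N \<beta> [] = ?Y" by (rule below_Nil)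
  next
    fix p i assume pi: "p @ [i] \<in> N"
    show "p \<in> N"
    proof (cases p)
      case (Cons j p')
      then obtain Z where Z: "Z \<in> \<Y>" "j = idx Z" "p' @ [i] \<in> n Z" using N_cases pi by auto
      then have "p' \<in> n Z" using nb[OF Z(1)] unfolding rooted_decomp_def by blast
      then show ?thesis using Cons Z N_iff by simp
    qed (simp add: N_def)
  next
    fix p q assume p: "p \<in> N" and q: "q \<in> N" and pq: "p \<noteq> q"
    have *: "B \<inter> \<beta> (i # r) = {}" if r: "i # r \<in> N" for i r
    proof -
      obtain Z where Z: "Z \<in> \<Y>" "i = idx Z" "r \<in> n Z" using N_cases[OF r] by blast
      then show ?thesis using b_sub[OF Z(1,3)] node.hyps(3) by (auto simp: \<beta>_Cons)
    qed
    have Nil: "\<beta> [] = B" by (simp add: \<beta>_def)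
    show "\<beta> p \<inter> \<beta> q = {}"
    proof (cases p)
      case p0: Nil
      then obtain j q' where "q = j # q'" using pq by (cases q) auto
      then show ?thesis using p0 * q Nil by simp
    next
      case p0: (Cons i p')
      show ?thesis
      proof (cases q)
        case q0: Nil
        then show ?thesis using p0 * p Nil by (simp add: Int_commute)
      next
        case q0: (Cons j q')
        obtain Z where Z: "Z \<in> \<Y>" "i = idx Z" "p' \<in> n Z" using N_cases p p0 by blast
        obtain Z' where Z': "Z' \<in> \<Y>" "j = idx Z'" "q' \<in> n Z'" using N_cases q q0 by blast
        have eq: "\<beta> p = b Z p'" "\<beta> q = b Z' q'" using p0 q0 Z Z' \<beta>_Cons by simp_all
        show ?thesis
        proof (cases "Z = Z'")
          case True
          then have "p' \<noteq> q'" using pq p0 q0 Z(2) Z'(2) by blast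
          then show ?thesis using nb[OF Z(1)] Z(3) Z'(3) True unfolding eq rooted_decomp_def by blast
        next
          case False
          then have "Z \<inter> Z' = {}" using node.hyps(2) Z(1) Z'(1) by (auto dest: disjointD)
          then show ?thesis using b_sub[OF Z(1,3)] b_sub[OF Z'(1,3)] unfolding eq by blast
        qed
      qed
    qed
  next
    fix p assume p: "p \<in> N"
    show "card (\<beta> p) < k"
    proof (cases p)
      case Nil
      then show ?thesis using node.hyps(5) by (simp add: \<beta>_def)
    next
      case (Cons i p')
      then obtain Z where Z: "Z \<in> \<Y>" "i = idx Z" "p' \<in> n Z" using N_cases p by blast
      then show ?thesis using nb[OF Z(1)] Cons by (simp add: rooted_decomp_def \<beta>_Cons)
    qed
  next
    fix p assume p: "p \<in> N"
    show "card (node_cuts G N \<beta> p) < k"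
    proof (cases p)
      case Nil
      have "node_cuts G N \<beta> p \<subseteq> bold_cut G ?Y \<union> (\<Union>Z\<in>\<Y>. bold_cut G Z)"
      proof -
        have "bold_cut G (below N \<beta> [i]) \<subseteq> (\<Union>Z\<in>\<Y>. bold_cut G Z)" if i: "[i] \<in> N" for i
        proof -
          obtain Z where Z: "Z \<in> \<Y>" "i = idx Z" using N_cases[OF i] by blast
          then have "below N \<beta> [i] = Z" using below_Cons below_nb by simp
          then show ?thesis using Z(1) by blast
        qed
        then show ?thesis unfolding node_cuts_def Nil below_Nil by auto
      qed
      then have "card (node_cuts G N \<beta> p) \<le> card (bold_cut G ?Y \<union> (\<Union>Z\<in>\<Y>. bold_cut G Z))"
        by (rule card_mono[OF finite_edge_set[OF G bold_cuts_subset]])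
      then show ?thesis using node.hyps(6) by linarith
    next
      case (Cons i p')
      then obtain Z where Z: "Z \<in> \<Y>" "i = idx Z" "p' \<in> n Z" using N_cases p by blast
      have "node_cuts G N \<beta> p = node_cuts G (n Z) (b Z) p'"
        unfolding node_cuts_def using Cons Z by (simp add: below_Cons N_iff)
      then show ?thesis using nb[OF Z(1)] Z(3) by (simp add: rooted_decomp_def)
    qed
  qed
  then show ?case by blast
qed

text \<open>An edge is named by its lower end, so nodes and edges share one encoding. Positions are
  coded as numbers because the width refers to trees over \<open>nat\<close>.\<close>

definition position_tree :: "nat list set \<Rightarrow> (nat, nat) mgraph" where
  "position_tree N = \<lparr>verts = to_nat ` N, edges = to_nat ` (N - {[]}),
     ends = (\<lambda>f. {f, to_nat (butlast (from_nat f :: nat list))})\<rparr>"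

lemma position_tree_simps [simp]:
  "verts (position_tree N) = to_nat ` N" "edges (position_tree N) = to_nat ` (N - {[]})"
  "ends (position_tree N) (to_nat (p :: nat list)) = {to_nat p, to_nat (butlast p)}"
  by (simp_all add: position_tree_def)

lemma to_nat_eq: "to_nat (p :: nat list) = to_nat q \<longleftrightarrow> p = q"
  by (simp add: inj_eq)

locale positions =
  fixes N :: "nat list set"
  assumes finN: "finite N" and root: "[] \<in> N" and prefix_closed: "p @ [i] \<in> N \<Longrightarrow> p \<in> N"
begin

abbreviation "T \<equiv> position_tree N"

lemma butlast_in: "p \<in> N \<Longrightarrow> p \<noteq> [] \<Longrightarrow> butlast p \<in> N"
  by (metis append_butlast_last_id prefix_closed)

lemma graph_T: "is_graph T"
proof -
  have "ends T e \<subseteq> verts T \<and> card (ends T e) = 2" if e: "e \<in> edges T" for e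
  proof -
    obtain p where p: "e = to_nat p" "p \<in> N" "p \<noteq> []" using e by auto
    then have "butlast p \<noteq> p" by (metis append_butlast_last_id append_self_conv list.distinct(1))
    then show ?thesis using p butlast_in[OF p(2,3)] by (simp add: to_nat_eq)
  qed
  then show ?thesis using finN by (auto simp: is_graph_def)
qed

definition descendants :: "nat list \<Rightarrow> nat set" where
  "descendants p = {to_nat (p @ r) | r. p @ r \<in> N}"

lemma in_descendants: "to_nat q \<in> descendants p \<longleftrightarrow> q \<in> N \<and> (\<exists>r. q = p @ r)"
  by (auto simp: descendants_def to_nat_eq)

lemma descendants_step:
  assumes q: "q \<in> N" "q \<noteq> []" "q \<noteq> p"
  shows "to_nat q \<in> descendants p \<longleftrightarrow> to_nat (butlast q) \<in> descendants p"
proof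
  assume "to_nat q \<in> descendants p"
  then obtain r where r: "q = p @ r" by (auto simp: in_descendants)
  then have "butlast q = p @ butlast r" using q(3) by (simp add: butlast_append)
  then show "to_nat (butlast q) \<in> descendants p" using butlast_in[OF q(1,2)] by (auto simp: in_descendants)
next
  assume "to_nat (butlast q) \<in> descendants p"
  then obtain r where "butlast q = p @ r" by (auto simp: in_descendants)
  then have "q = p @ (r @ [last q])" using q(2) by (metis append_assoc append_butlast_last_id)
  then show "to_nat q \<in> descendants p" using q(1) in_descendants by blast
qed

lemma conn_descendants:
  assumes "conn (del_edges T {to_nat p}) x y"
  shows "x \<in> descendants p \<longleftrightarrow> y \<in> descendants p"
  using assms
proof (induction rule: conn_induct)
  case (step y z e)
  then obtain q where q: "e = to_nat q" "q \<in> N" "q \<noteq> []" "q \<noteq> p" by auto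
  then have "{y, z} = {to_nat q, to_nat (butlast q)}" using step(3) by simp
  then have "(y \<in> descendants p) = (z \<in> descendants p)"
    using descendants_step[OF q(2-4)] by (auto simp: doubleton_eq_iff)
  then show ?case using step.IH by simp
qed simp

lemma conn_down:
  assumes "F \<subseteq> {to_nat p}" "p @ r \<in> N"
  shows "conn (del_edges T F) (to_nat p) (to_nat (p @ r))"
  using assms(2)
proof (induction r rule: rev_induct)
  case Nil
  then show ?case by (simp add: conn_refl)
next
  case (snoc i r)
  have pr: "p @ r \<in> N" using snoc.prems prefix_closed[of "p @ r" i] by simp
  let ?q = "p @ r @ [i]"
  have "butlast ?q = p @ r" by (simp add: butlast_append)
  then have ends: "ends T (to_nat ?q) = {to_nat (p @ r), to_nat ?q}"
    using position_tree_simps(3)[of N ?q] by (simp add: insert_commute)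
  have "to_nat ?q \<notin> F" using assms(1) to_nat_eq[of ?q p] by auto
  then have "to_nat ?q \<in> edges (del_edges T F)" using snoc.prems by auto
  moreover have "ends (del_edges T F) (to_nat ?q) = {to_nat (p @ r), to_nat ?q}" using ends by simp
  ultimately show ?case by (rule conn_step[OF snoc.IH[OF pr]])
qed

lemma tree_T: "is_tree T"
proof -
  have all: "conn T (to_nat ([] :: nat list)) x" if x: "x \<in> verts T" for x
  proof -
    obtain p where p: "x = to_nat p" "p \<in> N" using x by auto
    have "conn (del_edges T {}) (to_nat ([] :: nat list)) (to_nat ([] @ p))" by (rule conn_down) (use p in simp_all)
    moreover have "del_edges T {} = T" by (simp add: del_edges_def position_tree_def)
    ultimately show ?thesis using p(1) by simp
  qed
  have "connected_graph T"
    unfolding connected_graph_iff[OF graph_T]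
  proof (intro conjI ballI)
    show "verts T \<noteq> {}" using root by auto
    show "conn T u v" if "u \<in> verts T" "v \<in> verts T" for u v
      using conn_trans[OF conn_sym[OF graph_T all] all] that by blast
  qed
  moreover have "\<not> is_cycle T vs es" for vs es
  \<comment> \<open>Every edge is a bridge: without the edge above \<open>p\<close>, nothing leads
    out of the descendants of \<open>p\<close>, and the parent of \<open>p\<close> is not among
    them.\<close>
  proof (rule bridges_imp_no_cycle[OF graph_T])
    fix f s t assume f: "f \<in> edges T" "ends T f = {s, t}"
    then obtain p where p: "f = to_nat p" "p \<in> N" "p \<noteq> []" by auto
    have "to_nat p \<in> descendants p" using p by (simp add: in_descendants)
    moreover have "to_nat (butlast p) \<notin> descendants p"
    proof
      assume "to_nat (butlast p) \<in> descendants p"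
      then obtain r where "butlast p = p @ r" by (auto simp: in_descendants)
      then have "length p - 1 = length p + length r" by (metis length_append length_butlast)
      moreover have "0 < length p" using p(3) by simp
      ultimately show False by linarith
    qed
    moreover have "{s, t} = {to_nat p, to_nat (butlast p)}" using f(2) p(1) by simp
    ultimately have "(s \<in> descendants p) \<noteq> (t \<in> descendants p)" by (auto simp: doubleton_eq_iff)
    then show "\<not> conn (del_edges T {f}) s t" using conn_descendants p(1) by blast
  qed
  ultimately show ?thesis using graph_T by (simp add: is_tree_def)
qed

lemma side_eq_descendants:
  assumes p: "p \<in> N" "p \<noteq> []"
  shows "side T (to_nat p) (to_nat p) = descendants p"
proof
  have self: "to_nat p \<in> descendants p" using p by (simp add: in_descendants)
  show "side T (to_nat p) (to_nat p) \<subseteq> descendants p"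
    using conn_descendants self by (auto simp: side_def)
  show "descendants p \<subseteq> side T (to_nat p) (to_nat p)"
    using p conn_down[where p = p and F = "{to_nat p}"] by (auto simp: side_def descendants_def)
qed

end

lemma rooted_decomp_imp_tree_cut:
  assumes G: "is_graph G" and d: "rooted_decomp G k N \<beta> (verts G)"
  shows "\<exists>(T :: (nat, nat) mgraph) X. tree_cut_decomp G T X \<and>
    (\<forall>t\<in>verts T. card (adh_node G T X t) < k) \<and> (\<forall>t\<in>verts T. card (X t) < k)"
proof -
  interpret positions N
    using d by unfold_locales (auto simp: rooted_decomp_def)
  define X where "X = (\<lambda>n. \<beta> (from_nat n))"
  have X_to_nat: "X (to_nat p) = \<beta> p" for p by (simp add: X_def)
  have part: "near_partition (verts G) (verts T) X"
    unfolding near_partition_def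
  proof (intro conjI ballI impI)
    fix i j assume ij: "i \<in> verts T" "j \<in> verts T" "i \<noteq> j"
    then obtain p q where "i = to_nat p" "j = to_nat q" "p \<in> N" "q \<in> N" "p \<noteq> q" by auto
    then show "X i \<inter> X j = {}" using d by (simp add: X_to_nat rooted_decomp_def)
  next
    show "(\<Union>i\<in>verts T. X i) = verts G" using d by (simp add: X_to_nat rooted_decomp_def below_root)
  qed
  interpret tree_cut T G X
    using tree_T G part by unfold_locales
  have adh: "adh G T X (to_nat p) = cut G (below N \<beta> p)" if p: "p \<in> N" "p \<noteq> []" for p
  proof -
    have "adh G T X (to_nat p) = cut G (bags X (side T (to_nat p) (to_nat p)))"
      by (rule adh_eq_cut[of _ _ "to_nat (butlast p)"]) (use p in simp_all)
    also have "bags X (side T (to_nat p) (to_nat p)) = below N \<beta> p"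
      unfolding side_eq_descendants[OF p] by (auto simp: bags_def descendants_def below_def X_to_nat)
    finally show ?thesis .
  qed
  have "card (adh_node G T X t) < k" if t: "t \<in> verts T" for t
  proof -
    obtain p where p: "t = to_nat p" "p \<in> N" using t by auto
    have "adh_node G T X t \<subseteq> node_cuts G N \<beta> p"
    proof
      fix e assume "e \<in> adh_node G T X t"
      then obtain f where f: "f \<in> edges T" "t \<in> ends T f" "bold G T X f" "e \<in> adh G T X f"
        unfolding adh_node_def by blast
      then obtain q where q: "f = to_nat q" "q \<in> N" "q \<noteq> []" by auto
      have e: "e \<in> bold_cut G (below N \<beta> q)"
        using f(3,4) adh[OF q(2,3)] q(1) by (simp add: bold_def bold_cut_def)
      have "p = q \<or> p = butlast q" using f(2) q(1) p(1) by (simp add: to_nat_eq)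
      then show "e \<in> node_cuts G N \<beta> p"
      proof
        assume "p = q"
        then show ?thesis using e by (simp add: node_cuts_def)
      next
        assume "p = butlast q"
        then have "q = p @ [last q]" using q(3) by simp
        then have "last q \<in> {i. p @ [i] \<in> N}" "e \<in> bold_cut G (below N \<beta> (p @ [last q]))"
          using q(2) e by simp_all
        then show ?thesis unfolding node_cuts_def by blast
      qed
    qed
    moreover have "node_cuts G N \<beta> p \<subseteq> edges G"
      using bold_cut_subset[of G] unfolding node_cuts_def by blast
    ultimately have "card (adh_node G T X t) \<le> card (node_cuts G N \<beta> p)"
      by (intro card_mono finite_edge_set[OF G])
    also have "\<dots> < k" using d p(2) by (simp add: rooted_decomp_def)
    finally show ?thesis .
  qed
  moreover have "card (X t) < k" if t: "t \<in> verts T" for t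
    using t d by (auto simp: X_to_nat rooted_decomp_def)
  moreover have "tree_cut_decomp G T X" using tree_T part by (simp add: tree_cut_decomp_def)
  ultimately show ?thesis by blast
qed

section \<open>Width and dismantlability\<close>

lemma width_le_iff_dismantlable:
  assumes G: "is_graph G"
  shows "(\<exists>(T :: (nat, nat) mgraph) X. tree_cut_decomp G T X \<and> adhesion_width G T X \<le> j \<and> bag_width T X \<le> j)
    \<longleftrightarrow> dismantlable G (Suc j) (small_sets G (Suc j)) (verts G)" (is "?l \<longleftrightarrow> ?r")
proof -
  \<comment> \<open>Widths are bounded weakly and dismantlability strictly, hence
    \<open>Suc j\<close>. The maxima are taken over finite nonempty sets because a tree has a
    node.\<close>
  have widths: "adhesion_width G T X \<le> j \<and> bag_width T X \<le> j \<longleftrightarrow>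
      (\<forall>t\<in>verts T. card (adh_node G T X t) < Suc j) \<and> (\<forall>t\<in>verts T. card (X t) < Suc j)"
    if "tree_cut_decomp G T X" for T :: "(nat, nat) mgraph" and X
  proof -
    have "is_graph T" "verts T \<noteq> {}"
      using that by (auto simp: tree_cut_decomp_def is_tree_def connected_graph_def)
    then have "finite (verts T)" by (simp add: is_graph_def)
    then show ?thesis using \<open>verts T \<noteq> {}\<close>
      by (simp add: adhesion_width_def bag_width_def less_Suc_eq_le)
  qed
  show ?thesis
  proof
    assume ?l
    then obtain T :: "(nat, nat) mgraph" and X where TX: "tree_cut_decomp G T X"
        "adhesion_width G T X \<le> j \<and> bag_width T X \<le> j" by blast
    interpret tree_cut T G X
      using TX(1) G by unfold_locales (auto simp: tree_cut_decomp_def)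
    show ?r using TX(2) unfolding widths[OF TX(1)] by (intro dismantlable_verts) blast+
  next
    assume ?r
    then obtain N \<beta> where "rooted_decomp G (Suc j) N \<beta> (verts G)"
      using dismantlable_imp_rooted_decomp[OF G] by blast
    then obtain T :: "(nat, nat) mgraph" and X where TX: "tree_cut_decomp G T X"
        "(\<forall>t\<in>verts T. card (adh_node G T X t) < Suc j) \<and> (\<forall>t\<in>verts T. card (X t) < Suc j)"
      using rooted_decomp_imp_tree_cut[OF G] by blast
    then show ?l using widths[OF TX(1)] by blast
  qed
qed

text \<open>The admissible bounds are closed upwards, so \<open>k\<close> is at most the least one
  exactly if \<open>k - 1\<close> is not admissible.\<close>

lemma width_ge_iff_undismantlable:
  assumes G: "is_graph G" and k: "0 < k"
  shows "k \<le> ab_tree_cut_width G \<longleftrightarrow> \<not> dismantlable G k (small_sets G k) (verts G)"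
proof -
  define P where "P j \<longleftrightarrow> (\<exists>(T :: (nat, nat) mgraph) X. tree_cut_decomp G T X \<and>
    adhesion_width G T X \<le> j \<and> bag_width T X \<le> j)" for j
  have P_iff: "P j \<longleftrightarrow> dismantlable G (Suc j) (small_sets G (Suc j)) (verts G)" for j
    unfolding P_def by (rule width_le_iff_dismantlable[OF G])
  have w: "ab_tree_cut_width G = (LEAST j. P j)" by (simp add: ab_tree_cut_width_def P_def)
  \<comment> \<open>A single node holding all vertices; without some admissible bound the value of
    \<open>LEAST\<close> would be arbitrary.\<close>
  have "P (card (verts G))"
    unfolding P_iff by (rule dismantlable.leaf) (simp_all add: small_sets_def bold_cut_verts[OF G])
  then have PL: "P (LEAST j. P j)" by (rule LeastI)
  have mono: "P j'" if "P j" "j \<le> j'" for j j' using that order_trans unfolding P_def by meson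
  have "k \<le> (LEAST j. P j) \<longleftrightarrow> \<not> P (k - 1)"
  proof
    assume "k \<le> (LEAST j. P j)"
    then show "\<not> P (k - 1)" using k by (intro not_less_Least) simp
  next
    assume "\<not> P (k - 1)"
    then show "k \<le> (LEAST j. P j)" using mono[OF PL, of "k - 1"] by linarith
  qed
  then show ?thesis using k by (simp add: w P_iff)
qed

text \<open>For \<open>k = 1\<close> all bags are empty, so only the empty set is dismantlable. This
  supplies the bramble in the case \<open>k = 1\<close>, which the tangle argument for
  \<open>3 \<le> k\<close> does not reach.\<close>

lemma has_bramble_of_order_ge_1:
  assumes G: "is_graph G" and "verts G \<noteq> {}"
  shows "has_bramble_of_order_ge G 1"
proof (rule undismantlable_imp_bramble[OF G])
  show "\<not> dismantlable G 1 (small_sets G 1) (verts G)"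
  proof
    have "Y = {}" if "dismantlable G 1 (small_sets G 1) Y" for Y
      using that
    proof (induction rule: dismantlable.induct)
      case (leaf Y)
      then have "finite Y" using finite_subset is_graph_finite(1)[OF G] by blast
      then show ?case using leaf(1) by (simp add: small_sets_def)
    next
      case (node \<Y> B)
      have "finite B" using node.hyps(4) is_graph_finite(1)[OF G] by (rule finite_subset)
      then have "B = {}" using node.hyps(5) by simp
      then show ?case using node.IH by blast
    qed
    moreover assume "dismantlable G 1 (small_sets G 1) (verts G)"
    ultimately show False using assms(2) by blast
  qed
qed simp

theorem corollary3p12:
  fixes G :: "('v, 'e) mgraph" and k :: nat
  assumes "is_graph G" and "verts G \<noteq> {}" and "0 < k"
  shows "(has_bramble_of_order_ge G k \<longleftrightarrow> ab_tree_cut_width G \<ge> k) \<and>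
         (has_bramble_of_order_ge G k \<longrightarrow> has_tangle_of_order_ge G k) \<and>
         (k \<noteq> 2 \<longrightarrow> has_tangle_of_order_ge G k \<longrightarrow> has_bramble_of_order_ge G k)"
proof (intro conjI impI)
  show "has_bramble_of_order_ge G k \<longleftrightarrow> ab_tree_cut_width G \<ge> k"
    using width_ge_iff_undismantlable bramble_imp_undismantlable undismantlable_imp_bramble assms
    by blast
  show "has_tangle_of_order_ge G k" if "has_bramble_of_order_ge G k"
    using assms(1,3) that by (rule bramble_imp_tangle)
  assume "k \<noteq> 2" and t: "has_tangle_of_order_ge G k"
  then consider "k = 1" | "3 \<le> k" using assms(3) by linarith
  then show "has_bramble_of_order_ge G k"
  proof cases
    case 1
    then show ?thesis using has_bramble_of_order_ge_1[OF assms(1,2)] by simp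
  next
    case 2
    obtain a b L where "tangle G a b L" "k \<le> a" "k \<le> b"
      using t unfolding has_tangle_of_order_ge_def by auto
    then show ?thesis
      using tangle_imp_undismantlable[OF assms(1) _ 2] undismantlable_imp_bramble[OF assms(1,3)] by blast
  qed
qed

end
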